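(* Let $(V,\omega,q)$ be a finite-dimensional dg $(-1)$-shifted symplectic vector space with a quantum master action $S=S_{\mathrm{free}}+S_{\mathrm{int}}$. Given two maximal non-degenerate isotropes $J,\tilde J\subset V$, the corresponding effective actions $W$, $\tilde W$ on the cohomology $H(V,q)$ are homotopic, i.e. the half-densities $e^{W/\hbar}\sqrt{dH}$ and $e^{\tilde W/\hbar}\sqrt{dH}$ on $H(V,q)$ differ by a $\Delta_H$-exact half-density.
   Context: $|\cdot|$ denotes degree. A $(-1)$-shifted symplectic vector space is a $\mathbb Z$-graded real vector space $V$ with an antisymmetric non-degenerate pairing $\omega$ of degree $-1$ (vanishing on arguments of total degree $\neq1$); it is dg if it has a degree $1$ differential $q$ with $\omega(qv,w)+(-1)^{|v|}\omega(v,qw)=0$. The adjoint is defined by $\omega(Ov,w)=(-1)^{|O||v|}\omega(v,O^\dagger w)$. $H(V,q)$ carries the induced symplectic form and zero differential. A graded isotropic subspace $J\subset V$ is non-degenerate if the pairing $(v,w)\mapsto(-1)^{|v|}\omega(qv,w)$ is non-degenerate on $J$. Then $J\oplus qJ$ is a symplectic subspace; let $k:V\to V$ be the degree $-1$ map equal to the inverse of $q:J\to qJ$ on $qJ$ and zero on $J$ and on $(J\oplus qJ)^\omega$. $J$ is called maximal if the reduction $J^\omega/J$ is isomorphic to $H(V,q)$; equivalently $qkq=q$. In that case there is a canonical chain map $p_k:V\to H(V,q)$, $p_k(v)=[(1-kq)v]$, and with $i_k=p_k^\dagger$ the triple $(p_k,i_k,k)$ is a cyclic special deformation retract: $1_V-i_kp_k=kq+qk$,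 $p_ki_k=1$, $k^2=0$, $p_kk=0$, $ki_k=0$, $k^\dagger=k$. $\mathcal F V:=\widehat{\operatorname{Sym}}\,V^*[[\hbar]]$. $Q$ is the derivation with $Q\phi=-(-1)^{|\phi|}\phi\circ q$ on $V^*$. The BV operator on $\mathcal F V$ is $\Delta=-\tfrac12\sum\partial_{\mathcal K'}\partial_{\mathcal K''}$, where $\sum\mathcal K'\otimes\mathcal K''\in V\otimes V$ is determined by $(-1)^{|v|}\sum\mathcal K'\,\omega(\mathcal K'',v)=v$, and $\partial_v$ is the derivation with $\partial_v\phi=(-1)^{|v|}\phi(v)$. $\Delta_H$ on $\mathcal F H(V,q)$ is defined in the same way from the induced symplectic form. The bracket is defined by $\Delta(FG)=(\Delta F)G+(-1)^{|F|}F\Delta G+(-1)^{|F|}\{F,G\}$, and $S_{\mathrm{free}}$ is the quadratic function with $\{S_{\mathrm{free}},-\}=Q$. A quantum master action is $S=S_{\mathrm{free}}+S_{\mathrm{int}}$ with $S_{\mathrm{int}}\in\mathcal F V$ of degree $0$ and $(Q+\hbar\Delta)e^{S_{\mathrm{int}}/\hbar}=0$. Exponentials are formal: a term of polynomial degree $n$ and order $\hbar^g$ has weight $n+2g$, $S_{\mathrm{int}}$ has only terms of weight $\ge3$, and exponentials live in $\prod_w\bigoplus_{n+2g=w}\operatorname{Sym}^nV^*\hbar^g$, $g\in\mathbb Z$. The effective action of $J$ on $H(V,q)$ is $W=\hbar\log P'(e^{S_{\mathrm{int}}/\hbar})$, where $P'=P(1-\hbar\Delta K+(\hbar\Delta K)^2-\cdots)$,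 $P=i_k^*$ is the induced algebra map, $K=\frac1{\#''}K_{\mathrm{un}}$, $K_{\mathrm{un}}$ is the derivation with $K_{\mathrm{un}}\phi=(-1)^{|\phi|}\phi\circ k$ on $V^*$, and $\#''$ counts the factors of a monomial from $(V'')^*$ for $V=V'\oplus V''$, $V'=\operatorname{Im}(i_kp_k)$, $V''=J\oplus qJ$ ($K=0$ if $\#''=0$). This $P'$ is the normalized BV fiber integral along the Lagrangian relation $\{(v-qkv,p_k(v))\mid v\in V\}$. $\sqrt{dH}$ is a constant half-density on $H(V,q)$ and $\Delta_H(F\sqrt{dH})=(\Delta_HF)\sqrt{dH}$. Two $\Delta_H$-closed half-densities are homotopic if their difference is $\Delta_H\varphi$ for some half-density $\varphi$ (here: $\varphi=F\sqrt{dH}$ with $F$ in the weight-completed space for $H(V,q)$). *)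

theory Defs
  imports "HOL-Analysis.Analysis" "HOL-Library.Groups_Big_Fun"
begin

section \<open>Graded vector spaces and subquotients\<close>

definition ksgn :: "int \<Rightarrow> real" where
  "ksgn d = (if even d then 1 else - 1)"

text \<open>
  A graded vector space is given by its homogeneous components and its linear operations.  The
  record allows quotient spaces, whose elements are cosets, next to spaces living on a type.
\<close>

record 'a gspace =
  hcomp :: "int \<Rightarrow> 'a set"
  vadd :: "'a \<Rightarrow> 'a \<Rightarrow> 'a"
  vscale :: "real \<Rightarrow> 'a \<Rightarrow> 'a"
  vzero :: 'a

definition whole :: "(int \<Rightarrow> 'v::real_vector set) \<Rightarrow> 'v gspace" where
  "whole V = \<lparr>hcomp = V, vadd = (+), vscale = (*\<^sub>R), vzero = 0\<rparr>"

definition coset :: "'v::real_vector set \<Rightarrow> 'v \<Rightarrow> 'v set" where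
  "coset B v = {v + b | b. b \<in> B}"

text \<open>The graded quotient \<open>A / B\<close> for graded subspaces \<open>B \<subseteq> A\<close>; adding \<open>B\<close> in
  the scalar multiplication matters for the scalar 0 only.\<close>

definition subquotient ::
  "(int \<Rightarrow> 'v::real_vector set) \<Rightarrow> 'v set \<Rightarrow> 'v set \<Rightarrow> 'v set gspace" where
  "subquotient V A B =
     \<lparr>hcomp = (\<lambda>d. coset B ` (A \<inter> V d)),
      vadd = (\<lambda>X Y. {x + y | x y. x \<in> X \<and> y \<in> Y}),
      vscale = (\<lambda>c X. {c *\<^sub>R x + b | x b. x \<in> X \<and> b \<in> B}),
      vzero = B\<rparr>"

definition gspace_iso :: "'a gspace \<Rightarrow> 'b gspace \<Rightarrow> bool" where
  "gspace_iso G G' \<longleftrightarrow>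
     (\<exists>f. \<forall>d. bij_betw f (hcomp G d) (hcomp G' d) \<and>
        (\<forall>x\<in>hcomp G d. \<forall>y\<in>hcomp G d. f (vadd G x y) = vadd G' (f x) (f y)) \<and>
        (\<forall>c. \<forall>x\<in>hcomp G d. f (vscale G c x) = vscale G' c (f x)))"

section \<open>Dg shifted symplectic vector spaces\<close>

definition graded_space :: "(int \<Rightarrow> 'v::real_vector set) \<Rightarrow> bool" where
  "graded_space V \<longleftrightarrow> (\<forall>d. subspace (V d)) \<and>
     (\<forall>v. \<exists>!c. (\<forall>d. c d \<in> V d) \<and> finite {d. c d \<noteq> 0} \<and> v = (\<Sum>d | c d \<noteq> 0. c d))"

definition shifted_symplectic ::
  "(int \<Rightarrow> 'v::real_vector set) \<Rightarrow> ('v \<Rightarrow> 'v \<Rightarrow> real) \<Rightarrow> bool" where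
  "shifted_symplectic V \<omega> \<longleftrightarrow> graded_space V \<and> bilinear \<omega> \<and>
     (\<forall>v w. \<omega> v w = - \<omega> w v) \<and>
     (\<forall>d e. \<forall>v\<in>V d. \<forall>w\<in>V e. d + e \<noteq> 1 \<longrightarrow> \<omega> v w = 0) \<and>
     (\<forall>v. (\<forall>w. \<omega> v w = 0) \<longrightarrow> v = 0)"

definition dg_shifted_symplectic ::
  "(int \<Rightarrow> 'v::real_vector set) \<Rightarrow> ('v \<Rightarrow> 'v \<Rightarrow> real) \<Rightarrow> ('v \<Rightarrow> 'v) \<Rightarrow> bool" where
  "dg_shifted_symplectic V \<omega> q \<longleftrightarrow> shifted_symplectic V \<omega> \<and>
     linear q \<and> (\<forall>d. \<forall>v\<in>V d. q v \<in> V (d + 1)) \<and> (\<forall>v. q (q v) = 0) \<and>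
     (\<forall>d. \<forall>v\<in>V d. \<forall>w. \<omega> (q v) w + ksgn d * \<omega> v (q w) = 0)"

definition finite_dimensional :: "'v::real_vector itself \<Rightarrow> bool" where
  "finite_dimensional _ \<longleftrightarrow> (\<exists>B::'v set. finite B \<and> span B = UNIV)"

definition cohomology ::
  "(int \<Rightarrow> 'v::real_vector set) \<Rightarrow> ('v \<Rightarrow> 'v) \<Rightarrow> 'v set gspace" where
  "cohomology V q = subquotient V {v. q v = 0} (range q)"

definition induced_form :: "('v \<Rightarrow> 'v \<Rightarrow> real) \<Rightarrow> 'v set \<Rightarrow> 'v set \<Rightarrow> real" where
  "induced_form \<omega> X Y = (THE r. \<forall>x\<in>X. \<forall>y\<in>Y. \<omega> x y = r)"

section \<open>Non-degenerate isotropes\<close>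

definition graded_subspace :: "(int \<Rightarrow> 'v::real_vector set) \<Rightarrow> 'v set \<Rightarrow> bool" where
  "graded_subspace V J \<longleftrightarrow> subspace J \<and> J \<subseteq> span (\<Union>d. J \<inter> V d)"

definition orth :: "('v \<Rightarrow> 'v \<Rightarrow> real) \<Rightarrow> 'v set \<Rightarrow> 'v set" where
  "orth \<omega> J = {v. \<forall>w\<in>J. \<omega> v w = 0}"

text \<open>The pairing \<open>(-1)\<^sup>|\<^sup>v\<^sup>| \<omega>(q v, w)\<close> pairs degree \<open>d\<close> with degree \<open>-d\<close> and is symmetric up to
  sign, so non-degeneracy on a graded \<open>J\<close> is a condition on homogeneous \<open>v\<close>.\<close>

definition nondegenerate_isotrope ::
  "(int \<Rightarrow> 'v::real_vector set) \<Rightarrow> ('v \<Rightarrow> 'v \<Rightarrow> real) \<Rightarrow> ('v \<Rightarrow> 'v) \<Rightarrow> 'v set \<Rightarrow> bool" where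
  "nondegenerate_isotrope V \<omega> q J \<longleftrightarrow> graded_subspace V J \<and>
     (\<forall>v\<in>J. \<forall>w\<in>J. \<omega> v w = 0) \<and>
     (\<forall>d. \<forall>v\<in>J \<inter> V d. (\<forall>w\<in>J. ksgn d * \<omega> (q v) w = 0) \<longrightarrow> v = 0)"

text \<open>The isomorphism is one of graded vector spaces.  It is not required to respect the
  symplectic forms, so the hypothesis covers symplectic isomorphisms.\<close>

definition maximal_isotrope ::
  "(int \<Rightarrow> 'v::real_vector set) \<Rightarrow> ('v \<Rightarrow> 'v \<Rightarrow> real) \<Rightarrow> ('v \<Rightarrow> 'v) \<Rightarrow> 'v set \<Rightarrow> bool" where
  "maximal_isotrope V \<omega> q J \<longleftrightarrow> nondegenerate_isotrope V \<omega> q J \<and>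
     gspace_iso (subquotient V (orth \<omega> J) J) (cohomology V q)"

definition kmap :: "('v::real_vector \<Rightarrow> 'v \<Rightarrow> real) \<Rightarrow> ('v \<Rightarrow> 'v) \<Rightarrow> 'v set \<Rightarrow> 'v \<Rightarrow> 'v" where
  "kmap \<omega> q J = (THE k. linear k \<and> (\<forall>v\<in>J. k (q v) = v) \<and> (\<forall>v\<in>J. k v = 0) \<and>
     (\<forall>v\<in>orth \<omega> {a + q b | a b. a \<in> J \<and> b \<in> J}. k v = 0))"

definition pmap :: "('v::real_vector \<Rightarrow> 'v) \<Rightarrow> ('v \<Rightarrow> 'v) \<Rightarrow> 'v \<Rightarrow> 'v set" where
  "pmap q k v = coset (range q) (v - k (q v))"

text \<open>The adjoint of \<open>pmap\<close>; there is no sign because \<open>pmap\<close> has degree 0.\<close>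

definition imap :: "('v::real_vector \<Rightarrow> 'v \<Rightarrow> real) \<Rightarrow> ('v \<Rightarrow> 'v) \<Rightarrow> ('v \<Rightarrow> 'v) \<Rightarrow> 'v set \<Rightarrow> 'v" where
  "imap \<omega> q k h = (THE w. \<forall>v. induced_form \<omega> (pmap q k v) h = \<omega> v w)"

section \<open>Formal functions\<close>

text \<open>
  An element \<open>f\<close> of the completed symmetric algebra of \<open>V\<^sup>*\<close> is represented by its iterated
  derivatives at the origin, that is by the graded symmetric multilinear forms
  \<^item> \<open>f [v\<^sub>1, \<dots>, v\<^sub>n] = \<partial>\<^bsub>v\<^sub>n\<^esub> \<cdots> \<partial>\<^bsub>v\<^sub>1\<^esub> f\<close>

  on homogeneous vectors.  In characteristic 0 this identifies \<open>Sym\<^sup>n V\<^sup>*\<close> with the graded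
  symmetric \<open>n\<close>-linear forms, and \<open>\<partial>\<^sub>v f\<close> is \<open>\<lambda>xs. f (v # xs)\<close>.  A homogeneous vector is paired
  with its degree, so that signs are meaningful for the zero vector too.  A functional \<open>\<phi>\<close> has
  \<open>\<partial>\<^sub>v \<phi> = (-1)\<^sup>|\<^sup>v\<^sup>| \<phi>(v)\<close>, and the degree of a form is minus the total degree of the
  arguments on which it does not vanish.
\<close>

type_synonym 'a hvec = "int \<times> 'a"
type_synonym 'a form = "'a hvec list \<Rightarrow> real"

definition degs :: "'a hvec list \<Rightarrow> int" where
  "degs xs = sum_list (map fst xs)"

definition hom_list :: "'a gspace \<Rightarrow> 'a hvec list \<Rightarrow> bool" where
  "hom_list G xs \<longleftrightarrow> (\<forall>(d, v) \<in> set xs. v \<in> hcomp G d)"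

definition hmap :: "int \<Rightarrow> ('a \<Rightarrow> 'b) \<Rightarrow> 'a hvec \<Rightarrow> 'b hvec" where
  "hmap a f x = (fst x + a, f (snd x))"

definition sym_forms :: "'a gspace \<Rightarrow> 'a form set" where
  "sym_forms G = {f.
     (\<forall>xs. \<not> hom_list G xs \<longrightarrow> f xs = 0) \<and>
     (\<forall>xs ys d. \<forall>u\<in>hcomp G d. \<forall>v\<in>hcomp G d.
        f (xs @ (d, vadd G u v) # ys) = f (xs @ (d, u) # ys) + f (xs @ (d, v) # ys)) \<and>
     (\<forall>xs ys d c. \<forall>v\<in>hcomp G d.
        f (xs @ (d, vscale G c v) # ys) = c * f (xs @ (d, v) # ys)) \<and>
     (\<forall>xs ys x y. f (xs @ x # y # ys) = ksgn (fst x * fst y) * f (xs @ y # x # ys))}"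

definition lin_form :: "('a hvec \<Rightarrow> real) \<Rightarrow> 'a form" where
  "lin_form \<phi> xs = (case xs of [x] \<Rightarrow> ksgn (fst x) * \<phi> x | _ \<Rightarrow> 0)"

text \<open>The product, determined by
  \<open>\<partial>\<^sub>v (f g) = (\<partial>\<^sub>v f) g + (-1)\<^sup>|\<^sup>v\<^sup>|\<^sup>|\<^sup>f\<^sup>| f \<partial>\<^sub>v g\<close>.\<close>

fun form_mult :: "'a form \<Rightarrow> 'a form \<Rightarrow> 'a form" where
  "form_mult f g [] = f [] * g []"
| "form_mult f g (x # xs) = form_mult (\<lambda>ys. f (x # ys)) g xs
     + form_mult (\<lambda>ys. ksgn (fst x * degs ys) * f ys) (\<lambda>ys. g (x # ys)) xs"

text \<open>The derivation of odd degree that is \<open>\<delta>\<close> on functionals, determined by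
  \<open>\<partial>\<^sub>v D f = (-1)\<^sup>|\<^sup>v\<^sup>| D \<partial>\<^sub>v f + [\<partial>\<^sub>v, D] f\<close>, where \<open>[\<partial>\<^sub>v, D]\<close> is the derivation that sends
  \<open>\<phi>\<close> to \<open>\<partial>\<^sub>v (\<delta> \<phi>)\<close>.
  Lemmas \<open>form_der_lin_form\<close> and \<open>form_der_form_mult\<close> below are the defining properties.\<close>

fun form_der :: "(('a hvec \<Rightarrow> real) \<Rightarrow> 'a hvec \<Rightarrow> real) \<Rightarrow> 'a form \<Rightarrow> 'a form" where
  "form_der \<delta> f [] = 0"
| "form_der \<delta> f (x # xs) = ksgn (fst x) * form_der \<delta> (\<lambda>ys. f (x # ys)) xs
     + ksgn (fst x) * \<delta> (\<lambda>u. ksgn (fst u) * f (u # xs)) x"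

lemma ksgn_square [simp]: "ksgn d * ksgn d = 1" "ksgn d * (ksgn d * r) = r"
  by (auto simp: ksgn_def)

lemma ksgn_add: "ksgn (d + e) = ksgn d * ksgn e"
  by (auto simp: ksgn_def)

lemma form_mult_zero [simp]: "form_mult (\<lambda>_. 0) g xs = 0" "form_mult f (\<lambda>_. 0) xs = 0"
  by (induction xs arbitrary: f g) simp_all

lemma form_mult_scale:
  "form_mult (\<lambda>ys. c * f ys) g xs = c * form_mult f g xs"
  "form_mult f (\<lambda>ys. c * g ys) xs = c * form_mult f g xs"
proof (induction xs arbitrary: f g)
  case (Cons x xs)
  { case 1 show ?case using Cons.IH by (simp add: algebra_simps mult.left_commute) }
  { case 2 show ?case using Cons.IH by (simp add: algebra_simps) }
qed simp_all

lemma form_mult_add: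
  "form_mult (\<lambda>ys. f ys + f' ys) g xs = form_mult f g xs + form_mult f' g xs"
  "form_mult f (\<lambda>ys. g ys + g' ys) xs = form_mult f g xs + form_mult f g' xs"
proof (induction xs arbitrary: f f' g g')
  case (Cons x xs)
  { case 1 show ?case using Cons.IH by (simp add: algebra_simps) }
  { case 2 show ?case using Cons.IH by (simp add: algebra_simps) }
qed (simp_all add: algebra_simps)

lemma form_der_lin_form:
  assumes "\<delta> (\<lambda>_. 0) = (\<lambda>_. 0)"
  shows "form_der \<delta> (lin_form \<phi>) = lin_form (\<delta> \<phi>)"
proof -
  have zero: "form_der \<delta> (\<lambda>_. 0) xs = 0" for xs :: "'a hvec list"
    by (induction xs) (use assms in simp_all)
  have const: "form_der \<delta> (\<lambda>ys. if ys = [] then c else 0) xs = 0" for c xs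
    by (cases xs) (use assms zero in simp_all)
  show ?thesis
  proof
    fix xs
    show "form_der \<delta> (lin_form \<phi>) xs = lin_form (\<delta> \<phi>) xs"
    proof (cases xs)
      case Nil
      then show ?thesis by (simp add: lin_form_def)
    next
      case (Cons x ys)
      have "(\<lambda>ys. lin_form \<phi> (x # ys)) = (\<lambda>ys. if ys = [] then ksgn (fst x) * \<phi> x else 0)"
        by (auto simp: lin_form_def split: list.split)
      then show ?thesis
        using assms by (cases ys) (simp_all add: Cons const zero lin_form_def)
    qed
  qed
qed

lemma form_der_scale:
  assumes "\<delta> = (\<lambda>\<phi> x. s x * \<phi> (hmap a A x))"
  shows "form_der \<delta> (\<lambda>ys. c * f ys) xs = c * form_der \<delta> f xs"
  using assms by (induction xs arbitrary: f) (simp_all add: algebra_simps)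

lemma form_der_add:
  assumes "\<delta> = (\<lambda>\<phi> x. s x * \<phi> (hmap a A x))"
  shows "form_der \<delta> (\<lambda>ys. f ys + g ys) xs = form_der \<delta> f xs + form_der \<delta> g xs"
  using assms by (induction xs arbitrary: f g) (simp_all add: algebra_simps)

lemma form_der_sign:
  assumes a: "odd a" and \<delta>: "\<delta> = (\<lambda>\<phi> x. s x * \<phi> (hmap a A x))"
  shows "form_der \<delta> (\<lambda>ys. ksgn (m * degs ys) * f ys) xs =
    ksgn m * (ksgn (m * degs xs) * form_der \<delta> f xs)"
proof (induction xs arbitrary: f)
  case (Cons x xs)
  have sign: "ksgn (m * degs (y # ys)) = ksgn (m * fst y) * ksgn (m * degs ys)" for y :: "'a hvec" and ys
    by (simp add: degs_def distrib_left ksgn_add)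
  have y: "ksgn (m * fst (hmap a A x)) = ksgn m * ksgn (m * fst x)"
    using a by (auto simp: ksgn_def hmap_def)
  have D: "form_der \<delta> h (x # ys) = ksgn (fst x) * form_der \<delta> (\<lambda>zs. h (x # zs)) ys
      + ksgn (fst x) * s x * ksgn (fst (hmap a A x)) * h (hmap a A x # ys)" for h ys
    by (simp add: \<delta>)
  have "form_der \<delta> (\<lambda>ys. ksgn (m * degs (x # ys)) * f (x # ys)) xs =
      ksgn (m * fst x) * form_der \<delta> (\<lambda>ys. ksgn (m * degs ys) * f (x # ys)) xs"
    unfolding sign mult.assoc by (rule form_der_scale[OF \<delta>])
  then show ?case
    by (simp only: D Cons.IH sign y) (simp add: algebra_simps)
qed simp

lemma form_der_form_mult:
  assumes a: "odd a" and \<delta>: "\<delta> = (\<lambda>\<phi> x. s x * \<phi> (hmap a A x))"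
  shows "form_der \<delta> (form_mult f g) xs =
    form_mult (form_der \<delta> f) g xs + form_mult (\<lambda>ys. ksgn (degs ys) * f ys) (form_der \<delta> g) xs"
proof (induction xs arbitrary: f g)
  case (Cons x xs)
  define y where "y = hmap a A x"
  define c where "c = ksgn (fst x) * s x * ksgn (fst y)"
  have D: "form_der \<delta> h (x # ys) = ksgn (fst x) * form_der \<delta> (\<lambda>zs. h (x # zs)) ys + c * h (y # ys)"
    for h ys by (simp add: \<delta> c_def y_def)
  have y: "ksgn (fst y * d) = ksgn (fst x * d) * ksgn d" for d
    using a by (auto simp: ksgn_def y_def hmap_def)
  have x: "ksgn (degs (x # ys)) = ksgn (fst x) * ksgn (degs ys)" for ys
    by (simp add: degs_def ksgn_add)
  have S: "(\<lambda>ys. ksgn (fst x * degs ys) * form_der \<delta> f ys) =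
      (\<lambda>ys. ksgn (fst x) * form_der \<delta> (\<lambda>zs. ksgn (fst x * degs zs) * f zs) ys)"
    using form_der_sign[OF a \<delta>, of "fst x" f] by simp
  have M: "(\<lambda>ys. ksgn (degs ys) * (ksgn (fst x * degs ys) * f ys)) =
      (\<lambda>ys. ksgn (fst x * degs ys) * (ksgn (degs ys) * f ys))"
    by (simp add: mult.left_commute)
  show ?case
    by (simp only: D form_mult.simps form_mult_add form_mult_scale form_der_add[OF \<delta>] Cons.IH x y S M
        mult.assoc) (simp add: algebra_simps form_mult_scale)
qed simp

section \<open>The weight-completed space and its operators\<close>

text \<open>\<open>F g\<close> is the coefficient of \<open>\<hbar>\<^sup>g\<close>.\<close>

type_synonym 'a series = "int \<Rightarrow> 'a form"

definition weight_completed :: "'a gspace \<Rightarrow> 'a series set" where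
  "weight_completed G = {F. (\<forall>g. F g \<in> sym_forms G) \<and>
     (\<forall>w. finite {g. \<exists>xs. int (length xs) + 2 * g = w \<and> F g xs \<noteq> 0})}"

text \<open>Formal power series in \<open>\<hbar>\<close> with coefficients in the completed symmetric algebra.\<close>

definition formal_functions :: "'a gspace \<Rightarrow> 'a series set" where
  "formal_functions G = {F. (\<forall>g. F g \<in> sym_forms G) \<and> (\<forall>g<0. \<forall>xs. F g xs = 0)}"

definition hbar_pow :: "int \<Rightarrow> 'a series \<Rightarrow> 'a series" where
  "hbar_pow m F = (\<lambda>g xs. F (g - m) xs)"

definition restrict_hom :: "'a gspace \<Rightarrow> 'a series \<Rightarrow> 'a series" where
  "restrict_hom G F = (\<lambda>g xs. if hom_list G xs then F g xs else 0)"

text \<open>The sum defining the product has finitely many nonzero terms whenever the weights occurring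
  in the two factors are bounded below.\<close>

definition series_mult :: "'a series \<Rightarrow> 'a series \<Rightarrow> 'a series" where
  "series_mult F G = (\<lambda>g xs. Sum_any (\<lambda>h. form_mult (F h) (G (g - h)) xs))"

definition series_one :: "'a series" where
  "series_one = (\<lambda>g xs. if g = 0 \<and> xs = [] then 1 else 0)"

fun series_power :: "'a series \<Rightarrow> nat \<Rightarrow> 'a series" where
  "series_power F 0 = series_one"
| "series_power F (Suc n) = series_mult F (series_power F n)"

text \<open>In \<open>series_exp\<close> and \<open>series_log\<close> every coefficient is a finite sum if \<open>F\<close>, respectively
  \<open>F - 1\<close>, has only terms of weight at least 1.\<close>

definition series_exp :: "'a series \<Rightarrow> 'a series" where
  "series_exp F = (\<lambda>g xs. Sum_any (\<lambda>n. series_power F n g xs / fact n))"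

definition series_log :: "'a series \<Rightarrow> 'a series" where
  "series_log F = (\<lambda>g xs. Sum_any (\<lambda>n::nat.
     if n = 0 then 0 else (- 1) ^ (n + 1) / real n * series_power (F - series_one) n g xs))"

definition Qop :: "'a gspace \<Rightarrow> ('a \<Rightarrow> 'a) \<Rightarrow> 'a series \<Rightarrow> 'a series" where
  "Qop G q F = restrict_hom G (\<lambda>g. form_der (\<lambda>\<phi> x. - ksgn (fst x + 1) * \<phi> (hmap 1 q x)) (F g))"

definition Kun :: "'a gspace \<Rightarrow> ('a \<Rightarrow> 'a) \<Rightarrow> 'a series \<Rightarrow> 'a series" where
  "Kun G k F = restrict_hom G (\<lambda>g. form_der (\<lambda>\<phi> x. ksgn (fst x - 1) * \<phi> (hmap (- 1) k x)) (F g))"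

text \<open>\<open>ks\<close> lists the pairs \<open>(\<K>', \<K>'')\<close> of a decomposition of the tensor \<open>\<Sum> \<K>' \<otimes> \<K>''\<close> determined
  by \<open>(-1)\<^sup>|\<^sup>v\<^sup>| \<Sum> \<K>' \<omega>(\<K>'', v) = v\<close>.  The operator \<open>BV\<close> only depends on this tensor.\<close>

definition casimir ::
  "'a gspace \<Rightarrow> ('a \<Rightarrow> 'a \<Rightarrow> real) \<Rightarrow> ('a hvec \<times> 'a hvec) list \<Rightarrow> bool" where
  "casimir G \<omega> ks \<longleftrightarrow> (\<forall>(a, b) \<in> set ks. hom_list G [a, b]) \<and>
     (\<forall>d. \<forall>v\<in>hcomp G d.
        vscale G (ksgn d)
          (foldr (\<lambda>(a, b) s. vadd G (vscale G (\<omega> (snd b) v) (snd a)) s) ks (vzero G)) = v)"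

definition BV :: "'a gspace \<Rightarrow> ('a \<Rightarrow> 'a \<Rightarrow> real) \<Rightarrow> 'a series \<Rightarrow> 'a series" where
  "BV G \<omega> F = (\<lambda>g xs. - (1 / 2) *
     (\<Sum>(a, b) \<leftarrow> (SOME ks. casimir G \<omega> ks). F g (b # a # xs)))"

definition parity :: "'a series \<Rightarrow> 'a series" where
  "parity F = (\<lambda>g xs. ksgn (degs xs) * F g xs)"

text \<open>\<open>{F, G} = (-1)\<^sup>|\<^sup>F\<^sup>| \<Delta>(F G) - (-1)\<^sup>|\<^sup>F\<^sup>| (\<Delta> F) G - F \<Delta> G\<close>\<close>

definition BV_bracket ::
  "'a gspace \<Rightarrow> ('a \<Rightarrow> 'a \<Rightarrow> real) \<Rightarrow> 'a series \<Rightarrow> 'a series \<Rightarrow> 'a series" where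
  "BV_bracket G \<omega> F F' = BV G \<omega> (series_mult (parity F) F')
     - series_mult (BV G \<omega> (parity F)) F' - series_mult F (BV G \<omega> F')"

section \<open>Quantum master actions and effective actions\<close>

definition S_free ::
  "(int \<Rightarrow> 'v::real_vector set) \<Rightarrow> ('v \<Rightarrow> 'v \<Rightarrow> real) \<Rightarrow> ('v \<Rightarrow> 'v) \<Rightarrow> 'v series" where
  "S_free V \<omega> q = (THE S. S \<in> formal_functions (whole V) \<and>
     (\<forall>g xs. S g xs \<noteq> 0 \<longrightarrow> g = 0 \<and> length xs = 2) \<and>
     (\<forall>F\<in>formal_functions (whole V). BV_bracket (whole V) \<omega> S F = Qop (whole V) q F))"

definition quantum_master_action ::
  "(int \<Rightarrow> 'v::real_vector set) \<Rightarrow> ('v \<Rightarrow> 'v \<Rightarrow> real) \<Rightarrow> ('v \<Rightarrow> 'v) \<Rightarrow> 'v series \<Rightarrow> bool" where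
  "quantum_master_action V \<omega> q S \<longleftrightarrow>
     (let Sint = S - S_free V \<omega> q; E = series_exp (hbar_pow (- 1) Sint) in
        Sint \<in> formal_functions (whole V) \<and>
        (\<forall>g xs. Sint g xs \<noteq> 0 \<longrightarrow> degs xs = 0) \<and>
        (\<forall>g xs. Sint g xs \<noteq> 0 \<longrightarrow> int (length xs) + 2 * g \<ge> 3) \<and>
        (\<forall>g xs. Qop (whole V) q E g xs + hbar_pow 1 (BV (whole V) \<omega> E) g xs = 0))"

text \<open>The part of \<open>F\<close> spanned by the monomials with exactly \<open>m\<close> factors from \<open>(V'')\<^sup>*\<close>, where
  \<open>\<pi>\<close> is the projection onto \<open>V'\<close> along \<open>V''\<close>.\<close>

definition count_part :: "('v::real_vector \<Rightarrow> 'v) \<Rightarrow> nat \<Rightarrow> 'v series \<Rightarrow> 'v series" where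
  "count_part \<pi> m F = (\<lambda>g xs. \<Sum>bs | length bs = length xs \<and> count_list bs True = m.
     F g (map2 (\<lambda>b. hmap 0 (if b then (\<lambda>v. v - \<pi> v) else \<pi>)) bs xs))"

definition Kop ::
  "(int \<Rightarrow> 'v::real_vector set) \<Rightarrow> ('v \<Rightarrow> 'v) \<Rightarrow> ('v \<Rightarrow> 'v) \<Rightarrow> 'v series \<Rightarrow> 'v series" where
  "Kop V \<pi> k F = (\<lambda>g xs. \<Sum>m = 1..length xs. 1 / real m * Kun (whole V) k (count_part \<pi> m F) g xs)"

definition pullback :: "'b gspace \<Rightarrow> ('b \<Rightarrow> 'a) \<Rightarrow> 'a series \<Rightarrow> 'b series" where
  "pullback H i F = restrict_hom H (\<lambda>g xs. F g (map (hmap 0 i) xs))"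

text \<open>\<open>P (1 - \<hbar> \<Delta> K + (\<hbar> \<Delta> K)\<^sup>2 - \<cdots>)\<close>; the operator \<open>\<hbar> \<Delta> K\<close> preserves weights and lowers the
  polynomial degree by 2, so that the sums are finite on weight-completed spaces.\<close>

definition perturbed_P ::
  "(int \<Rightarrow> 'v::real_vector set) \<Rightarrow> ('v \<Rightarrow> 'v \<Rightarrow> real) \<Rightarrow> ('v \<Rightarrow> 'v) \<Rightarrow> 'v set \<Rightarrow>
    'v series \<Rightarrow> 'v set series" where
  "perturbed_P V \<omega> q J F =
     (let k = kmap \<omega> q J; i = imap \<omega> q k; \<pi> = (\<lambda>v. i (pmap q k v));
          T = (\<lambda>F. - hbar_pow 1 (BV (whole V) \<omega> (Kop V \<pi> k F)))
      in pullback (cohomology V q) i (\<lambda>g xs. Sum_any (\<lambda>j. (T ^^ j) F g xs)))"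

definition effective_action ::
  "(int \<Rightarrow> 'v::real_vector set) \<Rightarrow> ('v \<Rightarrow> 'v \<Rightarrow> real) \<Rightarrow> ('v \<Rightarrow> 'v) \<Rightarrow> 'v series \<Rightarrow> 'v set \<Rightarrow>
    'v set series" where
  "effective_action V \<omega> q S J = hbar_pow 1 (series_log
     (perturbed_P V \<omega> q J (series_exp (hbar_pow (- 1) (S - S_free V \<omega> q)))))"

text \<open>A half-density \<open>F \<surd>dH\<close> is represented by its coefficient \<open>F\<close> with respect to the constant
  half-density \<open>\<surd>dH\<close>, on which the BV operator acts trivially.\<close>

definition homotopic_half_densities ::
  "'a gspace \<Rightarrow> ('a \<Rightarrow> 'a \<Rightarrow> real) \<Rightarrow> 'a series \<Rightarrow> 'a series \<Rightarrow> bool" where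
  "homotopic_half_densities H \<omega> A B \<longleftrightarrow>
     A \<in> weight_completed H \<and> B \<in> weight_completed H \<and>
     (\<forall>g xs. BV H \<omega> A g xs = 0) \<and> (\<forall>g xs. BV H \<omega> B g xs = 0) \<and>
     (\<exists>F\<in>weight_completed H. A - B = BV H \<omega> F)"

end

theory Submission
  imports Defs "HOL-Computational_Algebra.Formal_Power_Series"
begin

text \<open>
  The effective half-density of \<open>J\<close> is \<open>i\<^sub>k\<^sup>* R e\<^bsup>S/\<hbar>\<^esup>\<close> with the resolvent \<open>R = (1 + \<hbar>\<Delta>K)\<^sup>-\<^sup>1\<close>.
  Put \<open>D = Q + \<hbar>\<Delta>\<close> and \<open>\<pi> = i\<^sub>k p\<^sub>k\<close>.  The relations \<open>QK + KQ = 1 - \<pi>\<^sup>*\<close> and \<open>K\<pi>\<^sup>* = 0\<close> give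
  \<open>R D = Q R + \<hbar>\<Delta>\<pi>\<^sup>* R\<close>, hence \<open>i\<^sub>k\<^sup>* R D = \<hbar>\<Delta>\<^sub>H i\<^sub>k\<^sup>* R\<close>, and for \<open>E = e\<^bsup>S/\<hbar>\<^esup>\<close>, \<open>X = R E\<close> and
  \<open>f = \<pi>\<^sup>* X\<close> they give \<open>Q X = 0\<close>, \<open>\<Delta> f = 0\<close> and \<open>E = f + D K X\<close>.

  For a second isotrope \<open>J'\<close> the two projections to cohomology are joined by the path of chain maps
  \<open>A\<^sub>t = \<pi> - (1 - t) \<pi>k'q\<close> with \<open>A\<^sub>t A\<^sub>t\<^sup>\<dagger> = \<pi>\<close> and velocity \<open>B\<^sub>t q\<close>, where
  \<open>B\<^sub>t = \<pi>k' - t \<pi>k'\<pi>\<close>.  The second term of \<open>B\<^sub>t\<close> makes \<open>A\<^sub>t B\<^sub>t\<^sup>\<dagger>\<close> vanish, so that integrating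
  the derivations along \<open>A\<^sub>t\<close> given by \<open>B\<^sub>t\<close> produces \<open>Z\<close> with \<open>f = \<pi>'\<^sup>* f + D Z f\<close>.  Applying
  \<open>i\<^bsub>k'\<^esub>\<^sup>* R'\<close> to \<open>E = \<pi>'\<^sup>* f + D (K X + Z f)\<close> exhibits the difference of the two half-densities
  as \<open>\<Delta>\<^sub>H\<close>-exact.
\<close>

section \<open>Exponential and logarithm of series\<close>

text \<open>The operator \<open>K\<close> divides by the number of factors from V'', so it is not a
  derivation and its relations with Q and \<Delta> cannot be read off on generators. As an integral
  over t of derivations along a path of chain maps it is an instance of \<open>avg_der\<close>, and
  so is the interpolation \<open>Z\<close>. For both, the homotopy relation is the fundamental
  theorem of calculus, and \<Delta> enters only through contractions with the Casimir element, which
  depend on nothing but the linear operator that the contracted tensor induces on V. Questions about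
  forms thus become identities between linear maps. The correction term in B_t costs nothing: \<pi>q
  = q\<pi> = 0, so B_t q + q B_t, the velocity of the path, does not see it. The path runs from
  \<pi>\<pi>' to \<pi>, and f is already a pullback along \<pi>; hence its endpoints compare f with
  the pullback of f along \<pi>'. No analysis of convergence is involved: in a fixed weight the
  order in hbar is bounded on both sides, and each factor hbar \<Delta>K uses up one order.\<close>

lemma form_mult_nonzero:
  "form_mult f g xs \<noteq> 0 \<Longrightarrow>
    \<exists>ys zs. length ys + length zs = length xs \<and> f ys \<noteq> 0 \<and> g zs \<noteq> 0"
proof (induction xs arbitrary: f g)
  case (Cons x xs)
  have "form_mult (\<lambda>ys. f (x # ys)) g xs \<noteq> 0 \<or>
      form_mult (\<lambda>ys. ksgn (fst x * degs ys) * f ys) (\<lambda>ys. g (x # ys)) xs \<noteq> 0"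
    using Cons.prems by auto
  then show ?case
  proof
    assume "form_mult (\<lambda>ys. f (x # ys)) g xs \<noteq> 0"
    from Cons.IH[OF this] obtain ys zs where "length ys + length zs = length xs" "f (x # ys) \<noteq> 0" "g zs \<noteq> 0"
      by blast
    then show ?thesis by (intro exI[of _ "x # ys"] exI[of _ zs]) simp
  next
    assume "form_mult (\<lambda>ys. ksgn (fst x * degs ys) * f ys) (\<lambda>ys. g (x # ys)) xs \<noteq> 0"
    from Cons.IH[OF this] obtain ys zs where "length ys + length zs = length xs" "f ys \<noteq> 0" "g (x # zs) \<noteq> 0"
      by auto
    then show ?thesis by (intro exI[of _ ys] exI[of _ "x # zs"]) simp
  qed
qed auto

lemma form_mult_cong:
  assumes "\<And>ys. length ys \<le> length xs \<Longrightarrow> f ys = f' ys"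
    and "\<And>ys. length ys \<le> length xs \<Longrightarrow> g ys = g' ys"
  shows "form_mult f g xs = form_mult f' g' xs"
  using assms
proof (induction xs arbitrary: f f' g g')
  case (Cons x xs)
  show ?case
    by (simp, intro arg_cong2[where f = "(+)"] Cons.IH) (use Cons.prems in auto)
qed simp

lemma form_mult_sum:
  "form_mult (\<lambda>ys. \<Sum>i\<in>I. f i ys) g xs = (\<Sum>i\<in>I. form_mult (f i) g xs)"
  "form_mult f' (\<lambda>ys. \<Sum>i\<in>I. h i ys) xs = (\<Sum>i\<in>I. form_mult f' (h i) xs)"
  by (induction I rule: infinite_finite_induct) (simp_all add: form_mult_add)

lemma degs_Cons [simp]: "degs (x # xs) = fst x + degs xs"
  by (simp add: degs_def)

lemma degs_Nil [simp]: "degs [] = 0"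
  by (simp add: degs_def)

lemma degs_append [simp]: "degs (xs @ ys) = degs xs + degs ys"
  by (simp add: degs_def)

text \<open>The exponent is additive in the degree, so the twist is an automorphism of the algebra.
  In associativity it distributes the sign of the Leibniz rule over both inner factors.\<close>

lemma form_mult_sign:
  "form_mult (\<lambda>ys. ksgn (m * degs ys) * f ys) (\<lambda>ys. ksgn (m * degs ys) * g ys) xs =
    ksgn (m * degs xs) * form_mult f g xs"
proof (induction xs arbitrary: f g)
  case (Cons x xs)
  have *: "(\<lambda>ys. ksgn (fst x * degs ys) * (ksgn (m * degs ys) * f ys)) =
     (\<lambda>ys. ksgn (m * degs ys) * (ksgn (fst x * degs ys) * f ys))"
    by (simp add: mult.left_commute)
  show ?case
    by (simp add: distrib_left ksgn_add mult.assoc form_mult_scale Cons.IH *)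
qed (simp add: ksgn_def)

lemma form_mult_assoc:
  "form_mult (form_mult f g) h xs = form_mult f (form_mult g h) xs"
proof (induction xs arbitrary: f g h)
  case (Cons x xs)
  have *: "(\<lambda>ys. ksgn (fst x * degs ys) * form_mult f g ys) =
     form_mult (\<lambda>ys. ksgn (fst x * degs ys) * f ys) (\<lambda>ys. ksgn (fst x * degs ys) * g ys)"
    by (simp add: form_mult_sign fun_eq_iff)
  show ?case
    by (simp add: form_mult_add Cons.IH *)
qed (simp add: ksgn_def)

lemma form_mult_unit:
  "form_mult (\<lambda>ys. if ys = [] then 1 else 0) g xs = g xs"
  "form_mult f (\<lambda>ys. if ys = [] then 1 else 0) xs = f xs"
proof (induction xs arbitrary: f g)
  case (Cons x xs)
  have *: "(\<lambda>ys. ksgn (fst x * degs ys) * (if ys = [] then 1 else 0)) = (\<lambda>ys. if ys = [] then 1 else 0)"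
    by (auto simp: ksgn_def)
  { case 1 show ?case using Cons.IH by (simp add: *) }
  { case 2 show ?case using Cons.IH by (simp add: *) }
qed simp_all

section \<open>Weights and associativity of the product of series\<close>

abbreviation weight :: "int \<Rightarrow> 'a list \<Rightarrow> int" where
  "weight g xs \<equiv> int (length xs) + 2 * g"

definition weight_ge :: "int \<Rightarrow> 'a series \<Rightarrow> bool" where
  "weight_ge n F \<longleftrightarrow> (\<forall>g xs. F g xs \<noteq> 0 \<longrightarrow> n \<le> weight g xs)"

lemma weight_ge_mono: "weight_ge n F \<Longrightarrow> m \<le> n \<Longrightarrow> weight_ge m F"
  unfolding weight_ge_def by force

lemma weight_ge_series_mult:
  assumes F: "weight_ge m F" and G: "weight_ge n G"
  shows "weight_ge (m + n) (series_mult F G)"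
  unfolding weight_ge_def
proof (intro allI impI)
  fix g xs assume "series_mult F G g xs \<noteq> 0"
  then obtain h where "form_mult (F h) (G (g - h)) xs \<noteq> 0"
    unfolding series_mult_def using Sum_any.not_neutral_obtains_not_neutral by blast
  from form_mult_nonzero[OF this] obtain ys zs
    where l: "length ys + length zs = length xs" and n: "F h ys \<noteq> 0" "G (g - h) zs \<noteq> 0" by blast
  have "m \<le> weight h ys" "n \<le> int (length zs) + 2 * (g - h)"
    using F G n unfolding weight_ge_def by blast+
  then show "m + n \<le> weight g xs" using l by auto
qed

lemma weight_ge_series_one: "weight_ge 0 series_one"
  by (auto simp: weight_ge_def series_one_def)

lemma weight_ge_series_power:
  assumes "weight_ge 1 F" shows "weight_ge (int n) (series_power F n)"
proof (induction n)
  case (Suc n)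
  then show ?case using weight_ge_series_mult[OF assms, of "int n"] by (simp add: add.commute)
qed (simp add: weight_ge_series_one)

lemma weight_ge_0_series_power: "weight_ge 1 F \<Longrightarrow> weight_ge 0 (series_power F n)"
  using weight_ge_mono[OF weight_ge_series_power, of F 0 n] by simp

lemma series_mult_one_left: "series_mult series_one F = F"
proof (intro ext)
  fix g xs
  have "form_mult (series_one h) (F (g - h)) xs = (if h = 0 then F g xs else 0)" for h
    by (cases "h = 0") (simp_all add: series_one_def form_mult_unit)
  then show "series_mult series_one F g xs = F g xs"
    unfolding series_mult_def by simp
qed

lemma series_mult_one_right: "series_mult F series_one = F"
proof (intro ext)
  fix g xs
  have "form_mult (F h) (series_one (g - h)) xs = (if h = g then F g xs else 0)" for h
    by (cases "h = g") (simp_all add: series_one_def form_mult_unit)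
  then show "series_mult F series_one g xs = F g xs"
    unfolding series_mult_def by simp
qed

text \<open>Nonnegative weight of the first factor bounds \<open>h\<close> below by minus the
  length; that of the second bounds it above by \<open>g\<close> plus the length. The free superset
  \<open>M\<close> lets one window serve many lists and orders at once.\<close>

lemma series_mult_eq_sum_superset:
  assumes "weight_ge 0 F" and "weight_ge 0 G"
    and "finite M" "{- int (length xs)..\<bar>g\<bar> + int (length xs)} \<subseteq> M"
  shows "series_mult F G g xs = (\<Sum>h\<in>M. form_mult (F h) (G (g - h)) xs)"
  unfolding series_mult_def
proof (rule Sum_any.expand_superset)
  show "{h. form_mult (F h) (G (g - h)) xs \<noteq> 0} \<subseteq> M"
  proof clarify
    fix h assume "form_mult (F h) (G (g - h)) xs \<noteq> 0"
    from form_mult_nonzero[OF this] obtain ys zs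
      where l: "length ys + length zs = length xs" and n: "F h ys \<noteq> 0" "G (g - h) zs \<noteq> 0" by blast
    have "0 \<le> weight h ys" "0 \<le> int (length zs) + 2 * (g - h)"
      using assms(1,2) n unfolding weight_ge_def by blast+
    then have "h \<in> {- int (length xs)..\<bar>g\<bar> + int (length xs)}" using l by auto
    then show "h \<in> M" using assms(4) by blast
  qed
qed (rule assms)

lemma series_mult_assoc:
  fixes F G H :: "'a series"
  assumes F: "weight_ge 0 F" and G: "weight_ge 0 G" and H: "weight_ge 0 H"
  shows "series_mult (series_mult F G) H = series_mult F (series_mult G H)"
proof (intro ext)
  fix g and xs :: "'a hvec list"
  define L where "L = \<bar>g\<bar> + int (length xs)"
  have FG: "weight_ge 0 (series_mult F G)" and GH: "weight_ge 0 (series_mult G H)"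
    using weight_ge_series_mult[OF F G] weight_ge_series_mult[OF G H] by simp_all
  \<comment> \<open>The windows are nested with slack. For |h| at most 3L the inner summation range
    ends by 4L, inside \<open>N2\<close>; for |h| at most 5L the range belonging to order
    \<open>g - h\<close> ends by 6L, inside \<open>N3\<close>.\<close>
  define N1 where "N1 = {- (3 * L)..3 * L}"
  define N2 where "N2 = {- (5 * L)..5 * L}"
  define N3 where "N3 = {- (8 * L)..8 * L}"
  have fin: "finite N1" "finite N3" by (simp_all add: N1_def N3_def)
  define T where "T a b c = form_mult (form_mult (F a) (G b)) (H c) xs" for a b c
  \<comment> \<open>Nonzero terms have indices within L, well inside every window, so the change of
    summation index below loses nothing at the edges.\<close>
  have supp: "\<bar>h\<bar> \<le> L" "\<bar>h'\<bar> \<le> L" "\<bar>h + h'\<bar> \<le> L" if "T h h' (g - h - h') \<noteq> 0" for h h'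
  proof -
    from form_mult_nonzero[OF that[unfolded T_def]] obtain us vs where
      l: "length us + length vs = length xs" and n: "form_mult (F h) (G h') us \<noteq> 0" "H (g - h - h') vs \<noteq> 0" by blast
    from form_mult_nonzero[OF n(1)] obtain us1 us2 where
      l1: "length us1 + length us2 = length us" and n1: "F h us1 \<noteq> 0" "G h' us2 \<noteq> 0" by blast
    have "0 \<le> weight h us1" "0 \<le> weight h' us2" "0 \<le> int (length vs) + 2 * (g - h - h')"
      using F G H n n1 unfolding weight_ge_def by blast+
    then show "\<bar>h\<bar> \<le> L" "\<bar>h'\<bar> \<le> L" "\<bar>h + h'\<bar> \<le> L" using l l1 unfolding L_def by auto
  qed
  have "series_mult (series_mult F G) H g xs = (\<Sum>h\<in>N1. form_mult (series_mult F G h) (H (g - h)) xs)"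
    by (rule series_mult_eq_sum_superset[OF FG H]) (auto simp: N1_def L_def)
  also have "\<dots> = (\<Sum>h\<in>N1. \<Sum>h'\<in>N2. T h' (h - h') (g - h))"
  proof (rule sum.cong[OF refl])
    fix h assume h: "h \<in> N1"
    have "form_mult (series_mult F G h) (H (g - h)) xs =
        form_mult (\<lambda>ys. \<Sum>h'\<in>N2. form_mult (F h') (G (h - h')) ys) (H (g - h)) xs"
      by (rule form_mult_cong, rule series_mult_eq_sum_superset[OF F G])
        (use h in \<open>auto simp: N1_def N2_def L_def\<close>)
    then show "form_mult (series_mult F G h) (H (g - h)) xs = (\<Sum>h'\<in>N2. T h' (h - h') (g - h))"
      by (simp only: form_mult_sum T_def)
  qed
  also have "\<dots> = (\<Sum>h'\<in>N2. \<Sum>h\<in>N1. T h' (h - h') (g - h))"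
    by (rule sum.swap)
  also have "\<dots> = (\<Sum>h'\<in>N2. \<Sum>h\<in>N3. T h' h (g - h' - h))"
  proof (rule sum.cong[OF refl])
    fix h'
    show "(\<Sum>h\<in>N1. T h' (h - h') (g - h)) = (\<Sum>h\<in>N3. T h' h (g - h' - h))"
    proof (rule sum.reindex_bij_witness_not_neutral[of
          "{h\<in>N1. T h' (h - h') (g - h) = 0}" "{h\<in>N3. T h' h (g - h' - h) = 0}" _ "\<lambda>h. h + h'" "\<lambda>h. h - h'"])
      show "h - h' \<in> N3 - {h \<in> N3. T h' h (g - h' - h) = 0}"
        if "h \<in> N1 - {h \<in> N1. T h' (h - h') (g - h) = 0}" for h
        using that supp[of h' "h - h'"] unfolding N1_def N3_def by auto
      show "h + h' \<in> N1 - {h \<in> N1. T h' (h - h') (g - h) = 0}"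
        if "h \<in> N3 - {h \<in> N3. T h' h (g - h' - h) = 0}" for h
        using that supp[of h' h] unfolding N1_def N3_def by (auto simp: algebra_simps)
    qed (use fin in \<open>simp_all add: algebra_simps\<close>)
  qed
  also have "\<dots> = (\<Sum>h\<in>N2. form_mult (F h) (series_mult G H (g - h)) xs)"
  proof (rule sum.cong[OF refl])
    fix h assume h: "h \<in> N2"
    have "form_mult (F h) (series_mult G H (g - h)) xs =
        form_mult (F h) (\<lambda>ys. \<Sum>h'\<in>N3. form_mult (G h') (H (g - h - h')) ys) xs"
      by (rule form_mult_cong, simp, rule series_mult_eq_sum_superset[OF G H])
        (use h in \<open>auto simp: N3_def N2_def L_def\<close>)
    then show "(\<Sum>h'\<in>N3. T h h' (g - h - h')) = form_mult (F h) (series_mult G H (g - h)) xs"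
      by (simp only: form_mult_sum T_def form_mult_assoc)
  qed
  also have "\<dots> = series_mult F (series_mult G H) g xs"
    by (rule series_mult_eq_sum_superset[OF F GH, symmetric]) (auto simp: N2_def L_def)
  finally show "series_mult (series_mult F G) H g xs = series_mult F (series_mult G H) g xs" .
qed

lemma series_power_add:
  assumes "weight_ge 1 u"
  shows "series_mult (series_power u m) (series_power u n) = series_power u (m + n)"
proof (induction m)
  case (Suc m)
  have u: "weight_ge 0 u" using assms weight_ge_mono by fastforce
  show ?case
    using Suc series_mult_assoc[OF u weight_ge_0_series_power[OF assms] weight_ge_0_series_power[OF assms]] by simp
qed (simp add: series_mult_one_left)


section \<open>Substitution of a series into a formal power series\<close>

definition fps_eval :: "real fps \<Rightarrow> 'a series \<Rightarrow> 'a series" where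
  "fps_eval a u = (\<lambda>g xs. \<Sum>n\<le>nat (weight g xs). fps_nth a n * series_power u n g xs)"

lemma series_power_eq_0:
  "weight_ge 1 u \<Longrightarrow> weight g xs < int n \<Longrightarrow> series_power u n g xs = 0"
  using weight_ge_series_power[of u n] unfolding weight_ge_def by force

text \<open>Powers beyond the weight vanish, so the cut-off is immaterial; a common \<open>N\<close>
  for many lists allows sums to be interchanged.\<close>

lemma fps_eval_eq:
  assumes "weight_ge 1 u" and "weight g xs \<le> int N"
  shows "fps_eval a u g xs = (\<Sum>n\<le>N. fps_nth a n * series_power u n g xs)"
  unfolding fps_eval_def
  by (rule sum.mono_neutral_left) (use assms in \<open>auto simp: series_power_eq_0\<close>)

lemma weight_ge_fps_eval:
  assumes u: "weight_ge 1 u" and a: "\<And>n. n < m \<Longrightarrow> fps_nth a n = 0"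
  shows "weight_ge (int m) (fps_eval a u)"
  unfolding weight_ge_def
proof (intro allI impI)
  fix g and xs :: "'a hvec list" assume "fps_eval a u g xs \<noteq> 0"
  then obtain n where "fps_nth a n * series_power u n g xs \<noteq> 0"
    unfolding fps_eval_def using sum.not_neutral_contains_not_neutral by blast
  then have "m \<le> n" "int n \<le> weight g xs"
    using a[of n] weight_ge_series_power[OF u, of n] unfolding weight_ge_def by (auto simp: not_less[symmetric])
  then show "int m \<le> weight g xs" by simp
qed

text \<open>Substitution of \<open>u\<close> is a homomorphism of algebras. It carries the identity
  between exponential and logarithm from one formal variable over to series of forms.\<close>

lemma fps_eval_mult:
  assumes u: "weight_ge 1 u"
  shows "series_mult (fps_eval a u) (fps_eval b u) = fps_eval (a * b) u"
proof (intro ext)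
  fix g and xs :: "'a hvec list"
  define L where "L = \<bar>g\<bar> + int (length xs)"
  define S where "S = {- L..L}"
  \<comment> \<open>Orders up to 2L and lengths up to L occur, so 5L bounds every weight that is
    met.\<close>
  define N where "N = nat (5 * L)"
  have w0: "weight_ge 0 (fps_eval c u)" for c using weight_ge_fps_eval[OF u, of 0 c] by simp
  have ev: "fps_eval c u h ys = (\<Sum>n\<le>N. fps_nth c n * series_power u n h ys)"
    if "\<bar>h\<bar> \<le> 2 * L" "length ys \<le> length xs" for c h ys
    by (rule fps_eval_eq[OF u]) (use that in \<open>auto simp: N_def L_def\<close>)
  have "series_mult (fps_eval a u) (fps_eval b u) g xs =
      (\<Sum>h\<in>S. form_mult (fps_eval a u h) (fps_eval b u (g - h)) xs)"
    by (rule series_mult_eq_sum_superset[OF w0 w0]) (auto simp: S_def L_def)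
  also have "\<dots> = (\<Sum>h\<in>S. form_mult (\<lambda>ys. \<Sum>n\<le>N. fps_nth a n * series_power u n h ys)
      (\<lambda>ys. \<Sum>n\<le>N. fps_nth b n * series_power u n (g - h) ys) xs)"
    by (intro sum.cong refl form_mult_cong ev) (auto simp: S_def L_def)
  also have "\<dots> = (\<Sum>h\<in>S. \<Sum>m\<le>N. \<Sum>n\<le>N. fps_nth a m * fps_nth b n *
      form_mult (series_power u m h) (series_power u n (g - h)) xs)"
    by (simp add: form_mult_sum form_mult_scale sum_distrib_left mult.assoc mult.left_commute)
  also have "\<dots> = (\<Sum>m\<le>N. \<Sum>h\<in>S. \<Sum>n\<le>N. fps_nth a m * fps_nth b n *
      form_mult (series_power u m h) (series_power u n (g - h)) xs)"
    by (rule sum.swap)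
  also have "\<dots> = (\<Sum>m\<le>N. \<Sum>n\<le>N. \<Sum>h\<in>S. fps_nth a m * fps_nth b n *
      form_mult (series_power u m h) (series_power u n (g - h)) xs)"
    by (intro sum.cong refl sum.swap)
  also have "\<dots> = (\<Sum>m\<le>N. \<Sum>n\<le>N. fps_nth a m * fps_nth b n * series_power u (m + n) g xs)"
  proof (intro sum.cong refl)
    fix m n
    have "series_power u (m + n) g xs = series_mult (series_power u m) (series_power u n) g xs"
      by (simp add: series_power_add[OF u])
    also have "\<dots> = (\<Sum>h\<in>S. form_mult (series_power u m h) (series_power u n (g - h)) xs)"
      by (rule series_mult_eq_sum_superset) (auto simp: S_def L_def weight_ge_0_series_power u)
    finally show "(\<Sum>h\<in>S. fps_nth a m * fps_nth b n *
        form_mult (series_power u m h) (series_power u n (g - h)) xs) =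
      fps_nth a m * fps_nth b n * series_power u (m + n) g xs"
      by (simp add: sum_distrib_left)
  qed
  also have "\<dots> = (\<Sum>(m, n)\<in>{..N} \<times> {..N}. fps_nth a m * fps_nth b n * series_power u (m + n) g xs)"
    by (simp add: sum.cartesian_product)
  \<comment> \<open>From the square to the triangle: the dropped pairs have exponent above
    \<open>N\<close>, hence above the weight.\<close>
  also have "\<dots> = (\<Sum>(m, n)\<in>{(m, n). m + n \<le> N}. fps_nth a m * fps_nth b n * series_power u (m + n) g xs)"
    by (rule sum.mono_neutral_right) (auto simp: N_def L_def intro!: series_power_eq_0[OF u])
  also have "\<dots> = (\<Sum>k\<le>N. \<Sum>i\<le>k. fps_nth a i * fps_nth b (k - i) * series_power u k g xs)"
    by (subst sum.triangle_reindex_eq) simp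
  also have "\<dots> = (\<Sum>k\<le>N. fps_nth (a * b) k * series_power u k g xs)"
    by (simp add: fps_mult_nth sum_distrib_right atLeast0AtMost)
  also have "\<dots> = fps_eval (a * b) u g xs"
    by (rule fps_eval_eq[OF u, symmetric]) (auto simp: N_def L_def)
  finally show "series_mult (fps_eval a u) (fps_eval b u) g xs = fps_eval (a * b) u g xs" .
qed

lemma fps_eval_one:
  assumes "weight_ge 1 u" shows "fps_eval 1 u = series_one"
proof (intro ext)
  fix g and xs :: "'a hvec list"
  have "fps_eval 1 u g xs = (\<Sum>n\<le>nat (weight g xs). if n = 0 then series_one g xs else 0)"
    unfolding fps_eval_def by (rule sum.cong) auto
  then show "fps_eval 1 u g xs = series_one g xs" by simp
qed

lemma fps_eval_power:
  "weight_ge 1 u \<Longrightarrow> series_power (fps_eval a u) n = fps_eval (a ^ n) u"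
  by (induction n) (simp_all add: fps_eval_one fps_eval_mult)

lemma fps_exp_compose_ln: "fps_compose (fps_exp 1) (fps_ln (1::real)) = 1 + fps_X"
proof -
  have "fps_compose (fps_exp 1 - 1) (fps_ln (1::real)) = fps_X"
    using fps_inv_right[of "fps_exp (1::real) - 1"] by (simp add: fps_ln_fps_exp_inv)
  then show ?thesis by (simp add: fps_compose_sub_distrib algebra_simps)
qed

lemma series_log_eq_fps_eval:
  assumes u: "weight_ge 1 (F - series_one)"
  shows "series_log F = fps_eval (fps_ln 1) (F - series_one)"
proof (intro ext)
  fix g and xs :: "'a hvec list"
  let ?u = "F - series_one"
  have "series_log F g xs = (\<Sum>n\<le>nat (weight g xs).
      if n = 0 then 0 else (- 1) ^ (n + 1) / real n * series_power ?u n g xs)"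
    unfolding series_log_def
    by (rule Sum_any.expand_superset) (auto intro: ccontr simp: not_le series_power_eq_0[OF u])
  also have "\<dots> = fps_eval (fps_ln 1) ?u g xs"
    unfolding fps_eval_def
    by (rule sum.cong) (auto simp: fps_ln_nth power_add[symmetric] gr0_conv_Suc)
  finally show "series_log F g xs = fps_eval (fps_ln 1) ?u g xs" .
qed

lemma series_exp_eq_sum:
  assumes u: "weight_ge 1 u" and N: "weight g xs \<le> int N"
  shows "series_exp u g xs = (\<Sum>n\<le>N. series_power u n g xs / fact n)"
  unfolding series_exp_def
  by (rule Sum_any.expand_superset) (use N in \<open>auto intro: ccontr simp: not_le series_power_eq_0[OF u]\<close>)

text \<open>Exponential and logarithm are substitutions of \<open>u\<close>, so their composite is
  the substitution of \<open>1 + fps_X\<close>. Thanks to this only the exponential of the effective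
  action has to be studied.\<close>

lemma series_exp_log:
  assumes u: "weight_ge 1 (F - series_one)"
  shows "series_exp (series_log F) = F"
proof (intro ext)
  fix g and xs :: "'a hvec list"
  define u where "u = F - series_one"
  have u: "weight_ge 1 u" using assms by (simp add: u_def)
  \<comment> \<open>The summand 1 keeps the linear coefficient of \<open>1 + fps_X\<close> inside
    the truncated sum.\<close>
  define N where "N = nat (\<bar>weight g xs\<bar>) + 1"
  have N: "weight g xs \<le> int N" by (simp add: N_def)
  define l where "l = fps_ln (1 :: real)"
  \<comment> \<open>\<open>l\<close> has no constant term, so its n-th power starts in order n;
    hence \<open>n\<close> and \<open>k\<close> may run up to the same bound.\<close>
  have low: "fps_nth (l ^ n) k = 0" if "k < n" for k n
    using startsby_zero_power_prefix[of l n] that by (simp add: l_def)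
  have v: "weight_ge 1 (fps_eval l u)"
    using weight_ge_fps_eval[OF u, of 1 l] by (simp add: l_def)
  have "series_exp (series_log F) g xs = series_exp (fps_eval l u) g xs"
    by (simp add: series_log_eq_fps_eval assms u_def l_def)
  also have "\<dots> = (\<Sum>n\<le>N. fps_eval (l ^ n) u g xs / fact n)"
    by (simp add: series_exp_eq_sum[OF v N] fps_eval_power[OF u])
  also have "\<dots> = (\<Sum>n\<le>N. \<Sum>k\<le>N. fps_nth (l ^ n) k / fact n * series_power u k g xs)"
    by (simp add: fps_eval_eq[OF u N] sum_divide_distrib)
  also have "\<dots> = (\<Sum>k\<le>N. \<Sum>n\<le>N. fps_nth (l ^ n) k / fact n * series_power u k g xs)"
    by (rule sum.swap)
  also have "\<dots> = (\<Sum>k\<le>N. fps_nth (fps_compose (fps_exp 1) l) k * series_power u k g xs)"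
  proof (rule sum.cong[OF refl])
    fix k assume "k \<in> {..N}"
    then have "fps_nth (fps_compose (fps_exp 1) l) k = (\<Sum>n\<le>N. fps_nth (l ^ n) k / fact n)"
      unfolding fps_compose_nth atLeast0AtMost
      by (intro sum.mono_neutral_cong_left) (auto simp: low)
    then show "(\<Sum>n\<le>N. fps_nth (l ^ n) k / fact n * series_power u k g xs) =
        fps_nth (fps_compose (fps_exp 1) l) k * series_power u k g xs"
      by (simp add: sum_distrib_right)
  qed
  also have "\<dots> = (\<Sum>k\<in>{0, 1}. series_power u k g xs)"
    unfolding l_def fps_exp_compose_ln
    by (rule sum.mono_neutral_cong_right) (auto simp: N_def fps_X_def)
  also have "\<dots> = F g xs"
    by (simp add: u_def series_mult_one_right)
  finally show "series_exp (series_log F) g xs = F g xs" .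
qed

lemma series_exp_low_weight:
  assumes u: "weight_ge 1 u" and "weight g xs \<le> 0"
  shows "series_exp u g xs = series_one g xs"
  using series_exp_eq_sum[OF u, of xs g 0] assms(2) by simp

section \<open>Graded symmetric forms\<close>

lemma sym_formsI:
  assumes "\<And>xs. \<not> hom_list G xs \<Longrightarrow> f xs = 0"
    and "\<And>xs ys d u v. u \<in> hcomp G d \<Longrightarrow> v \<in> hcomp G d \<Longrightarrow>
      f (xs @ (d, vadd G u v) # ys) = f (xs @ (d, u) # ys) + f (xs @ (d, v) # ys)"
    and "\<And>xs ys d c v. v \<in> hcomp G d \<Longrightarrow> f (xs @ (d, vscale G c v) # ys) = c * f (xs @ (d, v) # ys)"
    and "\<And>xs ys x y. f (xs @ x # y # ys) = ksgn (fst x * fst y) * f (xs @ y # x # ys)"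
  shows "f \<in> sym_forms G"
  unfolding sym_forms_def using assms by blast

lemma sym_formsD:
  assumes "f \<in> sym_forms G"
  shows "\<And>xs. \<not> hom_list G xs \<Longrightarrow> f xs = 0"
    and "\<And>xs ys d u v. u \<in> hcomp G d \<Longrightarrow> v \<in> hcomp G d \<Longrightarrow>
      f (xs @ (d, vadd G u v) # ys) = f (xs @ (d, u) # ys) + f (xs @ (d, v) # ys)"
    and "\<And>xs ys d c v. v \<in> hcomp G d \<Longrightarrow> f (xs @ (d, vscale G c v) # ys) = c * f (xs @ (d, v) # ys)"
    and "\<And>xs ys x y. f (xs @ x # y # ys) = ksgn (fst x * fst y) * f (xs @ y # x # ys)"
  using assms unfolding sym_forms_def by blast+

lemma sym_forms_Cons:
  assumes "f \<in> sym_forms G" shows "(\<lambda>ys. f (x # ys)) \<in> sym_forms G"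
proof (rule sym_formsI)
  show "f (x # xs) = 0" if "\<not> hom_list G xs" for xs
    using sym_formsD(1)[OF assms] that by (auto simp: hom_list_def)
next
  show "f (x # xs @ (d, vadd G u v) # ys) = f (x # xs @ (d, u) # ys) + f (x # xs @ (d, v) # ys)"
    if "u \<in> hcomp G d" "v \<in> hcomp G d" for xs ys d u v
    using sym_formsD(2)[OF assms that, where xs = "x # xs"] by simp
  show "f (x # xs @ (d, vscale G c v) # ys) = c * f (x # xs @ (d, v) # ys)"
    if "v \<in> hcomp G d" for xs ys d c v
    using sym_formsD(3)[OF assms that, where xs = "x # xs"] by simp
  show "f (x # xs @ y # z # ys) = ksgn (fst y * fst z) * f (x # xs @ z # y # ys)" for xs ys y z
    using sym_formsD(4)[OF assms, of "x # xs" y z ys] by simp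
qed

lemma sym_forms_sign:
  assumes "f \<in> sym_forms G" shows "(\<lambda>ys. ksgn (m * degs ys) * f ys) \<in> sym_forms G"
proof (rule sym_formsI)
  show "ksgn (m * degs (xs @ x # y # ys)) * f (xs @ x # y # ys) =
    ksgn (fst x * fst y) * (ksgn (m * degs (xs @ y # x # ys)) * f (xs @ y # x # ys))" for xs ys x y
    by (subst sym_formsD(4)[OF assms]) (simp add: algebra_simps)
qed (use sym_formsD(1-3)[OF assms] in \<open>auto simp: algebra_simps\<close>)

lemma sym_forms_zero: "(\<lambda>_. 0) \<in> sym_forms G"
  by (rule sym_formsI) auto

lemma sym_forms_add:
  assumes "f \<in> sym_forms G" "g \<in> sym_forms G" shows "(\<lambda>ys. f ys + g ys) \<in> sym_forms G"
proof (rule sym_formsI)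
  show "f (xs @ x # y # ys) + g (xs @ x # y # ys) =
    ksgn (fst x * fst y) * (f (xs @ y # x # ys) + g (xs @ y # x # ys))" for xs ys x y
    by (subst sym_formsD(4)[OF assms(1)], subst sym_formsD(4)[OF assms(2)]) (simp add: algebra_simps)
qed (use sym_formsD(1-3)[OF assms(1)] sym_formsD(1-3)[OF assms(2)] in \<open>auto simp: algebra_simps\<close>)

lemma sym_forms_scale:
  assumes "f \<in> sym_forms G" shows "(\<lambda>ys. c * f ys) \<in> sym_forms G"
proof (rule sym_formsI)
  show "c * f (xs @ x # y # ys) = ksgn (fst x * fst y) * (c * f (xs @ y # x # ys))" for xs ys x y
    by (subst sym_formsD(4)[OF assms(1)]) (simp add: algebra_simps)
qed (use sym_formsD(1-3)[OF assms(1)] in \<open>auto simp: algebra_simps\<close>)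

lemma sym_forms_sum:
  "(\<And>i. i \<in> I \<Longrightarrow> f i \<in> sym_forms G) \<Longrightarrow> (\<lambda>ys. \<Sum>i\<in>I. f i ys) \<in> sym_forms G"
  by (induction I rule: infinite_finite_induct) (simp_all add: sym_forms_zero sym_forms_add)

text \<open>Each axiom of \<open>sym_forms\<close> relates values on lists of one length, so a
  different witness may be used for each length. Infinite sums of forms become finite only after the
  length is fixed.\<close>

lemma sym_forms_by_length:
  assumes "\<And>L. \<exists>f'\<in>sym_forms G. \<forall>xs. length xs = L \<longrightarrow> f xs = f' xs"
  shows "f \<in> sym_forms G"
proof (rule sym_formsI)
  fix xs ys :: "'a hvec list" and x y
  obtain f' where f': "f' \<in> sym_forms G" "\<And>zs. length zs = length (xs @ x # y # ys) \<Longrightarrow> f zs = f' zs"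
    using assms[of "length (xs @ x # y # ys)"] by blast
  show "f (xs @ x # y # ys) = ksgn (fst x * fst y) * f (xs @ y # x # ys)"
    using sym_formsD(4)[OF f'(1), of xs x y ys] by (simp add: f'(2))
next
  fix xs :: "'a hvec list" assume n: "\<not> hom_list G xs"
  obtain f' where f': "f' \<in> sym_forms G" "\<And>zs. length zs = length xs \<Longrightarrow> f zs = f' zs"
    using assms[of "length xs"] by blast
  show "f xs = 0" using sym_formsD(1)[OF f'(1) n] by (simp add: f'(2))
next
  fix xs ys :: "'a hvec list" and d u v assume uv: "u \<in> hcomp G d" "v \<in> hcomp G d"
  obtain f' where f': "f' \<in> sym_forms G" "\<And>zs. length zs = length (xs @ (d, u) # ys) \<Longrightarrow> f zs = f' zs"
    using assms[of "length (xs @ (d, u) # ys)"] by blast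
  show "f (xs @ (d, vadd G u v) # ys) = f (xs @ (d, u) # ys) + f (xs @ (d, v) # ys)"
    using sym_formsD(2)[OF f'(1) uv, of xs ys] by (simp add: f'(2))
next
  fix xs ys :: "'a hvec list" and d c v assume v: "v \<in> hcomp G d"
  obtain f' where f': "f' \<in> sym_forms G" "\<And>zs. length zs = length (xs @ (d, v) # ys) \<Longrightarrow> f zs = f' zs"
    using assms[of "length (xs @ (d, v) # ys)"] by blast
  show "f (xs @ (d, vscale G c v) # ys) = c * f (xs @ (d, v) # ys)"
    using sym_formsD(3)[OF f'(1) v, of xs c ys] by (simp add: f'(2))
qed

text \<open>Peeling off a prefix keeps both factors symmetric forms, up to a sign twist. Additivity,
  scaling and symmetry are thereby decided at the head of the list by unfolding the Leibniz
  rule.\<close>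

lemma sym_forms_form_mult:
  assumes "f \<in> sym_forms G" "g \<in> sym_forms G"
  shows "form_mult f g \<in> sym_forms G"
proof (rule sym_formsI)
  show "form_mult f g xs = 0" if "\<not> hom_list G xs" for xs
    using that assms
  proof (induction xs arbitrary: f g)
    case (Cons x xs)
    show ?case
    proof (cases "hom_list G xs")
      case True
      then have "\<not> hom_list G (x # ys)" for ys using Cons.prems(1) by (auto simp: hom_list_def)
      then have "(\<lambda>ys. f (x # ys)) = (\<lambda>_. 0)" "(\<lambda>ys. g (x # ys)) = (\<lambda>_. 0)"
        using sym_formsD(1)[OF Cons.prems(2)] sym_formsD(1)[OF Cons.prems(3)] by (simp_all add: fun_eq_iff)
      then show ?thesis by simp
    next
      case False
      then show ?thesis using Cons.IH[OF False] Cons.prems(2,3)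
        by (simp add: sym_forms_Cons sym_forms_sign)
    qed
  qed (simp add: hom_list_def)
next
  fix xs ys d u v assume uv: "u \<in> hcomp G d" "v \<in> hcomp G d"
  show "form_mult f g (xs @ (d, vadd G u v) # ys) =
      form_mult f g (xs @ (d, u) # ys) + form_mult f g (xs @ (d, v) # ys)"
    using assms
  proof (induction xs arbitrary: f g)
    case Nil
    have *: "h ((d, vadd G u v) # zs) = h ((d, u) # zs) + h ((d, v) # zs)" if "h \<in> sym_forms G" for h zs
      using sym_formsD(2)[OF that uv, of "[]" zs] by simp
    show ?case using *[OF Nil(1)] *[OF Nil(2)] by (simp add: form_mult_add)
  next
    case (Cons x xs)
    then show ?case by (simp add: sym_forms_Cons sym_forms_sign)
  qed
next
  fix xs ys d c v assume v: "v \<in> hcomp G d"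
  show "form_mult f g (xs @ (d, vscale G c v) # ys) = c * form_mult f g (xs @ (d, v) # ys)"
    using assms
  proof (induction xs arbitrary: f g)
    case Nil
    have *: "h ((d, vscale G c v) # zs) = c * h ((d, v) # zs)" if "h \<in> sym_forms G" for h zs
      using sym_formsD(3)[OF that v, of "[]" c zs] by simp
    show ?case using *[OF Nil(1)] *[OF Nil(2)] by (simp add: form_mult_scale distrib_left)
  next
    case (Cons x xs)
    then show ?case by (simp add: distrib_left sym_forms_Cons sym_forms_sign)
  qed
next
  fix xs ys x y
  show "form_mult f g (xs @ x # y # ys) = ksgn (fst x * fst y) * form_mult f g (xs @ y # x # ys)"
    using assms
  proof (induction xs arbitrary: f g)
    case Nil
    have sw: "h (x # y # zs) = ksgn (fst x * fst y) * h (y # x # zs)" if "h \<in> sym_forms G" for h zs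
      using sym_formsD(4)[OF that, of "[]" x y zs] by simp
    have c: "(\<lambda>zs. ksgn (fst y * degs zs) * (ksgn (fst x * degs zs) * f zs)) =
       (\<lambda>zs. ksgn (fst x * degs zs) * (ksgn (fst y * degs zs) * f zs))"
      by (simp add: mult.left_commute)
    show ?case
      using sw[OF Nil(1)] sw[OF Nil(2)]
      by (simp add: form_mult_add form_mult_scale distrib_left ksgn_add c mult.assoc)
        (simp add: algebra_simps)
  next
    case (Cons z xs)
    then show ?case by (simp add: distrib_left sym_forms_Cons sym_forms_sign)
  qed
qed

lemma sym_forms_series_mult:
  assumes "\<And>g. F g \<in> sym_forms G" "\<And>g. F' g \<in> sym_forms G" "weight_ge 0 F" "weight_ge 0 F'"
  shows "series_mult F F' g \<in> sym_forms G"
proof (rule sym_forms_by_length)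
  fix L
  show "\<exists>f'\<in>sym_forms G. \<forall>xs. length xs = L \<longrightarrow> series_mult F F' g xs = f' xs"
    by (rule bexI[of _ "\<lambda>xs. \<Sum>h\<in>{- int L..\<bar>g\<bar> + int L}. form_mult (F h) (F' (g - h)) xs"])
      (auto simp: assms sym_forms_form_mult intro!: series_mult_eq_sum_superset sym_forms_sum)
qed

lemma sym_forms_series_one:
  "series_one g \<in> sym_forms G"
  by (rule sym_formsI) (auto simp: series_one_def hom_list_def)

lemma sym_forms_series_power:
  assumes "\<And>g. F g \<in> sym_forms G" "weight_ge 1 F"
  shows "series_power F n g \<in> sym_forms G"
proof (induction n arbitrary: g)
  case (Suc n)
  have "weight_ge 0 F" using assms weight_ge_mono by fastforce
  then show ?case using Suc assms by (simp add: sym_forms_series_mult weight_ge_0_series_power)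
qed (simp add: sym_forms_series_one)

section \<open>The exponential in the weight-completed space\<close>

definition hbar_bounded :: "'a series \<Rightarrow> bool" where
  "hbar_bounded F \<longleftrightarrow> (\<forall>w. \<exists>m. \<forall>g xs. weight g xs = w \<longrightarrow> F g xs \<noteq> 0 \<longrightarrow> m \<le> g)"

text \<open>Lengths are nonnegative, so in weight w the order g is at most w/2 anyway; finiteness of
  the set of orders is then just a lower bound.\<close>

lemma weight_completed_iff:
  "F \<in> weight_completed G \<longleftrightarrow> (\<forall>g. F g \<in> sym_forms G) \<and> hbar_bounded F"
proof -
  have "finite {g. \<exists>xs. weight g xs = w \<and> F g xs \<noteq> 0} \<longleftrightarrow>
    (\<exists>m. \<forall>g xs. weight g xs = w \<longrightarrow> F g xs \<noteq> 0 \<longrightarrow> m \<le> g)" (is "finite ?S \<longleftrightarrow> ?R") for w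
  proof
    assume fin: "finite ?S"
    show ?R
      by (rule exI[of _ "Min (insert 0 ?S)"]) (use fin in \<open>auto intro!: Min_le\<close>)
  next
    assume ?R
    then obtain m where "\<And>g xs. weight g xs = w \<Longrightarrow> F g xs \<noteq> 0 \<Longrightarrow> m \<le> g" by blast
    then have "?S \<subseteq> {m..\<bar>w\<bar>}" by fastforce
    then show "finite ?S" using finite_subset by blast
  qed
  then show ?thesis unfolding weight_completed_def hbar_bounded_def by simp
qed

text \<open>The quantity length + 3g is additive under products. The 3 is the least length of a
  classical interaction term, which has order -1 after division by hbar.\<close>

lemma series_power_hbar_bound:
  assumes "\<And>g xs. F g xs \<noteq> 0 \<Longrightarrow> 0 \<le> int (length xs) + 3 * g"
  shows "series_power F n g xs \<noteq> 0 \<Longrightarrow> 0 \<le> int (length xs) + 3 * g"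
proof (induction n arbitrary: g xs)
  case 0
  then show ?case by (auto simp: series_one_def split: if_splits)
next
  case (Suc n)
  then obtain h where "form_mult (F h) (series_power F n (g - h)) xs \<noteq> 0"
    unfolding series_power.simps series_mult_def using Sum_any.not_neutral_obtains_not_neutral by blast
  from form_mult_nonzero[OF this] obtain ys zs
    where l: "length ys + length zs = length xs" and n: "F h ys \<noteq> 0" "series_power F n (g - h) zs \<noteq> 0" by blast
  show ?case using assms[OF n(1)] Suc.IH[OF n(2)] l by auto
qed

lemma weight_completed_series_exp:
  assumes F: "\<And>g. F g \<in> sym_forms G" "weight_ge 1 F"
    and b: "\<And>g xs. F g xs \<noteq> 0 \<Longrightarrow> 0 \<le> int (length xs) + 3 * g"
  shows "series_exp F \<in> weight_completed G"
  unfolding weight_completed_iff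
proof (intro conjI allI)
  show "series_exp F g \<in> sym_forms G" for g
  proof (rule sym_forms_by_length)
    fix L
    have "(\<lambda>xs. 1 / fact n * series_power F n g xs) \<in> sym_forms G" for n
      by (rule sym_forms_scale, rule sym_forms_series_power[OF F])
    then have "(\<lambda>xs. \<Sum>n\<le>nat (int L + 2 * g). 1 / fact n * series_power F n g xs) \<in> sym_forms G"
      by (rule sym_forms_sum)
    then show "\<exists>f'\<in>sym_forms G. \<forall>xs. length xs = L \<longrightarrow> series_exp F g xs = f' xs"
      by (rule bexI[rotated]) (auto simp: series_exp_eq_sum[OF F(2), of _ _ "nat (int L + 2 * g)"])
  qed
  \<comment> \<open>Subtracting length + 2g = w from length + 3g \<ge> 0 leaves g \<ge> -w.\<close>
  have "- w \<le> g" if "weight g xs = w" "series_exp F g xs \<noteq> 0" for w g and xs :: "'a hvec list"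
  proof -
    obtain n where "series_power F n g xs / fact n \<noteq> 0"
      using \<open>series_exp F g xs \<noteq> 0\<close> unfolding series_exp_def
      using Sum_any.not_neutral_obtains_not_neutral by blast
    then have "0 \<le> int (length xs) + 3 * g" using series_power_hbar_bound[OF b] by auto
    then show ?thesis using that by simp
  qed
  then show "hbar_bounded (series_exp F)" unfolding hbar_bounded_def by blast
qed

section \<open>Graded linear algebra and the Casimir element\<close>

text \<open>An injective map carries a basis of S to an independent subset of S of the same size,
  which therefore spans S.\<close>

lemma finite_dimensional_inj_image_eq:
  fixes f :: "'v::real_vector \<Rightarrow> 'v"
  assumes fd: "finite_dimensional TYPE('v)" and f: "linear f" and S: "subspace S"
    and inj: "inj_on f S" and sub: "f ` S \<subseteq> S"
  shows "f ` S = S"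
proof -
  obtain F :: "'v set" where F: "finite F" "span F = UNIV"
    using fd unfolding finite_dimensional_def by blast
  obtain B where B: "B \<subseteq> S" "independent B" "S \<subseteq> span B"
    by (rule real_vector.maximal_independent_subset)
  have SB: "S = span B" using B S by (intro subset_antisym span_minimal)
  have finB: "finite B" using independent_span_bound[OF F(1) B(2)] F(2) by simp
  have ind: "independent (f ` B)"
    by (rule linear_independent_injective_image[OF f B(2)]) (use inj SB in blast)
  have card: "card (f ` B) = card B"
    by (rule card_image[OF inj_on_subset[OF inj B(1)]])
  have "S \<subseteq> span (f ` B)"
  proof
    fix v assume v: "v \<in> S"
    show "v \<in> span (f ` B)"
    proof (rule ccontr)
      assume n: "v \<notin> span (f ` B)"
      then have "independent (insert v (f ` B))" using ind by (simp add: independent_insertI)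
      moreover have "insert v (f ` B) \<subseteq> span B" using v sub B(1) unfolding SB[symmetric] by blast
      ultimately have "card (insert v (f ` B)) \<le> card B"
        using independent_span_bound[OF finB] by blast
      moreover have "v \<notin> f ` B" using n span_base by metis
      ultimately show False using finB card by simp
    qed
  qed
  also have "span (f ` B) = f ` S" unfolding SB by (rule linear_span_image[OF f])
  finally show ?thesis using sub by blast
qed

lemma sum_list_sum_swap:
  "(\<Sum>x\<leftarrow>xs. \<Sum>y\<in>Y. f x y) = (\<Sum>y\<in>Y. \<Sum>x\<leftarrow>xs. (f x y :: 'a::comm_monoid_add))"
  by (induction xs) (simp_all add: sum.distrib)

lemma linear_sum_list: "linear f \<Longrightarrow> f (\<Sum>x\<leftarrow>xs. g x) = (\<Sum>x\<leftarrow>xs. f (g x))"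
  by (induction xs) (simp_all add: linear_0 linear_add)

lemma sum_list_scale: "(\<Sum>x\<leftarrow>xs. c * f x) = (c::real) * (\<Sum>x\<leftarrow>xs. f x)"
  by (induction xs) (simp_all add: algebra_simps)

section \<open>Homogeneous components and bases\<close>

locale dg_symp =
  fixes V :: "int \<Rightarrow> 'v::real_vector set" and \<omega> :: "'v \<Rightarrow> 'v \<Rightarrow> real" and q :: "'v \<Rightarrow> 'v"
  assumes fd: "finite_dimensional TYPE('v)" and dg: "dg_shifted_symplectic V \<omega> q"
begin

lemma dg_unfolded: "graded_space V" "bilinear \<omega>" "\<forall>v w. \<omega> v w = - \<omega> w v"
    "\<forall>d e. \<forall>v\<in>V d. \<forall>w\<in>V e. d + e \<noteq> 1 \<longrightarrow> \<omega> v w = 0"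
    "\<forall>v. (\<forall>w. \<omega> v w = 0) \<longrightarrow> v = 0"
    "linear q" "\<forall>d. \<forall>v\<in>V d. q v \<in> V (d + 1)" "\<forall>v. q (q v) = 0"
    "\<forall>d. \<forall>v\<in>V d. \<forall>w. \<omega> (q v) w + ksgn d * \<omega> v (q w) = 0"
  using dg unfolding dg_shifted_symplectic_def shifted_symplectic_def by - (elim conjE, assumption)+

lemmas graded = dg_unfolded(1)
lemmas bilin = dg_unfolded(2)
lemmas \<omega>_swap = dg_unfolded(3)[THEN spec, THEN spec]
lemmas \<omega>_deg = dg_unfolded(4)[THEN spec, THEN spec, THEN bspec, THEN bspec, THEN mp]
lemmas lin_q = dg_unfolded(6)
lemmas q_V = dg_unfolded(7)[THEN spec, THEN bspec]
lemmas q_q [simp] = dg_unfolded(8)[THEN spec]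

lemma \<omega>_nondeg: "(\<And>w. \<omega> v w = 0) \<Longrightarrow> v = 0"
  using dg_unfolded(5) by blast

lemma \<omega>_q:
  assumes "v \<in> V d" shows "\<omega> (q v) w = - ksgn d * \<omega> v (q w)"
proof -
  have "\<omega> (q v) w + ksgn d * \<omega> v (q w) = 0" using dg_unfolded(9) assms by blast
  then show ?thesis by simp
qed

lemma sub_V: "subspace (V d)"
  using graded unfolding graded_space_def by blast

lemmas q_simps = linear_add[OF lin_q] linear_diff[OF lin_q] linear_scale[OF lin_q] linear_0[OF lin_q] linear_neg[OF lin_q]

lemmas \<omega>_simps = bilinear_ladd[OF bilin] bilinear_radd[OF bilin] bilinear_lmul[OF bilin]
  bilinear_rmul[OF bilin] bilinear_lneg[OF bilin] bilinear_rneg[OF bilin] bilinear_lzero[OF bilin]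
  bilinear_rzero[OF bilin] bilinear_lsub[OF bilin] bilinear_rsub[OF bilin]

lemma lin_\<omega>_left: "linear (\<lambda>v. \<omega> v w)" and lin_\<omega>_right: "linear (\<omega> w)"
  using bilin unfolding bilinear_def by blast+

definition part :: "'v \<Rightarrow> int \<Rightarrow> 'v" where
  "part v = (THE c. (\<forall>d. c d \<in> V d) \<and> finite {d. c d \<noteq> 0} \<and> v = (\<Sum>d | c d \<noteq> 0. c d))"

lemma part: "part v d \<in> V d" "finite {d. part v d \<noteq> 0}" "(\<Sum>d | part v d \<noteq> 0. part v d) = v"
proof -
  have "\<exists>!c. (\<forall>d. c d \<in> V d) \<and> finite {d. c d \<noteq> 0} \<and> v = (\<Sum>d | c d \<noteq> 0. c d)"
    using graded unfolding graded_space_def by blast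
  from theI'[OF this, folded part_def]
  show "part v d \<in> V d" "finite {d. part v d \<noteq> 0}" "(\<Sum>d | part v d \<noteq> 0. part v d) = v" by auto
qed

lemma part_sum: "finite D \<Longrightarrow> {d. part v d \<noteq> 0} \<subseteq> D \<Longrightarrow> (\<Sum>d\<in>D. part v d) = v"
  using part(3)[of v] by (subst sum.mono_neutral_right[of D "{d. part v d \<noteq> 0}"]) auto

lemma part_unique:
  assumes c: "\<And>d. c d \<in> V d" and D: "finite D" "{d. c d \<noteq> 0} \<subseteq> D" and v: "v = (\<Sum>d\<in>D. c d)"
  shows "part v = c"
proof -
  have ex1: "\<exists>!c. (\<forall>d. c d \<in> V d) \<and> finite {d. c d \<noteq> 0} \<and> v = (\<Sum>d | c d \<noteq> 0. c d)"
    using graded unfolding graded_space_def by blast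
  have "(\<Sum>d\<in>D. c d) = (\<Sum>d | c d \<noteq> 0. c d)"
    using D by (intro sum.mono_neutral_right) auto
  then have "(\<forall>d. c d \<in> V d) \<and> finite {d. c d \<noteq> 0} \<and> v = (\<Sum>d | c d \<noteq> 0. c d)"
    using c D v finite_subset by auto
  moreover have "(\<forall>d. part v d \<in> V d) \<and> finite {d. part v d \<noteq> 0} \<and> v = (\<Sum>d | part v d \<noteq> 0. part v d)"
    using part by auto
  ultimately show ?thesis using ex1 by blast
qed

lemma part_hom: "v \<in> V d \<Longrightarrow> part v = (\<lambda>e. if e = d then v else 0)"
  by (rule part_unique[of _ "{d}"]) (auto simp: subspace_0[OF sub_V])

lemma part_add: "part (v + w) d = part v d + part w d"
proof -
  let ?D = "{d. part v d \<noteq> 0} \<union> {d. part w d \<noteq> 0}"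
  have "part (v + w) = (\<lambda>d. part v d + part w d)"
  proof (rule part_unique[of _ ?D])
    show "v + w = (\<Sum>d\<in>?D. part v d + part w d)"
      unfolding sum.distrib by (subst (1 2) part_sum) (auto simp: part)
  qed (auto simp: part subspace_add[OF sub_V])
  then show ?thesis by simp
qed

lemma part_scale: "part (c *\<^sub>R v) d = c *\<^sub>R part v d"
proof -
  have "part (c *\<^sub>R v) = (\<lambda>d. c *\<^sub>R part v d)"
  proof (rule part_unique[of _ "{d. part v d \<noteq> 0}"])
    show "c *\<^sub>R v = (\<Sum>d | part v d \<noteq> 0. c *\<^sub>R part v d)"
      using part(3)[of v] by (simp flip: scaleR_sum_right)
  qed (auto simp: part subspace_scale[OF sub_V])
  then show ?thesis by simp
qed

lemma lin_comp: "linear (\<lambda>v. part v d)"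
  by (rule linearI) (simp_all add: part_add part_scale)

lemma span_homogeneous: "v \<in> span (\<Union>d. V d)"
proof -
  have "(\<Sum>d | part v d \<noteq> 0. part v d) \<in> span (\<Union>d. V d)"
    by (intro span_sum span_base) (auto intro: part)
  then show ?thesis by (simp add: part)
qed

lemma linear_eq_hom:
  assumes "linear f" "linear g" "\<And>d v. v \<in> V d \<Longrightarrow> f v = g v"
  shows "f v = g v"
  by (rule linear_eq_on[OF assms(1,2) span_homogeneous]) (use assms(3) in auto)

lemma homogeneous_basis:
  obtains B where "finite B" "independent B" "span B = UNIV" "B \<subseteq> (\<Union>d. V d)"
proof -
  obtain F :: "'v set" where F: "finite F" "span F = UNIV"
    using fd unfolding finite_dimensional_def by blast
  obtain B where B: "B \<subseteq> (\<Union>d. V d)" "independent B" "(\<Union>d. V d) \<subseteq> span B"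
    by (rule real_vector.maximal_independent_subset)
  have "finite B" using independent_span_bound[OF F(1) B(2)] F(2) by simp
  moreover have "v \<in> span B" for v
    using span_homogeneous[of v] span_minimal[OF B(3) subspace_span] by blast
  then have "span B = UNIV" by blast
  ultimately show ?thesis using that[of B] B by blast
qed

lemma finite_degrees: obtains D where "finite D" "\<And>v d. d \<notin> D \<Longrightarrow> part v d = 0"
proof -
  obtain B where B: "finite B" "independent B" "span B = UNIV" "B \<subseteq> (\<Union>d. V d)"
    by (rule homogeneous_basis)
  have "part v d = 0" if "d \<notin> (\<Union>b\<in>B. {d. part b d \<noteq> 0})" for v d
  proof (rule linear_eq_0_on_span[where f = "\<lambda>v. part v d" and b = B])
    show "part b d = 0" if "b \<in> B" for b using that \<open>d \<notin> _\<close> by auto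
  qed (simp_all add: B(3) lin_comp)
  then show ?thesis by (rule that[of "\<Union>b\<in>B. {d. part b d \<noteq> 0}", rotated]) (use B(1) part(2) in auto)
qed

text \<open>The first legs form a homogeneous basis and the second legs its dual basis with respect
  to \<omega>, adjusted by signs.\<close>

lemma dual_basis_exists:
  "\<exists>cas :: ('v hvec \<times> 'v hvec) set. finite cas \<and>
     (\<forall>(a, b)\<in>cas. snd a \<in> V (fst a) \<and> snd b \<in> V (fst b) \<and> fst a + fst b = 1) \<and>
     (\<forall>d. \<forall>v\<in>V d. (\<Sum>(a, b)\<in>cas. \<omega> (snd b) v *\<^sub>R snd a) = ksgn d *\<^sub>R v)"
proof -
  obtain B where B: "finite B" "independent B" "span B = UNIV" "B \<subseteq> (\<Union>d. V d)"
    using homogeneous_basis by metis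
  obtain dg where dg: "\<And>b. b \<in> B \<Longrightarrow> b \<in> V (dg b)" using B(4) by (metis UN_E subsetD)
  \<comment> \<open>\<open>T w\<close> has the values of \<omega>(w, .) on the basis as coordinates.
    Non-degeneracy makes \<open>T\<close> injective, hence onto, and preimages of the basis vectors
    form the dual basis.\<close>
  define T where "T w = (\<Sum>b\<in>B. \<omega> w b *\<^sub>R b)" for w
  have linT: "linear T"
    by (rule linearI) (simp_all add: T_def \<omega>_simps scaleR_left_distrib sum.distrib scaleR_sum_right)
  have coord: "c b = c' b" if "(\<Sum>b\<in>B. c b *\<^sub>R b) = (\<Sum>b\<in>B. c' b *\<^sub>R b)" "b \<in> B" for c c' b
  proof -
    have "(\<Sum>b\<in>B. (c b - c' b) *\<^sub>R b) = 0"
      using that(1) by (simp add: scaleR_left_diff_distrib sum_subtractf)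
    moreover have "\<forall>u. (\<forall>v\<in>B. u v = 0) \<or> (\<Sum>v\<in>B. u v *\<^sub>R v) \<noteq> 0"
      using B(2) by (simp add: dependent_finite[OF B(1)])
    ultimately have "c b - c' b = 0"
      using that(2) by (auto dest: spec[of _ "\<lambda>b. c b - c' b"])
    then show ?thesis by simp
  qed
  have "inj T"
  proof (rule linear_injective_0[THEN iffD2, OF linT, rule_format])
    fix w assume "T w = 0"
    then have "\<omega> w b = 0" if "b \<in> B" for b
      using coord[of "\<omega> w" "\<lambda>_. 0" b] that by (simp add: T_def)
    then have "\<omega> w v = 0" for v
      using linear_eq_0_on_span[OF lin_\<omega>_right, of B w v] B(3) by auto
    then show "w = 0" by (rule \<omega>_nondeg)
  qed
  then have "surj T"
    using finite_dimensional_inj_image_eq[OF fd linT, of UNIV] by simp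
  then obtain e where e: "\<And>b. T (e b) = b" by (metis surjD)
  have dual: "\<omega> (e b) b' = (if b' = b then 1 else 0)" if b: "b \<in> B" "b' \<in> B" for b b'
  proof (rule coord[of "\<omega> (e b)" "\<lambda>b'. if b' = b then 1 else 0"])
    show "(\<Sum>b'\<in>B. \<omega> (e b) b' *\<^sub>R b') = (\<Sum>b'\<in>B. (if b' = b then 1 else 0) *\<^sub>R b')"
      using e[of b] b B(1) by (simp add: T_def if_distrib[of "\<lambda>r. r *\<^sub>R _"] cong: if_cong)
  qed (rule b)
  \<comment> \<open>Only the component of degree \<open>1 - dg b\<close> pairs with vectors of
    degree \<open>dg b\<close>, so discarding the others keeps the duality and makes each pair have
    total degree 1.\<close>
  define h where "h b = part (e b) (1 - dg b)" for b
  have hV: "h b \<in> V (1 - dg b)" for b by (simp add: h_def part)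
  have hdual: "\<omega> (h b) b' = (if b' = b then 1 else 0)" if b: "b \<in> B" "b' \<in> B" for b b'
  proof (cases "dg b' = dg b")
    case True
    have "\<omega> (e b) b' = \<omega> (\<Sum>d\<in>insert (1 - dg b) {d. part (e b) d \<noteq> 0}. part (e b) d) b'"
      by (subst part_sum) (auto simp: part)
    also have "\<dots> = (\<Sum>d\<in>insert (1 - dg b) {d. part (e b) d \<noteq> 0}. \<omega> (part (e b) d) b')"
      by (rule linear_sum[OF lin_\<omega>_left])
    also have "\<dots> = (\<Sum>d\<in>{1 - dg b}. \<omega> (part (e b) d) b')"
      by (rule sum.mono_neutral_right) (auto simp: part intro!: \<omega>_deg[OF part(1) dg[OF b(2)]] simp: True)
    finally show ?thesis using dual[OF b] by (simp add: h_def)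
  next
    case False
    then show ?thesis using \<omega>_deg[OF hV dg[OF b(2)]] by auto
  qed
  have rep: "(\<Sum>b\<in>B. \<omega> (h b) v *\<^sub>R b) = v" for v
  proof -
    have lin: "linear (\<lambda>v. \<Sum>b\<in>B. \<omega> (h b) v *\<^sub>R b)"
      by (rule linearI) (simp_all add: \<omega>_simps scaleR_left_distrib sum.distrib scaleR_sum_right)
    show ?thesis
    proof (rule linear_eq_on[OF lin linear_id[unfolded id_def], of v B])
      fix b' assume b': "b' \<in> B"
      have "(\<Sum>b\<in>B. \<omega> (h b) b' *\<^sub>R b) = (\<Sum>b\<in>B. if b = b' then b else 0)"
        by (rule sum.cong[OF refl]) (use hdual b' in auto)
      then show "(\<Sum>b\<in>B. \<omega> (h b) b' *\<^sub>R b) = b'" using B(1) b' by simp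
    qed (simp add: B(3))
  qed
  \<comment> \<open>Only basis vectors of the degree of v contribute to the expansion of v, so the
    sign of \<open>dg b\<close> becomes the sign of v.\<close>
  define p where "p b = ((dg b, b), (1 - dg b, ksgn (dg b) *\<^sub>R h b))" for b
  have inj: "inj_on p B" by (rule inj_onI) (simp add: p_def)
  show ?thesis
  proof (intro exI[of _ "p ` B"] conjI allI ballI)
    show "finite (p ` B)" using B(1) by simp
    show "case x of (a, b) \<Rightarrow> snd a \<in> V (fst a) \<and> snd b \<in> V (fst b) \<and> fst a + fst b = 1" if "x \<in> p ` B" for x
      using that dg hV by (auto simp: p_def subspace_scale[OF sub_V])
    fix d v assume v: "v \<in> V d"
    have "(\<Sum>(a, b)\<in>p ` B. \<omega> (snd b) v *\<^sub>R snd a) = (\<Sum>b\<in>B. (ksgn (dg b) * \<omega> (h b) v) *\<^sub>R b)"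
      by (subst sum.reindex[OF inj]) (simp add: p_def \<omega>_simps)
    also have "\<dots> = (\<Sum>b\<in>B. ksgn d *\<^sub>R \<omega> (h b) v *\<^sub>R b)"
    proof (rule sum.cong[OF refl])
      fix b assume "b \<in> B"
      show "(ksgn (dg b) * \<omega> (h b) v) *\<^sub>R b = ksgn d *\<^sub>R \<omega> (h b) v *\<^sub>R b"
        by (cases "d = dg b") (use \<omega>_deg[OF hV v] in auto)
    qed
    also have "\<dots> = ksgn d *\<^sub>R v" unfolding scaleR_sum_right[symmetric] rep ..
    finally show "(\<Sum>(a, b)\<in>p ` B. \<omega> (snd b) v *\<^sub>R snd a) = ksgn d *\<^sub>R v" .
  qed
qed

text \<open>The Casimir element as a set of pairs of total degree 1.  The lists allowed in \<open>casimir\<close> may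
  contain pairs of other degrees that cancel.\<close>

definition cas :: "('v hvec \<times> 'v hvec) set" where
  "cas = (SOME cas. finite cas \<and>
     (\<forall>(a, b)\<in>cas. snd a \<in> V (fst a) \<and> snd b \<in> V (fst b) \<and> fst a + fst b = 1) \<and>
     (\<forall>d. \<forall>v\<in>V d. (\<Sum>(a, b)\<in>cas. \<omega> (snd b) v *\<^sub>R snd a) = ksgn d *\<^sub>R v))"

lemma cas:
  shows finite_cas: "finite cas"
    and cas_V: "(a, b) \<in> cas \<Longrightarrow> snd a \<in> V (fst a)" "(a, b) \<in> cas \<Longrightarrow> snd b \<in> V (fst b)"
    and cas_deg: "(a, b) \<in> cas \<Longrightarrow> fst a + fst b = 1"
    and cas_rep: "v \<in> V d \<Longrightarrow> (\<Sum>(a, b)\<in>cas. \<omega> (snd b) v *\<^sub>R snd a) = ksgn d *\<^sub>R v"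
  using someI_ex[OF dual_basis_exists, folded cas_def] by blast+

lemma cas_sgn: "(a, b) \<in> cas \<Longrightarrow> ksgn (fst a) = - ksgn (fst b)"
  using cas_deg[of a b] unfolding ksgn_def by (auto simp: algebra_simps) presburger+

section \<open>Contraction of forms with tensors\<close>

definition hlin :: "('v hvec \<Rightarrow> real) \<Rightarrow> bool" where
  "hlin \<gamma> \<longleftrightarrow> (\<forall>d. \<forall>u\<in>V d. \<forall>v\<in>V d. \<gamma> (d, u + v) = \<gamma> (d, u) + \<gamma> (d, v)) \<and>
     (\<forall>d c. \<forall>v\<in>V d. \<gamma> (d, c *\<^sub>R v) = c * \<gamma> (d, v))"

lemma hlin_extend:
  assumes "hlin \<gamma>"
  obtains G where "linear G" "\<And>d v. v \<in> V d \<Longrightarrow> G v = \<gamma> (d, v)"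
proof -
  have add: "\<gamma> (d, u + v) = \<gamma> (d, u) + \<gamma> (d, v)" if "u \<in> V d" "v \<in> V d" for d u v
    using assms that unfolding hlin_def by blast
  have sc: "\<gamma> (d, c *\<^sub>R v) = c * \<gamma> (d, v)" if "v \<in> V d" for d c v
    using assms that unfolding hlin_def by blast
  have z: "\<gamma> (d, 0) = 0" for d using sc[of 0 d 0] subspace_0[OF sub_V] by simp
  obtain D where D: "finite D" "\<And>v d. d \<notin> D \<Longrightarrow> part v d = 0" using finite_degrees by blast
  define G where "G v = (\<Sum>d\<in>D. \<gamma> (d, part v d))" for v
  have "linear G"
    by (rule linearI) (simp_all add: G_def part_add part_scale add sc part sum.distrib sum_distrib_left)
  moreover have "G v = \<gamma> (d, v)" if v: "v \<in> V d" for d v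
  proof (cases "d \<in> D")
    case True
    have "G v = (\<Sum>e\<in>D. if e = d then \<gamma> (d, v) else 0)"
      unfolding G_def by (rule sum.cong) (auto simp: part_hom[OF v] z)
    then show ?thesis using True D(1) by simp
  next
    case False
    then have "v = 0" using D(2)[of d v] part_hom[OF v] by simp
    moreover have "G 0 = 0" using \<open>linear G\<close> by (rule linear_0)
    ultimately show ?thesis by (simp add: z)
  qed
  ultimately show ?thesis using that by blast
qed

text \<open>The reproducing property of \<open>cas\<close>, pushed through a linear extension of
  \<gamma>. The sign of w may be replaced by that of the first leg because \<omega>(b, w) \<noteq> 0
  forces both degrees to agree.\<close>

lemma hlin_cas:
  assumes \<gamma>: "hlin \<gamma>" and w: "w \<in> V e"
  shows "\<gamma> (e, w) = (\<Sum>(a, b)\<in>cas. ksgn (fst a) * \<omega> (snd b) w * \<gamma> a)"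
proof -
  obtain G where G: "linear G" "\<And>d v. v \<in> V d \<Longrightarrow> G v = \<gamma> (d, v)" using hlin_extend[OF \<gamma>] by blast
  have "w = ksgn e *\<^sub>R (\<Sum>(a, b)\<in>cas. \<omega> (snd b) w *\<^sub>R snd a)" by (simp add: cas_rep[OF w])
  then have "G w = G (ksgn e *\<^sub>R (\<Sum>(a, b)\<in>cas. \<omega> (snd b) w *\<^sub>R snd a))" by (rule arg_cong)
  also have "\<dots> = ksgn e * (\<Sum>(a, b)\<in>cas. \<omega> (snd b) w * G (snd a))"
    by (simp add: linear_scale[OF G(1)] linear_sum[OF G(1)] split_def)
  also have "\<dots> = (\<Sum>(a, b)\<in>cas. ksgn (fst a) * \<omega> (snd b) w * \<gamma> a)"
    unfolding sum_distrib_left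
  proof (rule sum.cong[OF refl], clarify)
    fix d a d' b assume c: "((d, a), (d', b)) \<in> cas"
    show "ksgn e * (\<omega> (snd (d', b)) w * G (snd (d, a))) = ksgn (fst (d, a)) * \<omega> (snd (d', b)) w * \<gamma> (d, a)"
      using cas_V[OF c] cas_deg[OF c] \<omega>_deg[OF cas_V(2)[OF c] w] G(2)[of a d]
      by (cases "e = d") (auto simp: algebra_simps)
  qed
  finally show ?thesis using G(2)[OF w] by simp
qed

text \<open>The contraction of a form with a tensor \<open>\<Sum> a \<otimes> b\<close> only depends on the operator
  \<open>v \<mapsto> \<Sum> \<omega>(b, v) a\<close>.\<close>

lemma contraction:
  fixes ks :: "('v hvec \<times> 'v hvec) list"
  assumes ks: "\<And>a b. (a, b) \<in> set ks \<Longrightarrow> snd a \<in> V (fst a) \<and> snd b \<in> V (fst b)"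
    and N: "\<And>d v. v \<in> V d \<Longrightarrow> (\<Sum>(a, b)\<leftarrow>ks. \<omega> (snd b) v *\<^sub>R snd a) = N d v"
      "\<And>d v. v \<in> V d \<Longrightarrow> N d v \<in> V (d + m)"
    and \<beta>: "\<And>x. snd x \<in> V (fst x) \<Longrightarrow> hlin (\<beta> x)" "\<And>y. snd y \<in> V (fst y) \<Longrightarrow> hlin (\<lambda>x. \<beta> x y)"
  shows "(\<Sum>(a, b)\<leftarrow>ks. \<beta> a b) = (\<Sum>(a, b)\<in>cas. ksgn (fst b) * \<beta> (fst b + m, N (fst b) (snd b)) a)"
proof -
  \<comment> \<open>Expanding the second slot by \<open>hlin_cas\<close> leaves \<omega>(b0, b) as
    the only trace of b; after exchanging the sums, the list is evaluated by its operator
    \<open>N\<close>.\<close>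
  have "(\<Sum>(a, b)\<leftarrow>ks. \<beta> a b) =
      (\<Sum>(a, b)\<leftarrow>ks. \<Sum>(a0, b0)\<in>cas. ksgn (fst a0) * \<omega> (snd b0) (snd b) * \<beta> a a0)"
  proof (rule arg_cong[of _ _ sum_list], rule map_cong[OF refl], clarify)
    fix d a e b assume "((d, a), (e, b)) \<in> set ks"
    then show "\<beta> (d, a) (e, b) =
        (\<Sum>(a0, b0)\<in>cas. ksgn (fst a0) * \<omega> (snd b0) (snd (e, b)) * \<beta> (d, a) a0)"
      using hlin_cas[OF \<beta>(1), of "(d, a)" b e] ks by fastforce
  qed
  also have "\<dots> = (\<Sum>(a0, b0)\<in>cas. \<Sum>(a, b)\<leftarrow>ks. ksgn (fst a0) * \<omega> (snd b0) (snd b) * \<beta> a a0)"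
    using sum_list_sum_swap[of "\<lambda>(a, b) (a0, b0). ksgn (fst a0) * \<omega> (snd b0) (snd b) * \<beta> a a0" cas ks]
    by (simp add: split_def)
  also have "\<dots> = (\<Sum>(a0, b0)\<in>cas. ksgn (fst b0) * \<beta> (fst b0 + m, N (fst b0) (snd b0)) a0)"
  proof (rule sum.cong[OF refl], clarify)
    fix d a0 e b0 assume c: "((d, a0), (e, b0)) \<in> cas"
    have V: "a0 \<in> V d" "b0 \<in> V e" using cas_V[OF c] by auto
    obtain G where G: "linear G" "\<And>d' v. v \<in> V d' \<Longrightarrow> G v = \<beta> (d', v) (d, a0)"
      using hlin_extend[OF \<beta>(2)[of "(d, a0)"]] V by auto
    have "(\<Sum>(a, b)\<leftarrow>ks. ksgn d * \<omega> b0 (snd b) * \<beta> a (d, a0)) =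
        (\<Sum>(a, b)\<leftarrow>ks. ksgn e * (\<omega> (snd b) b0 * G (snd a)))"
    proof (rule arg_cong[of _ _ sum_list], rule map_cong[OF refl], clarify)
      fix d' a e' b assume "((d', a), (e', b)) \<in> set ks"
      then have "a \<in> V d'" using ks by fastforce
      then show "ksgn d * \<omega> b0 (snd (e', b)) * \<beta> (d', a) (d, a0) =
          ksgn e * (\<omega> (snd (e', b)) b0 * G (snd (d', a)))"
        using cas_sgn[OF c] G(2)[of a d'] \<omega>_swap[of b0 b] by simp
    qed
    also have "\<dots> = ksgn e * (\<Sum>(a, b)\<leftarrow>ks. \<omega> (snd b) b0 * G (snd a))"
      by (simp add: split_def sum_list_scale)
    also have "(\<Sum>(a, b)\<leftarrow>ks. \<omega> (snd b) b0 * G (snd a)) = G (\<Sum>(a, b)\<leftarrow>ks. \<omega> (snd b) b0 *\<^sub>R snd a)"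
      by (simp add: linear_sum_list[OF G(1)] split_def linear_scale[OF G(1)])
    also have "\<dots> = \<beta> (e + m, N e b0) (d, a0)"
      using N[OF V(2)] G(2) by simp
    finally show "(\<Sum>(a, b)\<leftarrow>ks. ksgn (fst (d, a0)) * \<omega> (snd (e, b0)) (snd b) * \<beta> a (d, a0)) =
      ksgn (fst (e, b0)) * \<beta> (fst (e, b0) + m, N (fst (e, b0)) (snd (e, b0))) (d, a0)" by simp
  qed
  finally show ?thesis .
qed

lemma contraction_cas:
  assumes "\<And>d v. v \<in> V d \<Longrightarrow> A v \<in> V (d + r)" "\<And>d v. v \<in> V d \<Longrightarrow> B v \<in> V (d + s)"
    and N: "\<And>d v. v \<in> V d \<Longrightarrow> (\<Sum>(a, b)\<in>cas. \<omega> (B (snd b)) v *\<^sub>R A (snd a)) = N d v"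
      "\<And>d v. v \<in> V d \<Longrightarrow> N d v \<in> V (d + m)"
    and \<beta>: "\<And>x. snd x \<in> V (fst x) \<Longrightarrow> hlin (\<beta> x)" "\<And>y. snd y \<in> V (fst y) \<Longrightarrow> hlin (\<lambda>x. \<beta> x y)"
  shows "(\<Sum>(a, b)\<in>cas. \<beta> (hmap r A a) (hmap s B b)) =
    (\<Sum>(a, b)\<in>cas. ksgn (fst b) * \<beta> (fst b + m, N (fst b) (snd b)) a)"
proof -
  obtain cs where cs: "set cs = cas" "distinct cs" using finite_distinct_list[OF finite_cas] by blast
  let ?ks = "map (\<lambda>(a, b). (hmap r A a, hmap s B b)) cs"
  have s: "(\<Sum>(a, b)\<leftarrow>?ks. F a b) = (\<Sum>(a, b)\<in>cas. F (hmap r A a) (hmap s B b))"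
    for F :: "_ \<Rightarrow> _ \<Rightarrow> 'b::comm_monoid_add"
    by (simp add: cs sum_list_distinct_conv_sum_set split_def o_def)
  show ?thesis
    unfolding s[of \<beta>, symmetric]
  proof (rule contraction)
    show "snd a \<in> V (fst a) \<and> snd b \<in> V (fst b)" if "(a, b) \<in> set ?ks" for a b
      using that cs(1) assms(1,2) cas_V by (auto simp: hmap_def)
    show "(\<Sum>(a, b)\<leftarrow>?ks. \<omega> (snd b) v *\<^sub>R snd a) = N d v" if "v \<in> V d" for d v
      using N(1)[OF that] unfolding s by (simp add: hmap_def)
  qed (use assms in auto)
qed

end

section \<open>Derivations, the BV operator and integrated homotopies\<close>

lemma hmap_id [simp]: "hmap 0 (\<lambda>v. v) = (\<lambda>x. x)"
  by (simp add: hmap_def fun_eq_iff)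

lemma hmap_sel [simp]: "fst (hmap a f x) = fst x + a" "snd (hmap a f x) = f (snd x)"
  by (simp_all add: hmap_def)

lemma whole_simps [simp]:
  "hcomp (whole V) = V" "vadd (whole V) = (+)" "vscale (whole V) = (*\<^sub>R)" "vzero (whole V) = 0"
  by (simp_all add: whole_def)

lemma hom_list_Nil [simp]: "hom_list G []"
  by (simp add: hom_list_def)

lemma hom_list_Cons [simp]: "hom_list G (x # xs) \<longleftrightarrow> snd x \<in> hcomp G (fst x) \<and> hom_list G xs"
  by (auto simp: hom_list_def)

lemma hom_list_append [simp]: "hom_list G (xs @ ys) \<longleftrightarrow> hom_list G xs \<and> hom_list G ys"
  by (auto simp: hom_list_def)

lemma hom_list_map_hmap:
  "(\<And>d v. v \<in> hcomp G d \<Longrightarrow> A v \<in> hcomp G' (d + a)) \<Longrightarrow> hom_list G xs \<Longrightarrow> hom_list G' (map (hmap a A) xs)"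
  by (induction xs) auto

lemma sym_forms_integral:
  assumes F: "\<And>t. F t \<in> sym_forms G" and int: "\<And>xs. (\<lambda>t. F t xs) integrable_on {0..1::real}"
  shows "(\<lambda>xs. integral {0..1} (\<lambda>t. F t xs)) \<in> sym_forms G"
proof (rule sym_formsI)
  show "integral {0..1} (\<lambda>t. F t xs) = 0" if "\<not> hom_list G xs" for xs
    using sym_formsD(1)[OF F that] by simp
  show "integral {0..1} (\<lambda>t. F t (xs @ (d, vadd G u v) # ys)) =
      integral {0..1} (\<lambda>t. F t (xs @ (d, u) # ys)) + integral {0..1} (\<lambda>t. F t (xs @ (d, v) # ys))"
    if "u \<in> hcomp G d" "v \<in> hcomp G d" for xs ys d u v
    unfolding sym_formsD(2)[OF F that] by (rule integral_add[OF int int])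
  show "integral {0..1} (\<lambda>t. F t (xs @ (d, vscale G c v) # ys)) = c * integral {0..1} (\<lambda>t. F t (xs @ (d, v) # ys))"
    if "v \<in> hcomp G d" for xs ys d c v
    unfolding sym_formsD(3)[OF F that] by (rule integral_mult_right)
  show "integral {0..1} (\<lambda>t. F t (xs @ x # y # ys)) =
      ksgn (fst x * fst y) * integral {0..1} (\<lambda>t. F t (xs @ y # x # ys))" for xs ys x y
    by (subst sym_formsD(4)[OF F]) (rule integral_mult_right)
qed

text \<open>In terms of the derivation \<open>derv\<close> along a pullback, \<open>Q = - derv id 1 q\<close> and
  \<open>K\<^sub>u\<^sub>n = derv id (-1) k\<close>.\<close>

fun derv :: "('v \<Rightarrow> 'v) \<Rightarrow> int \<Rightarrow> ('v \<Rightarrow> 'v) \<Rightarrow> 'v form \<Rightarrow> 'v form" where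
  "derv A s B f [] = 0"
| "derv A s B f (x # xs) = ksgn (fst x) *
    (derv A s B (\<lambda>ys. f (hmap 0 A x # ys)) xs + f (hmap s B x # map (hmap 0 A) xs))"

text \<open>The derivative of the pullback of \<open>f\<close> along \<open>A\<close> when
  \<open>A\<close> moves with velocity \<open>C\<close>. It is an even operation, so there are no
  Koszul signs.\<close>

fun tangent :: "('v \<Rightarrow> 'v) \<Rightarrow> ('v \<Rightarrow> 'v) \<Rightarrow> 'v form \<Rightarrow> 'v form" where
  "tangent A C f [] = 0"
| "tangent A C f (x # xs) = tangent A C (\<lambda>ys. f (hmap 0 A x # ys)) xs + f (hmap 0 C x # map (hmap 0 A) xs)"

lemma derv_add: "derv A s B (\<lambda>ys. f ys + g ys) xs = derv A s B f xs + derv A s B g xs"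
  by (induction xs arbitrary: f g) (simp_all add: algebra_simps)

lemma derv_scale: "derv A s B (\<lambda>ys. c * f ys) xs = c * derv A s B f xs"
  by (induction xs arbitrary: f) (simp_all add: algebra_simps)

lemma derv_zero [simp]: "derv A s B (\<lambda>ys. 0) xs = 0"
  by (induction xs) simp_all

lemma derv_sum: "derv A s B (\<lambda>ys. \<Sum>i\<in>I. f i ys) xs = (\<Sum>i\<in>I. derv A s B (f i) xs)"
  by (induction I rule: infinite_finite_induct) (simp_all add: derv_add)

lemma tangent_add: "tangent A C (\<lambda>ys. f ys + g ys) xs = tangent A C f xs + tangent A C g xs"
  by (induction xs arbitrary: f g) (simp_all add: algebra_simps)

lemma tangent_scale: "tangent A C (\<lambda>ys. c * f ys) xs = c * tangent A C f xs"
  by (induction xs arbitrary: f) (simp_all add: algebra_simps)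

text \<open>The sign of Q on functionals cancels against the sign with which a functional is turned
  into a form; only the Koszul signs of \<open>derv\<close> are left.\<close>

lemma form_der_eq_derv_Q:
  "form_der (\<lambda>\<phi> x. - ksgn (fst x + 1) * \<phi> (hmap 1 B x)) f xs + derv (\<lambda>v. v) 1 B f xs = 0"
  by (induction xs arbitrary: f) (auto simp: algebra_simps eq_neg_iff_add_eq_0[symmetric])

lemma form_der_eq_derv_K:
  "form_der (\<lambda>\<phi> x. ksgn (fst x - 1) * \<phi> (hmap (- 1) B x)) f xs = derv (\<lambda>v. v) (- 1) B f xs"
  by (induction xs arbitrary: f) (auto simp: algebra_simps)

lemma derv_integral:
  assumes "\<And>ys. (\<lambda>t. F t ys) integrable_on {0..1::real}"
  shows "((\<lambda>t. derv A s B (F t) xs) has_integral derv A s B (\<lambda>ys. integral {0..1} (\<lambda>t. F t ys)) xs) {0..1}"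
  using assms
proof (induction xs arbitrary: F)
  case (Cons x xs)
  show ?case
    unfolding derv.simps
    by (intro has_integral_mult_right has_integral_add Cons.IH Cons.prems integrable_integral)
qed simp

context dg_symp
begin

abbreviation "qder \<equiv> derv (\<lambda>v. v) 1 q"
abbreviation homV :: "'v hvec list \<Rightarrow> bool" where "homV \<equiv> hom_list (whole V)"
abbreviation SF :: "'v form set" where "SF \<equiv> sym_forms (whole V)"

lemma SF_add: "f \<in> SF \<Longrightarrow> u \<in> V d \<Longrightarrow> v \<in> V d \<Longrightarrow>
    f (xs @ (d, u + v) # ys) = f (xs @ (d, u) # ys) + f (xs @ (d, v) # ys)"
  using sym_formsD(2)[of f "whole V" u d v] by simp

lemma SF_scale: "f \<in> SF \<Longrightarrow> v \<in> V d \<Longrightarrow> f (xs @ (d, c *\<^sub>R v) # ys) = c * f (xs @ (d, v) # ys)"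
  using sym_formsD(3)[of f "whole V" v d] by simp

lemma SF_swap: "f \<in> SF \<Longrightarrow> f (xs @ x # y # ys) = ksgn (fst x * fst y) * f (xs @ y # x # ys)"
  by (rule sym_formsD(4))

lemma SF_zero: "f \<in> SF \<Longrightarrow> f (xs @ (d, 0) # ys) = 0"
  using SF_scale[of f 0 d xs 0 ys] subspace_0[OF sub_V] by simp

lemmas SF_add' = SF_add[where xs = "[]", simplified]
lemmas SF_scale' = SF_scale[where xs = "[]", simplified]
lemmas SF_swap' = SF_swap[where xs = "[]", simplified]
lemmas SF_zero' = SF_zero[where xs = "[]", simplified]

lemma SF_hlin: "f \<in> SF \<Longrightarrow> hlin (\<lambda>x. f (xs @ x # ys))"
  unfolding hlin_def by (simp add: SF_add SF_scale)

lemmas SF_hlin' = SF_hlin[where xs = "[]", simplified] SF_hlin[where xs = "[x]" for x, simplified]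

section \<open>Homogeneous maps and derivations along them\<close>

definition homap :: "int \<Rightarrow> ('v \<Rightarrow> 'v) \<Rightarrow> bool" where
  "homap s A \<longleftrightarrow> linear A \<and> (\<forall>d. \<forall>v\<in>V d. A v \<in> V (d + s))"

lemma homapD: assumes "homap s A" shows "v \<in> V d \<Longrightarrow> A v \<in> V (d + s)" "linear A"
  using assms unfolding homap_def by blast+

lemma homap0D: assumes "homap 0 A" shows "v \<in> V d \<Longrightarrow> A v \<in> V d"
  using homapD(1)[OF assms] by simp

lemma homap_id: "homap 0 (\<lambda>v. v)"
  by (simp add: homap_def linear_id[unfolded id_def])

lemma homap_q: "homap 1 q"
  by (simp add: homap_def lin_q q_V)

lemma homap_comp: "homap s A \<Longrightarrow> homap t B \<Longrightarrow> homap (t + s) (\<lambda>v. A (B v))"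
  unfolding homap_def
  by (auto simp: linear_compose[unfolded o_def] simp flip: add.assoc)

lemma homap_comp': "homap s A \<Longrightarrow> homap t B \<Longrightarrow> r = t + s \<Longrightarrow> homap r (\<lambda>v. A (B v))"
  using homap_comp by blast

lemma homap_add: "homap s A \<Longrightarrow> homap s B \<Longrightarrow> homap s (\<lambda>v. A v + B v)"
  unfolding homap_def by (simp add: linear_compose_add subspace_add[OF sub_V])

lemma homap_diff: "homap s A \<Longrightarrow> homap s B \<Longrightarrow> homap s (\<lambda>v. A v - B v)"
  unfolding homap_def by (simp add: linear_compose_sub subspace_diff[OF sub_V])

lemma homap_scale: "homap s A \<Longrightarrow> homap s (\<lambda>v. c *\<^sub>R A v)"
  unfolding homap_def by (simp add: linear_compose_scale_right subspace_scale[OF sub_V])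

lemma derv_cong:
  assumes "homap 0 A" "homap s B" "homV xs"
    and "\<And>ys. homV ys \<Longrightarrow> length ys = length xs \<Longrightarrow> f ys = g ys"
  shows "derv A s B f xs = derv A s B g xs"
  using assms(3,4)
proof (induction xs arbitrary: f g)
  case (Cons x xs)
  have "homV (map (hmap 0 A) xs)"
    by (rule hom_list_map_hmap) (use homapD[OF assms(1)] Cons.prems in auto)
  moreover have "derv A s B (\<lambda>ys. f (hmap 0 A x # ys)) xs = derv A s B (\<lambda>ys. g (hmap 0 A x # ys)) xs"
    by (rule Cons.IH) (use homap0D[OF assms(1)] Cons.prems in auto)
  ultimately show ?case
    using Cons.prems homapD[OF assms(2)] by simp
qed simp

lemma derv_SF_add:
  assumes A: "homap 0 A" and B: "homap s B" and f: "f \<in> SF" and uv: "u \<in> V d" "v \<in> V d"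
  shows "derv A s B f (xs @ (d, u + v) # ys) = derv A s B f (xs @ (d, u) # ys) + derv A s B f (xs @ (d, v) # ys)"
  using f
proof (induction xs arbitrary: f)
  case Nil
  then show ?case
    using homap0D[OF A] homapD[OF B] uv
    by (simp add: hmap_def linear_add[OF homapD(2)[OF A]] linear_add[OF homapD(2)[OF B]] SF_add' derv_add distrib_left)
next
  case (Cons x xs)
  show ?case
    using Cons.IH[OF sym_forms_Cons[OF Cons.prems]] homap0D[OF A] uv
      SF_add[OF Cons.prems, where xs = "hmap s B x # map (hmap 0 A) xs"]
    by (simp add: hmap_def linear_add[OF homapD(2)[OF A]] distrib_left)
qed

lemma derv_SF_scale:
  assumes A: "homap 0 A" and B: "homap s B" and f: "f \<in> SF" and v: "v \<in> V d"
  shows "derv A s B f (xs @ (d, c *\<^sub>R v) # ys) = c * derv A s B f (xs @ (d, v) # ys)"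
  using f
proof (induction xs arbitrary: f)
  case Nil
  then show ?case
    using homap0D[OF A] homapD[OF B] v
    by (simp add: hmap_def linear_scale[OF homapD(2)[OF A]] linear_scale[OF homapD(2)[OF B]] SF_scale' derv_scale distrib_left)
next
  case (Cons x xs)
  show ?case
    using Cons.IH[OF sym_forms_Cons[OF Cons.prems]] homap0D[OF A] v
      SF_scale[OF Cons.prems, where xs = "hmap s B x # map (hmap 0 A) xs"]
    by (simp add: hmap_def linear_scale[OF homapD(2)[OF A]] distrib_left)
qed

lemma derv_SF_swap:
  assumes s: "odd s" and f: "f \<in> SF"
  shows "derv A s B f (xs @ x # y # ys) = ksgn (fst x * fst y) * derv A s B f (xs @ y # x # ys)"
  using f
proof (induction xs arbitrary: f)
  case Nil
  let ?a = "hmap 0 A" and ?b = "hmap s B"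
  have 1: "f (?b x # ?a y # zs) = ksgn (fst x * fst y) * ksgn (fst y) * f (?a y # ?b x # zs)"
    "f (?a x # ?b y # zs) = ksgn (fst x * fst y) * ksgn (fst x) * f (?b y # ?a x # zs)"
    "f (?a x # ?a y # zs) = ksgn (fst x * fst y) * f (?a y # ?a x # zs)" for zs
    using SF_swap'[OF Nil, of "?b x" "?a y" zs] SF_swap'[OF Nil, of "?a x" "?b y" zs]
      SF_swap'[OF Nil, of "?a x" "?a y" zs] s
    by (auto simp: ksgn_def)
  show ?case
    by (simp add: 1 derv_scale algebra_simps)
next
  case (Cons z xs)
  show ?case
    using Cons.IH[OF sym_forms_Cons[OF Cons.prems]]
      SF_swap[OF Cons.prems, where xs = "hmap s B z # map (hmap 0 A) xs" and x = "hmap 0 A x" and y = "hmap 0 A y"]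
    by (simp add: distrib_left algebra_simps)
qed

lemma derv_SF:
  assumes A: "homap 0 A" and B: "homap s B" and s: "odd s" and f: "f \<in> SF"
  shows "(\<lambda>xs. if homV xs then derv A s B f xs else 0) \<in> SF"
  by (rule sym_formsI)
    (auto simp: subspace_add[OF sub_V] subspace_scale[OF sub_V]
      derv_SF_add[OF A B f] derv_SF_scale[OF A B f] intro: derv_SF_swap[OF s f])

lemma derv_vanish:
  assumes A: "homap 0 A" and B: "homap s B" "homV xs"
    and f: "\<And>x ys zs. snd x \<in> V (fst x) \<Longrightarrow> f (ys @ hmap s B x # zs) = 0"
  shows "derv A s B f xs = 0"
  using assms(3) f
proof (induction xs arbitrary: f)
  case (Cons x xs)
  have "f (hmap s B x # map (hmap 0 A) xs) = 0"
    using Cons.prems(2)[of x "[]"] Cons.prems(1) by simp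
  moreover have "derv A s B (\<lambda>ys. f (hmap 0 A x # ys)) xs = 0"
    by (rule Cons.IH) (use Cons.prems(1) Cons.prems(2)[where ys = "hmap 0 A x # _"] in auto)
  ultimately show ?case by simp
qed simp

lemma derv_id_vanish:
  assumes C: "homap 0 C" and B: "\<And>v. B (C v) = 0" and f: "f \<in> SF"
  shows "derv (\<lambda>v. v) s B f (map (hmap 0 C) xs) = 0"
  using f
proof (induction xs arbitrary: f)
  case (Cons x xs)
  then show ?case
    using Cons.IH[OF sym_forms_Cons[OF Cons.prems]] by (simp add: hmap_def B SF_zero')
qed simp

lemma derv_naturality:
  assumes "\<And>v. q (A v) = A (q v)"
  shows "qder (\<lambda>ys. f (map (hmap 0 A) ys)) xs = qder f (map (hmap 0 A) xs)"
proof (induction xs arbitrary: f)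
  case (Cons x xs)
  then show ?case using Cons.IH[of "\<lambda>ys. f (hmap 0 A x # ys)"] by (simp add: hmap_def assms o_def)
qed simp

text \<open>The graded commutator of two odd derivations acts on one argument at a time, by
  \<open>B (q v) + q (B v)\<close>. Terms with \<open>q\<close> and \<open>B\<close> in different
  arguments cancel by their Koszul signs, since \<open>q\<close> commutes with
  \<open>A\<close>.\<close>

lemma derv_commutator:
  assumes A: "homap 0 A" and B: "homap (- 1) B" and f: "f \<in> SF" and xs: "homV xs"
    and qA: "\<And>v. q (A v) = A (q v)" and C: "\<And>v. B (q v) + q (B v) = C v"
  shows "qder (derv A (- 1) B f) xs + derv A (- 1) B (qder f) xs = - tangent A C f xs"
  using f xs
proof (induction xs arbitrary: f)
  case (Cons x xs)
  obtain d v where x: "x = (d, v)" by (cases x)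
  have v: "v \<in> V d" using Cons.prems x by simp
  have s: "ksgn (d + 1) = - ksgn d" "ksgn (1 + d) = - ksgn d" "ksgn (d - 1) = - ksgn d" by (auto simp: ksgn_def)
  have add: "f ((d, C v) # zs) = f ((d, B (q v)) # zs) + f ((d, q (B v)) # zs)" for zs
    using SF_add'[OF Cons.prems(1), of "B (q v)" d "q (B v)" zs] C[of v] v homapD(1)[OF B, of "q v" "d + 1"]
      q_V[of "B v" "d - 1"] homapD(1)[OF B, of v d] q_V by simp
  have IH: "qder (derv A (- 1) B (\<lambda>ys. f ((d, A v) # ys))) xs +
      derv A (- 1) B (qder (\<lambda>ys. f ((d, A v) # ys))) xs = - tangent A C (\<lambda>ys. f ((d, A v) # ys)) xs"
    by (rule Cons.IH) (use Cons.prems in \<open>auto intro: sym_forms_Cons\<close>)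
  have nat: "qder (\<lambda>ys. f ((d - 1, B v) # map (hmap 0 A) ys)) xs =
      qder (\<lambda>ys. f ((d - 1, B v) # ys)) (map (hmap 0 A) xs)"
    by (rule derv_naturality[where f = "\<lambda>ys. f ((d - 1, B v) # ys)"]) (rule qA)
  show ?case
    using IH by (simp add: x hmap_def derv_add derv_scale s add qA nat algebra_simps)
qed simp

section \<open>The BV operator as contraction with the Casimir element\<close>

definition BV_form :: "'v form \<Rightarrow> 'v form" where
  "BV_form f xs = - (1 / 2) * (\<Sum>(a, b)\<in>cas. f (b # a # xs))"

lemma BV_form_SF: "f \<in> SF \<Longrightarrow> BV_form f \<in> SF"
  unfolding BV_form_def[abs_def] split_def
  by (intro sym_forms_scale sym_forms_sum sym_forms_Cons)

lemma hlin_hmap: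
  assumes "f \<in> SF" "homap s A"
  shows "hlin (\<lambda>x. f (ys @ hmap s A x # zs))"
  unfolding hlin_def hmap_def
  using homapD[OF assms(2)] by (simp add: linear_add linear_scale SF_add[OF assms(1)] SF_scale[OF assms(1)])

lemmas hlin_hmap' = hlin_hmap[where ys = "[]", simplified] hlin_hmap[where ys = "[y]" for y, simplified]

lemma cas_even: "(a, b) \<in> cas \<Longrightarrow> ksgn (fst a * fst b) = 1"
  using cas_deg[of a b] by (auto simp: ksgn_def) presburger

text \<open>Applying the contraction formula to \<open>cas\<close> itself exchanges the two legs;
  the two signs that arise cancel.\<close>

lemma cas_sym:
  assumes "\<And>x. snd x \<in> V (fst x) \<Longrightarrow> hlin (\<beta> x)" "\<And>y. snd y \<in> V (fst y) \<Longrightarrow> hlin (\<lambda>x. \<beta> x y)"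
  shows "(\<Sum>(a, b)\<in>cas. \<beta> a b) = (\<Sum>(a, b)\<in>cas. \<beta> b a)"
proof -
  have "(\<Sum>(a, b)\<in>cas. \<beta> (hmap 0 (\<lambda>v. v) a) (hmap 0 (\<lambda>v. v) b)) =
      (\<Sum>(a, b)\<in>cas. ksgn (fst b) * \<beta> (fst b + 0, ksgn (fst b) *\<^sub>R snd b) a)"
    by (rule contraction_cas) (use assms cas_rep in \<open>auto simp: subspace_scale[OF sub_V]\<close>)
  also have "\<dots> = (\<Sum>(a, b)\<in>cas. \<beta> b a)"
  proof (rule sum.cong[OF refl], clarify)
    fix d a e b assume c: "((d, a), (e, b)) \<in> cas"
    have "hlin (\<lambda>x. \<beta> x (d, a))" using assms(2)[of "(d, a)"] cas_V(1)[OF c] by simp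
    then show "ksgn (fst (e, b)) * \<beta> (fst (e, b) + 0, ksgn (fst (e, b)) *\<^sub>R snd (e, b)) (d, a) = \<beta> (e, b) (d, a)"
      using cas_V(2)[OF c] unfolding hlin_def by simp
  qed
  finally show ?thesis by simp
qed

lemma foldr_pairs:
  "foldr (\<lambda>(a, b) s. \<omega> (snd b) v *\<^sub>R snd a + s) ks 0 = (\<Sum>(a, b)\<leftarrow>ks. \<omega> (snd b) v *\<^sub>R snd a)"
  by (induction ks) auto

lemma casimir_exists: "\<exists>ks. casimir (whole V) \<omega> ks"
proof -
  obtain ks where ks: "set ks = cas" "distinct ks" using finite_distinct_list[OF finite_cas] by blast
  have "casimir (whole V) \<omega> ks"
    unfolding casimir_def using ks cas_V cas_rep
    by (auto simp: foldr_pairs sum_list_distinct_conv_sum_set split: prod.splits)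
  then show ?thesis by blast
qed

lemma casimir_sum:
  assumes "casimir (whole V) \<omega> ks"
  shows "\<And>a b. (a, b) \<in> set ks \<Longrightarrow> snd a \<in> V (fst a) \<and> snd b \<in> V (fst b)"
    and "v \<in> V d \<Longrightarrow> (\<Sum>(a, b)\<leftarrow>ks. \<omega> (snd b) v *\<^sub>R snd a) = ksgn d *\<^sub>R v"
proof -
  show "snd a \<in> V (fst a) \<and> snd b \<in> V (fst b)" if "(a, b) \<in> set ks" for a b
    using assms that unfolding casimir_def by auto
  assume "v \<in> V d"
  then have "ksgn d *\<^sub>R (\<Sum>(a, b)\<leftarrow>ks. \<omega> (snd b) v *\<^sub>R snd a) = v"
    using assms unfolding casimir_def by (simp add: foldr_pairs)
  then have "ksgn d *\<^sub>R ksgn d *\<^sub>R (\<Sum>(a, b)\<leftarrow>ks. \<omega> (snd b) v *\<^sub>R snd a) = ksgn d *\<^sub>R v" by simp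
  then show "(\<Sum>(a, b)\<leftarrow>ks. \<omega> (snd b) v *\<^sub>R snd a) = ksgn d *\<^sub>R v" by (simp only: scaleR_scaleR ksgn_square scaleR_one)
qed

lemma sum_cas_swap: "f \<in> SF \<Longrightarrow> (\<Sum>(a, b)\<in>cas. f (a # b # xs)) = (\<Sum>(a, b)\<in>cas. f (b # a # xs))"
proof (rule sum.cong[OF refl], clarify)
  fix d a e b assume f: "f \<in> SF" and c: "((d, a), (e, b)) \<in> cas"
  show "f ((d, a) # (e, b) # xs) = f ((e, b) # (d, a) # xs)"
    using SF_swap'[OF f, of "(d, a)" "(e, b)" xs] cas_even[OF c] by simp
qed

lemma BV_eq_BV_form:
  assumes "\<And>g. F g \<in> SF"
  shows "BV (whole V) \<omega> F = (\<lambda>g. BV_form (F g))"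
proof (intro ext)
  fix g xs
  define ks where "ks = (SOME ks. casimir (whole V) \<omega> ks)"
  have ks: "casimir (whole V) \<omega> ks" unfolding ks_def using casimir_exists by (rule someI_ex)
  have "(\<Sum>(a, b)\<leftarrow>ks. F g (b # a # xs)) =
      (\<Sum>(a, b)\<in>cas. ksgn (fst b) * F g (a # (fst b + 0, ksgn (fst b) *\<^sub>R snd b) # xs))"
    by (rule contraction[OF casimir_sum[OF ks]])
      (auto simp: SF_hlin'[OF assms] subspace_scale[OF sub_V])
  also have "\<dots> = (\<Sum>(a, b)\<in>cas. F g (a # b # xs))"
  proof (rule sum.cong[OF refl], clarify)
    fix d a e b assume c: "((d, a), (e, b)) \<in> cas"
    show "ksgn (fst (e, b)) * F g ((d, a) # (fst (e, b) + 0, ksgn (fst (e, b)) *\<^sub>R snd (e, b)) # xs) = F g ((d, a) # (e, b) # xs)"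
      using SF_scale[OF assms, of b e g "[(d, a)]"] cas_V(2)[OF c] by simp
  qed
  finally show "BV (whole V) \<omega> F g xs = BV_form (F g) xs"
    by (simp add: BV_def BV_form_def ks_def sum_cas_swap[OF assms])
qed

text \<open>Where the derivation hits neither contracted argument, it passes a pair of odd total
  degree and changes sign; the two terms where it hits one of them agree by \<open>cas_sym\<close>.
  So only two contractions decide whether \<Delta> annihilates such a derivation of f.\<close>

lemma sum_cas_derv:
  assumes A: "homap 0 A" and B: "homap s B" and s: "odd s" and f: "f \<in> SF"
  shows "(\<Sum>(a, b)\<in>cas. derv A s B f (b # a # xs)) =
    - derv A s B (\<lambda>ys. \<Sum>(a, b)\<in>cas. f (hmap 0 A b # hmap 0 A a # ys)) xs
    - 2 * (\<Sum>(a, b)\<in>cas. f (hmap 0 A a # hmap s B b # map (hmap 0 A) xs))"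
proof -
  let ?M = "map (hmap 0 A) xs"
  have "derv A s B f (b # a # xs) = - derv A s B (\<lambda>ys. f (hmap 0 A b # hmap 0 A a # ys)) xs
      - f (hmap 0 A b # hmap s B a # ?M) - f (hmap 0 A a # hmap s B b # ?M)" if c: "(a, b) \<in> cas" for a b
  proof -
    have "f (hmap s B b # hmap 0 A a # ?M) = ksgn ((fst b + s) * fst a) * f (hmap 0 A a # hmap s B b # ?M)"
      by (subst SF_swap'[OF f]) simp
    moreover have "ksgn ((fst b + s) * fst a) = - ksgn (fst b)"
      using cas_deg[OF c] s by (auto simp: ksgn_def) presburger+
    ultimately show ?thesis using cas_sgn[OF c] by (simp add: algebra_simps)
  qed
  then have "(\<Sum>(a, b)\<in>cas. derv A s B f (b # a # xs)) =
     (\<Sum>(a, b)\<in>cas. - derv A s B (\<lambda>ys. f (hmap 0 A b # hmap 0 A a # ys)) xs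
      - f (hmap 0 A b # hmap s B a # ?M) - f (hmap 0 A a # hmap s B b # ?M))"
    by (intro sum.cong) auto
  also have "\<dots> = - derv A s B (\<lambda>ys. \<Sum>(a, b)\<in>cas. f (hmap 0 A b # hmap 0 A a # ys)) xs
      - (\<Sum>(a, b)\<in>cas. f (hmap 0 A b # hmap s B a # ?M)) - (\<Sum>(a, b)\<in>cas. f (hmap 0 A a # hmap s B b # ?M))"
    by (simp add: split_def sum_subtractf sum_negf derv_sum)
  also have "(\<Sum>(a, b)\<in>cas. f (hmap 0 A b # hmap s B a # ?M)) = (\<Sum>(a, b)\<in>cas. f (hmap 0 A a # hmap s B b # ?M))"
    by (rule cas_sym) (auto simp: hlin_hmap'[OF f A] hlin_hmap'[OF f B])
  finally show ?thesis by simp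
qed

text \<open>Moving \<open>B\<close> across \<omega> turns the sum into the reproducing formula for
  \<open>B' v\<close>; the minus sign is the change of parity caused by the odd degree r.\<close>

lemma cas_adjoint_odd:
  assumes B': "\<And>d v. v \<in> V d \<Longrightarrow> B' v \<in> V (d + r)" "odd r"
    and adj: "\<And>e b. b \<in> V e \<Longrightarrow> \<omega> (B b) v = ksgn e * \<omega> b (B' v)" and v: "v \<in> V d"
  shows "(\<Sum>(a, b)\<in>cas. \<omega> (B (snd b)) v *\<^sub>R snd a) = - B' v"
proof -
  have "(\<Sum>(a, b)\<in>cas. \<omega> (B (snd b)) v *\<^sub>R snd a) = (\<Sum>(a, b)\<in>cas. ksgn d *\<^sub>R \<omega> (snd b) (B' v) *\<^sub>R snd a)"
  proof (rule sum.cong[OF refl], clarify)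
    fix d' a e b assume c: "((d', a), (e, b)) \<in> cas"
    have b: "b \<in> V e" using cas_V(2)[OF c] by simp
    have "ksgn e * \<omega> b (B' v) = ksgn d * \<omega> b (B' v)"
    proof (cases "e + (d + r) = 1")
      case True
      \<comment> \<open>With r odd, e + d + r = 1 gives e and d the same parity.\<close>
      then have "ksgn e = ksgn d" using B'(2) by (auto simp: ksgn_def) presburger+
      then show ?thesis by simp
    qed (use \<omega>_deg[OF b B'(1)[OF v]] in simp)
    then show "\<omega> (B (snd (e, b))) v *\<^sub>R snd (d', a) = ksgn d *\<^sub>R \<omega> (snd (e, b)) (B' v) *\<^sub>R snd (d', a)"
      by (simp add: adj[OF b])
  qed
  also have "\<dots> = ksgn d *\<^sub>R (\<Sum>(a, b)\<in>cas. \<omega> (snd b) (B' v) *\<^sub>R snd a)"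
    by (simp add: scaleR_sum_right split_def)
  also have "\<dots> = (ksgn d * ksgn (d + r)) *\<^sub>R B' v"
    by (simp add: cas_rep[OF B'(1)[OF v]])
  also have "ksgn d * ksgn (d + r) = - 1" using B'(2) by (simp add: ksgn_def)
  finally show ?thesis by simp
qed

text \<open>Invariance of \<omega> under \<open>q\<close> makes the tensor with \<open>q\<close> on
  one leg antisymmetric: the contraction formula returns the same sum with the opposite sign. This
  is what makes \<Delta> anticommute with Q.\<close>

lemma sum_cas_q:
  assumes f: "f \<in> SF"
  shows "(\<Sum>(a, b)\<in>cas. f (a # hmap 1 q b # xs)) = 0"
proof -
  have "(\<Sum>(a, b)\<in>cas. f (hmap 0 (\<lambda>v. v) a # hmap 1 q b # xs)) =
      (\<Sum>(a, b)\<in>cas. ksgn (fst b) * f ((fst b + 1, q (snd b)) # a # xs))"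
  proof (rule contraction_cas[where \<beta> = "\<lambda>a b. f (a # b # xs)"])
    show "(\<Sum>(a, b)\<in>cas. \<omega> (q (snd b)) v *\<^sub>R snd a) = q v" if "v \<in> V d" for d v
      using cas_adjoint_odd[where B = q and B' = "\<lambda>v. - q v" and r = 1 and v = v and d = d]
        that \<omega>_q q_V by (simp add: \<omega>_simps subspace_neg[OF sub_V])
  qed (auto simp: SF_hlin'[OF f] q_V)
  also have "\<dots> = (\<Sum>(a, b)\<in>cas. - f (a # hmap 1 q b # xs))"
  proof (rule sum.cong[OF refl], clarify)
    fix d a e b assume c: "((d, a), (e, b)) \<in> cas"
    have "ksgn e * ksgn ((e + 1) * d) = - 1"
      using cas_deg[OF c] by (auto simp: ksgn_def) presburger+
    then show "ksgn (fst (e, b)) * f ((fst (e, b) + 1, q (snd (e, b))) # (d, a) # xs) = - f ((d, a) # hmap 1 q (e, b) # xs)"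
      using SF_swap'[OF f, of "(e + 1, q b)" "(d, a)" xs] by (simp add: hmap_def flip: mult.assoc)
  qed
  finally show ?thesis by (simp add: split_def sum_negf)
qed

lemma BV_form_derv_q:
  assumes f: "f \<in> SF"
  shows "BV_form (qder f) xs = - qder (BV_form f) xs"
  unfolding BV_form_def[abs_def] derv_scale
  using sum_cas_derv[OF homap_id homap_q _ f, of xs] sum_cas_q[OF f] by simp

text \<open>The pairs in \<open>cas\<close> have odd total degree, so exchanging two of them changes
  the sign of a graded symmetric form, and the double sum equals its own negative.\<close>

lemma BV_form_BV_form:
  assumes f: "f \<in> SF"
  shows "BV_form (BV_form f) xs = 0"
proof -
  define F where "F p p' = f (snd p' # fst p' # snd p # fst p # xs)" for p p'
  have F: "F p p' = - F p' p" if "p \<in> cas" "p' \<in> cas" for p p'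
  proof -
    obtain y z where p: "p = (z, y)" by (cases p)
    obtain w x where p': "p' = (x, w)" by (cases p')
    have "f (w # x # y # z # xs) = ksgn (fst x * fst y) * f (w # y # x # z # xs)"
      using SF_swap[OF f, of "[w]" x y "z # xs"] by simp
    also have "f (w # y # x # z # xs) = ksgn (fst w * fst y) * f (y # w # x # z # xs)"
      using SF_swap'[OF f, of w y "x # z # xs"] by simp
    also have "f (y # w # x # z # xs) = ksgn (fst x * fst z) * f (y # w # z # x # xs)"
      using SF_swap[OF f, of "[y, w]" x z xs] by simp
    also have "f (y # w # z # x # xs) = ksgn (fst w * fst z) * f (y # z # w # x # xs)"
      using SF_swap[OF f, of "[y]" w z "x # xs"] by simp
    finally have "f (w # x # y # z # xs) = ksgn ((fst x + fst w) * (fst z + fst y)) * f (y # z # w # x # xs)"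
      by (simp add: distrib_left distrib_right ksgn_add mult_ac)
    moreover have "(fst x + fst w) * (fst z + fst y) = 1"
      using that cas_deg[of z y] cas_deg[of x w] by (simp add: p p')
    moreover have "ksgn 1 = - 1" by (simp add: ksgn_def)
    ultimately show ?thesis by (simp add: F_def p p')
  qed
  have "(\<Sum>p\<in>cas. \<Sum>p'\<in>cas. F p p') = (\<Sum>p\<in>cas. \<Sum>p'\<in>cas. - F p' p)"
    by (intro sum.cong refl F)
  also have "\<dots> = - (\<Sum>p'\<in>cas. \<Sum>p\<in>cas. F p' p)"
    by (subst sum.swap) (simp add: sum_negf)
  finally have "(\<Sum>p\<in>cas. \<Sum>p'\<in>cas. F p p') = 0" by simp
  moreover have "BV_form (BV_form f) xs = 1 / 4 * (\<Sum>p\<in>cas. \<Sum>p'\<in>cas. F p p')"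
    by (simp add: BV_form_def F_def split_def sum_distrib_left)
  ultimately show ?thesis by simp
qed

section \<open>Derivations integrated along an affine path\<close>

definition aff :: "('v \<Rightarrow> 'v) \<Rightarrow> ('v \<Rightarrow> 'v) \<Rightarrow> real \<Rightarrow> 'v \<Rightarrow> 'v" where
  "aff C D t v = C v + t *\<^sub>R D v"

lemma homap_aff: "homap s C \<Longrightarrow> homap s D \<Longrightarrow> homap s (aff C D t)"
  unfolding aff_def[abs_def] by (intro homap_add homap_scale)

lemma SF_aff:
  assumes "f \<in> SF" "homap s C" "homap s D" "v \<in> V d"
  shows "f ((d + s, aff C D t v) # ys) = f ((d + s, C v) # ys) + t * f ((d + s, D v) # ys)"
  using homapD(1)[OF assms(2,4)] homapD(1)[OF assms(3,4)]
  by (simp add: aff_def SF_add'[OF assms(1)] SF_scale'[OF assms(1)] subspace_scale[OF sub_V])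

lemma has_derivative_pullback:
  assumes C: "homap 0 C" and D: "homap 0 D" and f: "f \<in> SF" and xs: "homV xs"
  shows "((\<lambda>t. f (map (hmap 0 (aff C D t)) xs)) has_real_derivative tangent (aff C D t) D f xs) (at t)"
  using f xs
proof (induction xs arbitrary: f)
  case (Cons x xs)
  obtain d v where x: "x = (d, v)" by (cases x)
  have v: "v \<in> V d" using Cons.prems x by simp
  note SF = SF_aff[OF Cons.prems(1) C D v, simplified]
  have *: "f (map (hmap 0 (aff C D t)) (x # xs)) = f ((d, C v) # map (hmap 0 (aff C D t)) xs) +
      t * f ((d, D v) # map (hmap 0 (aff C D t)) xs)" for t
    using SF by (simp add: x hmap_def)
  show ?case
    unfolding *
    by (rule DERIV_cong[OF DERIV_add[OF Cons.IH DERIV_mult[OF DERIV_ident Cons.IH]]])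
      (use Cons.prems SF in \<open>auto simp: sym_forms_Cons x hmap_def[abs_def] tangent_add tangent_scale\<close>)
qed simp

lemma continuous_derv:
  assumes C: "homap 0 C" and D: "homap 0 D" and P: "homap s P" and R: "homap s R"
    and f: "f \<in> SF" and xs: "homV xs"
  shows "continuous_on UNIV (\<lambda>t. derv (aff C D t) s (aff P R t) f xs)"
  using f xs
proof (induction xs arbitrary: f)
  case (Cons x xs)
  obtain d v where x: "x = (d, v)" by (cases x)
  have v: "v \<in> V d" using Cons.prems x by simp
  have c: "continuous_on UNIV (\<lambda>t. f (y # map (hmap 0 (aff C D t)) xs))" for y
    by (rule DERIV_continuous_on[OF has_derivative_pullback[OF C D sym_forms_Cons[OF Cons.prems(1)], THEN DERIV_subset]])
      (use Cons.prems in auto)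
  have "derv (aff C D t) s (aff P R t) f (x # xs) = ksgn d *
      (derv (aff C D t) s (aff P R t) (\<lambda>ys. f ((d, C v) # ys)) xs +
       t * derv (aff C D t) s (aff P R t) (\<lambda>ys. f ((d, D v) # ys)) xs +
       f ((d + s, P v) # map (hmap 0 (aff C D t)) xs) + t * f ((d + s, R v) # map (hmap 0 (aff C D t)) xs))" for t
    using SF_aff[OF Cons.prems(1) C D v, simplified] SF_aff[OF Cons.prems(1) P R v]
    by (simp add: x hmap_def derv_add derv_scale)
  then show ?case
    by (simp only:) (intro continuous_intros c Cons.IH sym_forms_Cons, use Cons.prems in auto)
qed simp

definition avg_der :: "('v \<Rightarrow> 'v) \<Rightarrow> ('v \<Rightarrow> 'v) \<Rightarrow> ('v \<Rightarrow> 'v) \<Rightarrow> ('v \<Rightarrow> 'v) \<Rightarrow> 'v form \<Rightarrow> 'v form" where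
  "avg_der C D P R f xs = (if homV xs
     then integral {0..1} (\<lambda>t. derv (aff C D t) (- 1) (aff P R t) f xs) else 0)"

definition Qf :: "'v form \<Rightarrow> 'v form" where
  "Qf f xs = (if homV xs then - qder f xs else 0)"

lemma Qf_SF: "f \<in> SF \<Longrightarrow> Qf f \<in> SF"
  using sym_forms_scale[OF derv_SF[OF homap_id homap_q], of f "- 1"]
  by (simp add: Qf_def[abs_def] if_distrib cong: if_cong)

lemma Qf_cong:
  "(\<And>ys. homV ys \<Longrightarrow> length ys = length xs \<Longrightarrow> f ys = g ys) \<Longrightarrow> Qf f xs = Qf g xs"
  unfolding Qf_def using derv_cong[OF homap_id homap_q, of xs f g] by auto

lemma Qop_eq: "Qop (whole V) q F = (\<lambda>g. Qf (F g))"
  using form_der_eq_derv_Q[of q] by (auto simp: Qop_def restrict_hom_def Qf_def fun_eq_iff eq_neg_iff_add_eq_0)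

lemma BV_form_Qf:
  assumes f: "f \<in> SF"
  shows "BV_form (Qf f) xs + Qf (BV_form f) xs = 0"
proof (cases "homV xs")
  case True
  have "BV_form (Qf f) xs = - BV_form (qder f) xs"
    using True cas_V by (auto simp: BV_form_def Qf_def sum_negf[symmetric] split_def simp del: derv.simps intro!: sum.cong)
  then show ?thesis using True BV_form_derv_q[OF f] by (simp add: Qf_def)
next
  case False
  then show ?thesis using sym_formsD(1)[OF BV_form_SF[OF Qf_SF[OF f]] False] by (simp add: Qf_def)
qed

context
  fixes C D P R
  assumes C: "homap 0 C" and D: "homap 0 D" and P: "homap (- 1) P" and R: "homap (- 1) R"
begin

lemma integrable_derv:
  "f \<in> SF \<Longrightarrow> homV xs \<Longrightarrow>
    (\<lambda>t. derv (aff C D t) (- 1) (aff P R t) f xs) integrable_on {0..1}"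
  by (rule integrable_continuous_interval[OF continuous_on_subset[OF continuous_derv[OF C D P R]]]) auto

lemma avg_der_eq_integral:
  "avg_der C D P R f = (\<lambda>xs. integral {0..1}
     (\<lambda>t. if homV xs then derv (aff C D t) (- 1) (aff P R t) f xs else 0))"
  by (auto simp: avg_der_def)

lemma avg_der_SF:
  assumes f: "f \<in> SF" shows "avg_der C D P R f \<in> SF"
  unfolding avg_der_eq_integral
proof (rule sym_forms_integral)
  show "(\<lambda>t. if homV xs then derv (aff C D t) (- 1) (aff P R t) f xs else 0) integrable_on {0..1}"
    for xs
    by (cases "homV xs") (simp_all add: integrable_derv[OF f] integrable_0)
qed (use derv_SF[OF homap_aff[OF C D] homap_aff[OF P R] _ f] in auto)

lemma avg_der_cong:
  assumes "\<And>ys. homV ys \<Longrightarrow> length ys = length xs \<Longrightarrow> f ys = g ys"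
  shows "avg_der C D P R f xs = avg_der C D P R g xs"
  unfolding avg_der_def using derv_cong[OF homap_aff[OF C D] homap_aff[OF P R] _ assms] by auto

text \<open>By \<open>derv_commutator\<close> the commutator of Q with the derivation at time t is
  the t-derivative of the pullback of f, so integration leaves the endpoints. The hypotheses say
  that the path consists of chain maps and that its velocity is null-homotopic.\<close>

lemma avg_der_homotopy:
  assumes f: "f \<in> SF" and xs: "homV xs"
    and qA: "\<And>t v. q (aff C D t v) = aff C D t (q v)"
    and BD: "\<And>t v. aff P R t (q v) + q (aff P R t v) = D v"
  shows "Qf (avg_der C D P R f) xs + avg_der C D P R (Qf f) xs =
    f (map (hmap 0 (aff C D 1)) xs) - f (map (hmap 0 (aff C D 0)) xs)"
proof -
  let ?A = "aff C D" and ?B = "aff P R" and ?q = "qder"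
  define F where "F t ys = (if homV ys then derv (?A t) (- 1) (?B t) f ys else 0)" for t ys
  have F: "(\<lambda>t. F t ys) integrable_on {0..1}" for ys
    by (cases "homV ys") (simp_all add: F_def integrable_derv[OF f] integrable_0)
  have "((\<lambda>t. ?q (F t) xs) has_integral ?q (avg_der C D P R f) xs) {0..1}"
    using derv_integral[of F, OF F] unfolding avg_der_eq_integral F_def .
  moreover have "?q (F t) xs = ?q (derv (?A t) (- 1) (?B t) f) xs" for t
    by (rule derv_cong[OF homap_id homap_q xs]) (simp add: F_def)
  ultimately have 1: "((\<lambda>t. ?q (derv (?A t) (- 1) (?B t) f) xs) has_integral - Qf (avg_der C D P R f) xs) {0..1}"
    using xs by (simp add: Qf_def)
  have "((\<lambda>t. derv (?A t) (- 1) (?B t) (Qf f) xs) has_integral avg_der C D P R (Qf f) xs) {0..1}"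
    using integrable_integral[OF integrable_derv[OF Qf_SF[OF f] xs]] xs by (simp add: avg_der_def)
  moreover have "derv (?A t) (- 1) (?B t) (Qf f) xs = - derv (?A t) (- 1) (?B t) (?q f) xs" for t
    using derv_cong[OF homap_aff[OF C D] homap_aff[OF P R] xs, of "Qf f" "\<lambda>ys. - 1 * ?q f ys"]
      derv_scale[of _ _ _ "- 1" "?q f"] by (simp add: Qf_def)
  ultimately have 2: "((\<lambda>t. - derv (?A t) (- 1) (?B t) (?q f) xs) has_integral avg_der C D P R (Qf f) xs) {0..1}"
    by simp
  have "- ?q (derv (?A t) (- 1) (?B t) f) xs + - derv (?A t) (- 1) (?B t) (?q f) xs = tangent (?A t) D f xs" for t
    using derv_commutator[OF homap_aff[OF C D, of t] homap_aff[OF P R, of t] f xs qA BD] by simp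
  then have 3: "((\<lambda>t. tangent (?A t) D f xs) has_integral Qf (avg_der C D P R f) xs + avg_der C D P R (Qf f) xs) {0..1}"
    using has_integral_add[OF has_integral_neg[OF 1] 2] by simp
  have "((\<lambda>t. tangent (?A t) D f xs) has_integral
      f (map (hmap 0 (?A 1)) xs) - f (map (hmap 0 (?A 0)) xs)) {0..1}"
    by (rule fundamental_theorem_of_calculus)
      (auto intro!: has_derivative_pullback[OF C D f xs, THEN DERIV_subset]
        simp flip: has_real_derivative_iff_has_vector_derivative)
  then show ?thesis using 3 has_integral_unique by blast
qed

text \<open>The assumptions are the two contractions isolated in \<open>sum_cas_derv\<close>. They
  make the integrand vanish for every t separately.\<close>

lemma BV_form_avg_der:
  assumes f: "f \<in> SF" and xs: "homV xs"
    and 1: "\<And>t ys. homV ys \<Longrightarrow>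
      (\<Sum>(a, b)\<in>cas. f (hmap 0 (aff C D t) b # hmap 0 (aff C D t) a # ys)) = 0"
    and 2: "\<And>t ys. homV ys \<Longrightarrow>
      (\<Sum>(a, b)\<in>cas. f (hmap 0 (aff C D t) a # hmap (- 1) (aff P R t) b # ys)) = 0"
  shows "BV_form (avg_der C D P R f) xs = 0"
proof -
  let ?A = "aff C D" and ?B = "aff P R"
  have "(\<Sum>(a, b)\<in>cas. avg_der C D P R f (b # a # xs)) =
      (\<Sum>p\<in>cas. integral {0..1} (\<lambda>t. derv (?A t) (- 1) (?B t) f (snd p # fst p # xs)))"
    by (rule sum.cong) (use cas_V xs in \<open>auto simp: avg_der_def simp del: derv.simps\<close>)
  also have "\<dots> = integral {0..1} (\<lambda>t. \<Sum>p\<in>cas. derv (?A t) (- 1) (?B t) f (snd p # fst p # xs))"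
    by (rule integral_sum[symmetric, OF finite_cas integrable_derv[OF f]]) (use cas_V xs in auto)
  also have "\<dots> = integral {0..1} (\<lambda>t::real. 0)"
  proof (rule Henstock_Kurzweil_Integration.integral_cong)
    fix t :: real
    have "homV (map (hmap 0 (?A t)) xs)"
      by (rule hom_list_map_hmap) (use homapD[OF homap_aff[OF C D]] xs in auto)
    moreover have "derv (?A t) (- 1) (?B t) (\<lambda>ys. \<Sum>(a, b)\<in>cas. f (hmap 0 (?A t) b # hmap 0 (?A t) a # ys)) xs =
       derv (?A t) (- 1) (?B t) (\<lambda>ys. 0) xs"
      by (rule derv_cong[OF homap_aff[OF C D] homap_aff[OF P R] xs]) (rule 1)
    ultimately show "(\<Sum>p\<in>cas. derv (?A t) (- 1) (?B t) f (snd p # fst p # xs)) = 0"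
      using sum_cas_derv[OF homap_aff[OF C D] homap_aff[OF P R] _ f, of t t xs] 2[of "map (hmap 0 (?A t)) xs" t]
      by (simp add: split_def)
  qed
  finally show ?thesis by (simp add: BV_form_def)
qed

end

end

section \<open>Special deformation retracts\<close>

lemma sym_forms_pullback:
  assumes f: "f \<in> sym_forms G"
    and hom: "\<And>d v. v \<in> hcomp H d \<Longrightarrow> i v \<in> hcomp G d"
    and add: "\<And>d u v. u \<in> hcomp H d \<Longrightarrow> v \<in> hcomp H d \<Longrightarrow>
      vadd H u v \<in> hcomp H d \<and> i (vadd H u v) = vadd G (i u) (i v)"
    and scale: "\<And>d c v. v \<in> hcomp H d \<Longrightarrow> vscale H c v \<in> hcomp H d \<and> i (vscale H c v) = vscale G c (i v)"
  shows "(\<lambda>xs. if hom_list H xs then f (map (hmap 0 i) xs) else 0) \<in> sym_forms H"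
proof (rule sym_formsI)
  show "(if hom_list H (xs @ (d, vadd H u v) # ys) then f (map (hmap 0 i) (xs @ (d, vadd H u v) # ys)) else 0) =
      (if hom_list H (xs @ (d, u) # ys) then f (map (hmap 0 i) (xs @ (d, u) # ys)) else 0) +
      (if hom_list H (xs @ (d, v) # ys) then f (map (hmap 0 i) (xs @ (d, v) # ys)) else 0)"
    if "u \<in> hcomp H d" "v \<in> hcomp H d" for xs ys d u v
    using that add[OF that] hom sym_formsD(2)[OF f, of "i u" d "i v" "map (hmap 0 i) xs" "map (hmap 0 i) ys"]
    by (simp add: hmap_def[of 0 i "(d, _)"])
  show "(if hom_list H (xs @ (d, vscale H c v) # ys) then f (map (hmap 0 i) (xs @ (d, vscale H c v) # ys)) else 0) =
      c * (if hom_list H (xs @ (d, v) # ys) then f (map (hmap 0 i) (xs @ (d, v) # ys)) else 0)"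
    if "v \<in> hcomp H d" for xs ys d c v
    using that scale[OF that] hom sym_formsD(3)[OF f, of "i v" d "map (hmap 0 i) xs" c "map (hmap 0 i) ys"]
    by (simp add: hmap_def[of 0 i "(d, _)"])
  show "(if hom_list H (xs @ x # y # ys) then f (map (hmap 0 i) (xs @ x # y # ys)) else 0) =
      ksgn (fst x * fst y) * (if hom_list H (xs @ y # x # ys) then f (map (hmap 0 i) (xs @ y # x # ys)) else 0)"
    for xs ys x y
    using sym_formsD(4)[OF f, of "map (hmap 0 i) xs" "hmap 0 i x" "hmap 0 i y" "map (hmap 0 i) ys"] by auto
qed simp

lemma sum_bool_lists_Suc:
  "(\<Sum>bs | length bs = Suc n. h bs) =
    (\<Sum>bs | length bs = n. h (True # bs)) + (\<Sum>bs | length bs = n. (h (False # bs) :: real))"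
proof -
  let ?L = "{bs :: bool list. length bs = n}"
  have fin: "finite ?L" using finite_lists_length_eq[of "UNIV :: bool set" n] by simp
  have "{bs :: bool list. length bs = Suc n} = (#) True ` ?L \<union> (#) False ` ?L"
    by (auto simp: length_Suc_conv)
  then have "(\<Sum>bs | length bs = Suc n. h bs) = sum h ((#) True ` ?L) + sum h ((#) False ` ?L)"
    using fin by (simp only:) (rule sum.union_disjoint, auto)
  then show ?thesis by (simp add: sum.reindex)
qed

lemma has_integral_power_unit:
  assumes "m > 0"
  shows "((\<lambda>t::real. t ^ (m - 1)) has_integral 1 / real m) {0..1}"
proof -
  have "((\<lambda>t. t ^ m / real m) has_real_derivative x ^ (m - 1)) (at x within {0..1})" for x
    using assms by (auto intro!: derivative_eq_intros)
  then have "((\<lambda>t::real. t ^ (m - 1)) has_integral 1 ^ m / real m - 0 ^ m / real m) {0..1}"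
    by (intro fundamental_theorem_of_calculus) (auto simp: has_real_derivative_iff_has_vector_derivative)
  then show ?thesis using assms by (simp add: zero_power)
qed

context dg_symp
begin

text \<open>With \<open>A\<close> on both legs, moving one of them across \<omega> shows that the
  tensor induces the operator A A', up to the usual sign. Contractions therefore depend on
  \<open>A\<close> only through this product with its adjoint.\<close>

lemma sum_cas_even:
  assumes f: "f \<in> SF" and A: "homap 0 A" and A': "homap 0 A'"
    and adj: "\<And>v w. \<omega> (A v) w = \<omega> v (A' w)"
  shows "(\<Sum>(a, b)\<in>cas. f (hmap 0 A b # hmap 0 A a # ys)) = (\<Sum>(a, b)\<in>cas. f (a # (fst b, A (A' (snd b))) # ys))"
proof -
  have "(\<Sum>(a, b)\<in>cas. f (hmap 0 A b # hmap 0 A a # ys)) =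
      (\<Sum>(a, b)\<in>cas. ksgn (fst b) * f (a # (fst b + 0, ksgn (fst b) *\<^sub>R A (A' (snd b))) # ys))"
  proof (rule contraction_cas[where \<beta> = "\<lambda>a b. f (b # a # ys)"])
    show "(\<Sum>(a, b)\<in>cas. \<omega> (A (snd b)) v *\<^sub>R A (snd a)) = ksgn d *\<^sub>R A (A' v)" if v: "v \<in> V d" for d v
    proof -
      have "(\<Sum>(a, b)\<in>cas. \<omega> (A (snd b)) v *\<^sub>R A (snd a)) = A (\<Sum>(a, b)\<in>cas. \<omega> (snd b) (A' v) *\<^sub>R snd a)"
        by (simp add: linear_sum[OF homapD(2)[OF A]] linear_scale[OF homapD(2)[OF A]] split_def adj)
      then show ?thesis
        by (simp add: cas_rep[OF homap0D[OF A' v]] linear_scale[OF homapD(2)[OF A]])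
    qed
  qed (auto simp: SF_hlin'[OF f] homap0D[OF A] homap0D[OF A'] subspace_scale[OF sub_V])
  also have "\<dots> = (\<Sum>(a, b)\<in>cas. f (a # (fst b, A (A' (snd b))) # ys))"
  proof (rule sum.cong[OF refl], clarify)
    fix d a e b assume c: "((d, a), (e, b)) \<in> cas"
    show "ksgn (fst (e, b)) * f ((d, a) # (fst (e, b) + 0, ksgn (fst (e, b)) *\<^sub>R A (A' (snd (e, b)))) # ys) =
        f ((d, a) # (fst (e, b), A (A' (snd (e, b)))) # ys)"
      using SF_scale[OF f homap0D[OF A homap0D[OF A']], of b e "[(d, a)]"] cas_V(2)[OF c] by simp
  qed
  finally show ?thesis .
qed

end

text \<open>Only \<open>k\<close> is recorded, since the projection and inclusion are recovered from
  it. The sign in the last axiom is that of the adjoint of a map of degree -1, so the axiom says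
  that \<open>k\<close> is self-adjoint.\<close>

locale sdr = dg_symp V \<omega> q
  for V :: "int \<Rightarrow> 'v::real_vector set" and \<omega> :: "'v \<Rightarrow> 'v \<Rightarrow> real" and q :: "'v \<Rightarrow> 'v" +
  fixes k :: "'v \<Rightarrow> 'v"
  assumes homap_k: "homap (- 1) k" and k_k [simp]: "k (k v) = 0"
    and k_q_k [simp]: "k (q (k v)) = k v" and q_k_q [simp]: "q (k (q v)) = q v"
    and \<omega>_k: "v \<in> V d \<Longrightarrow> \<omega> (k v) w = ksgn d * \<omega> v (k w)"
begin

lemmas lin_k = homapD(2)[OF homap_k]
lemmas k_V = homapD(1)[OF homap_k, simplified]
lemmas k_simps = linear_add[OF lin_k] linear_diff[OF lin_k] linear_scale[OF lin_k] linear_0[OF lin_k] linear_neg[OF lin_k]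

definition pr :: "'v \<Rightarrow> 'v" where "pr v = v - k (q v) - q (k v)"

lemma homap_pr: "homap 0 pr"
  unfolding pr_def[abs_def]
  by (intro homap_diff homap_id homap_comp'[OF homap_k homap_q] homap_comp'[OF homap_q homap_k]) simp_all

lemmas pr_V = homap0D[OF homap_pr]
lemmas lin_pr = homapD(2)[OF homap_pr]
lemmas pr_simps = linear_add[OF lin_pr] linear_diff[OF lin_pr] linear_scale[OF lin_pr] linear_0[OF lin_pr] linear_neg[OF lin_pr]

lemma pr_k [simp]: "pr (k v) = 0" and k_pr [simp]: "k (pr v) = 0"
  and pr_q [simp]: "pr (q v) = 0" and q_pr [simp]: "q (pr v) = 0"
  by (simp_all add: pr_def k_simps q_simps)

lemma pr_pr [simp]: "pr (pr v) = pr v"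
  by (subst (2) pr_def) (simp add: pr_simps)

text \<open>The adjunction signs of \<open>k\<close> and \<open>q\<close> belong to adjacent degrees
  and multiply to +1. The resulting identity is free of degrees and so extends from homogeneous to
  all vectors.\<close>

lemma \<omega>_kq: "\<omega> (k (q v)) w = \<omega> v (q (k w))" and \<omega>_qk: "\<omega> (q (k v)) w = \<omega> v (k (q w))"
proof -
  have 1: "linear (\<lambda>v. \<omega> (k (q v)) w)" "linear (\<lambda>v. \<omega> (q (k v)) w)"
    by (rule linearI; simp add: \<omega>_simps k_simps q_simps)+
  have s: "ksgn (d + 1) = - ksgn d" "ksgn (d - 1) = - ksgn d" for d by (auto simp: ksgn_def)
  show "\<omega> (k (q v)) w = \<omega> v (q (k w))"
    by (rule linear_eq_hom[OF 1(1) lin_\<omega>_left]) (simp add: \<omega>_k[OF q_V] \<omega>_q s)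
  show "\<omega> (q (k v)) w = \<omega> v (k (q w))"
    by (rule linear_eq_hom[OF 1(2) lin_\<omega>_left]) (simp add: \<omega>_q[OF k_V] \<omega>_k s)
qed

lemma \<omega>_pr: "\<omega> (pr v) w = \<omega> v (pr w)"
  by (simp add: pr_def \<omega>_simps \<omega>_kq \<omega>_qk)

text \<open>\<open>K\<close> is the integral of \<open>K\<^sub>u\<^sub>n\<close> along the scaling \<open>\<pi> + t (1 - \<pi>)\<close> of \<open>V''\<close>; the integral
  \<open>\<integral>\<^sub>0\<^sup>1 t\<^bsup>m-1\<^esup> dt\<close> produces the factor \<open>1 / #''\<close>.\<close>

definition K :: "'v form \<Rightarrow> 'v form" where
  "K = avg_der pr (\<lambda>v. v - pr v) k (\<lambda>v. 0)"

lemma homap_pr': "homap 0 (\<lambda>v. v - pr v)"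
  by (intro homap_diff homap_id homap_pr)

lemma homap_zero: "homap s (\<lambda>v. 0)"
  unfolding homap_def using subspace_0[OF sub_V] linear_zero by auto

lemmas K_args = homap_pr homap_pr' homap_k homap_zero[of "- 1"]

abbreviation "scaling \<equiv> aff pr (\<lambda>v. v - pr v)"

lemma aff_k [simp]: "aff k (\<lambda>v. 0) t = k"
  by (simp add: aff_def fun_eq_iff)

lemma K_SF: "f \<in> SF \<Longrightarrow> K f \<in> SF"
  unfolding K_def by (rule avg_der_SF[OF K_args])

lemmas K_cong = avg_der_cong[OF K_args, folded K_def]

definition pull :: "('v \<Rightarrow> 'v) \<Rightarrow> 'v form \<Rightarrow> 'v form" where
  "pull A f xs = (if homV xs then f (map (hmap 0 A) xs) else 0)"

lemma pull_SF: "homap 0 A \<Longrightarrow> f \<in> SF \<Longrightarrow> pull A f \<in> SF"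
  unfolding pull_def[abs_def]
  by (rule sym_forms_pullback)
    (auto simp: homap0D subspace_add[OF sub_V] subspace_scale[OF sub_V] linear_add[OF homapD(2)] linear_scale[OF homapD(2)])

lemma hom_pr: "homV xs \<Longrightarrow> homV (map (hmap 0 pr) xs)"
  by (rule hom_list_map_hmap) (auto simp: pr_V)

text \<open>A derivation moves one argument into the image of \<open>k\<close> or \<open>q\<close>,
  and \<open>pr\<close> annihilates both. Hence \<open>K\<close> and Q vanish on pullbacks along
  \<open>pr\<close>.\<close>

lemma pull_pr_vanish:
  assumes "f \<in> SF" "\<And>v. pr (B v) = 0"
  shows "pull pr f (ys @ hmap s B x # zs) = 0"
  using assms SF_zero[OF assms(1), of "map (hmap 0 pr) ys" "fst x + s" "map (hmap 0 pr) zs"]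
  by (auto simp: pull_def hmap_def[of 0 pr "hmap s B x"])

lemma K_pull:
  assumes f: "f \<in> SF" shows "K (pull pr f) xs = 0"
proof -
  have "derv (scaling t) (- 1) k (pull pr f) xs = 0" if "homV xs" for t
    by (rule derv_vanish[OF homap_aff[OF homap_pr homap_pr'] homap_k that]) (rule pull_pr_vanish[OF f pr_k])
  then show ?thesis by (simp add: K_def avg_der_def)
qed

lemma Qf_pull:
  assumes f: "f \<in> SF" shows "Qf (pull pr f) xs = 0"
proof (cases "homV xs")
  case True
  have "qder (pull pr f) xs = 0"
    by (rule derv_vanish[OF homap_id homap_q True]) (rule pull_pr_vanish[OF f pr_q])
  then show ?thesis by (simp add: Qf_def)
qed (simp add: Qf_def)

lemma pull_Qf:
  assumes f: "f \<in> SF" shows "pull pr (Qf f) xs = 0"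
  using derv_id_vanish[where C = pr and B = q and s = 1 and xs = xs, OF homap_pr q_pr f] hom_pr
  by (simp add: pull_def Qf_def)

text \<open>The scaling runs from \<open>pr\<close> at t = 0 to the identity at t = 1, and its
  velocity 1 - pr equals kq + qk by the definition of \<open>pr\<close>.\<close>

lemma K_homotopy:
  assumes f: "f \<in> SF"
  shows "Qf (K f) xs + K (Qf f) xs = f xs - pull pr f xs"
proof (cases "homV xs")
  case True
  have "Qf (K f) xs + K (Qf f) xs = f (map (hmap 0 (scaling 1)) xs) - f (map (hmap 0 (scaling 0)) xs)"
    unfolding K_def
    by (rule avg_der_homotopy[OF K_args f True]) (simp_all add: aff_def pr_simps q_simps k_simps pr_def)
  moreover have "scaling 1 = (\<lambda>v. v)" "scaling 0 = pr"
    by (simp_all add: aff_def fun_eq_iff)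
  ultimately show ?thesis using True by (simp add: pull_def)
next
  case False
  then show ?thesis using sym_formsD(1)[OF f False] by (simp add: pull_def Qf_def K_def avg_der_def)
qed

lemma pull_pull:
  shows "pull pr (pull pr f) = pull pr f"
proof
  fix xs
  have "map (hmap 0 pr) (map (hmap 0 pr) xs) = map (hmap 0 pr) xs"
    by (simp add: hmap_def)
  then show "pull pr (pull pr f) xs = pull pr f xs"
    using hom_pr[of xs] by (cases "homV xs") (simp_all only: pull_def if_True if_False)
qed

text \<open>The arguments left over after a contraction are still projected by \<open>pr\<close>, so
  the result is a pullback again, and \<open>K\<close> annihilates it.\<close>

lemma pull_BV_form_pull:
  assumes f: "f \<in> SF"
  shows "pull pr (BV_form (pull pr f)) = BV_form (pull pr f)"
proof
  fix xs
  show "pull pr (BV_form (pull pr f)) xs = BV_form (pull pr f) xs"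
  proof (cases "homV xs")
    case True
    have "map (hmap 0 pr) (map (hmap 0 pr) xs) = map (hmap 0 pr) xs"
      by (simp add: hmap_def)
    then have "pull pr f (b # a # map (hmap 0 pr) xs) = pull pr f (b # a # xs)" for a b
      using True hom_pr[OF True] by (simp only: pull_def hom_list_Cons list.map)
    then show ?thesis using True by (simp add: pull_def[of _ "BV_form _"] BV_form_def)
  next
    case False
    then show ?thesis using sym_formsD(1)[OF BV_form_SF[OF pull_SF[OF homap_pr f]] False] by (simp add: pull_def)
  qed
qed

section \<open>The factor 1/#'' as an integral\<close>

definition count_form :: "nat \<Rightarrow> 'v form \<Rightarrow> 'v form" where
  "count_form m f xs = (\<Sum>bs | length bs = length xs \<and> count_list bs True = m.
     f (map2 (\<lambda>b. hmap 0 (if b then (\<lambda>v. v - pr v) else pr)) bs xs))"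

text \<open>Multilinear expansion of pr + t (1 - pr) in every argument: the exponent of t counts the
  arguments sent to V''.\<close>

lemma scaling_expansion:
  assumes f: "f \<in> SF" and xs: "homV xs"
  shows "f (map (hmap 0 (scaling t)) xs) = (\<Sum>m\<le>length xs. t ^ m * count_form m f xs)"
proof -
  have "f (map (hmap 0 (scaling t)) xs) = (\<Sum>bs | length bs = length xs.
     t ^ count_list bs True * f (map2 (\<lambda>b. hmap 0 (if b then (\<lambda>v. v - pr v) else pr)) bs xs))"
    using f xs
  proof (induction xs arbitrary: f)
    case (Cons x xs)
    obtain d v where x: "x = (d, v)" by (cases x)
    have v: "v \<in> V d" using Cons.prems x by simp
    have "f (map (hmap 0 (scaling t)) (x # xs)) =
      f ((d, pr v) # map (hmap 0 (scaling t)) xs) +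
      t * f ((d, v - pr v) # map (hmap 0 (scaling t)) xs)"
      using SF_aff[OF Cons.prems(1) homap_pr homap_pr' v] by (simp add: x hmap_def[of _ _ "(d, v)"])
    then show ?case
      using Cons.IH[OF sym_forms_Cons[OF Cons.prems(1), of "(d, pr v)"]]
        Cons.IH[OF sym_forms_Cons[OF Cons.prems(1), of "(d, v - pr v)"]] Cons.prems(2)
      by (simp add: sum_bool_lists_Suc sum_distrib_left x hmap_def[of _ _ "(d, v)"] mult.assoc)
  qed simp
  also have "\<dots> = (\<Sum>m\<le>length xs. \<Sum>bs\<in>{bs\<in>{bs. length bs = length xs}. count_list bs True = m}.
     t ^ count_list bs True * f (map2 (\<lambda>b. hmap 0 (if b then (\<lambda>v. v - pr v) else pr)) bs xs))"
  proof (rule sum.group[symmetric])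
    show "finite {bs :: bool list. length bs = length xs}"
      using finite_lists_length_eq[of "UNIV :: bool set" "length xs"] by simp
    show "(\<lambda>bs. count_list bs True) ` {bs. length bs = length xs} \<subseteq> {..length xs}"
      by (auto, metis count_le_length)
  qed simp
  finally show ?thesis by (simp add: count_form_def sum_distrib_left)
qed

text \<open>\<open>k\<close> takes values in the kernel of \<open>pr\<close>, where the scaling is
  multiplication by t.\<close>

lemma derv_scaling:
  assumes f: "f \<in> SF" and xs: "homV xs"
  shows "derv (\<lambda>v. v) (- 1) k (\<lambda>ys. f (map (hmap 0 (scaling t)) ys)) xs =
    t * derv (scaling t) (- 1) k f xs"
  using f xs
proof (induction xs arbitrary: f)
  case (Cons x xs)
  obtain d v where x: "x = (d, v)" by (cases x)
  have v: "v \<in> V d" using Cons.prems x by simp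
  let ?A = "scaling t"
  have "f (hmap 0 ?A (hmap (- 1) k x) # ys) = t * f (hmap (- 1) k x # ys)" for ys
    using SF_scale'[OF Cons.prems(1) k_V[OF v]] by (simp add: x hmap_def aff_def)
  then show ?case
    using Cons.IH[OF sym_forms_Cons[OF Cons.prems(1), of "hmap 0 ?A x"]] Cons.prems(2)
    by (simp add: algebra_simps)
qed simp

text \<open>By \<open>derv_scaling\<close> and \<open>scaling_expansion\<close>, t times the
  integrand of \<open>K\<close> is a polynomial in t whose coefficients are the counted parts.
  Dividing by t and integrating gives 1/m.\<close>

lemma K_eq_sum:
  assumes f: "f \<in> SF" and xs: "homV xs"
  shows "K f xs = (\<Sum>m = 1..length xs. 1 / real m * derv (\<lambda>v. v) (- 1) k (count_form m f) xs)"
proof -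
  let ?A = "scaling"
  define \<kappa> where "\<kappa> m = derv (\<lambda>v. v) (- 1) k (count_form m f) xs" for m
  have eq: "t * derv (?A t) (- 1) k f xs = (\<Sum>m\<le>length xs. t ^ m * \<kappa> m)" for t
  proof -
    have "t * derv (?A t) (- 1) k f xs = derv (\<lambda>v. v) (- 1) k (\<lambda>ys. \<Sum>m\<le>length xs. t ^ m * count_form m f ys) xs"
      unfolding derv_scaling[OF f xs, symmetric]
      by (rule derv_cong[OF homap_id homap_k xs]) (simp add: scaling_expansion[OF f])
    then show ?thesis by (simp add: derv_sum derv_scale \<kappa>_def)
  qed
  \<comment> \<open>Setting t = 0 shows that monomials without factors from V'' contribute nothing,
    in agreement with the convention K = 0 on them.\<close>
  have "(\<Sum>m\<le>length xs. 0 ^ m * \<kappa> m) = (\<Sum>m\<in>{0}. 0 ^ m * \<kappa> m)"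
    by (rule sum.mono_neutral_right) auto
  then have "\<kappa> 0 = 0" using eq[of 0] by simp
  have ne: "derv (?A t) (- 1) k f xs = (\<Sum>m = 1..length xs. \<kappa> m * t ^ (m - 1))" if "t \<noteq> 0" for t
  proof -
    have "(\<Sum>m\<le>length xs. t ^ m * \<kappa> m) = (\<Sum>m = 1..length xs. t ^ m * \<kappa> m)"
      by (rule sum.mono_neutral_right) (auto simp: \<open>\<kappa> 0 = 0\<close> not_less_eq_eq)
    also have "\<dots> = t * (\<Sum>m = 1..length xs. \<kappa> m * t ^ (m - 1))"
      unfolding sum_distrib_left
      by (rule sum.cong) (auto simp: power_eq_if)
    finally show ?thesis using eq[of t] that by simp
  qed
  have "((\<lambda>t. \<Sum>m = 1..length xs. \<kappa> m * t ^ (m - 1)) has_integral (\<Sum>m = 1..length xs. \<kappa> m * (1 / real m))) {0..1}"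
    by (intro has_integral_sum has_integral_mult_right has_integral_power_unit) auto
  \<comment> \<open>Division by t fails at t = 0 only, a single point that the integral
    ignores.\<close>
  then have "((\<lambda>t. derv (?A t) (- 1) k f xs) has_integral (\<Sum>m = 1..length xs. \<kappa> m * (1 / real m))) {0..1}"
    by (rule has_integral_spike_finite[where S = "{0}", rotated 2]) (simp_all add: ne)
  then show ?thesis using xs by (simp add: K_def avg_der_def integral_unique \<kappa>_def mult.commute)
qed

lemma Kop_eq:
  assumes "\<And>g. F g \<in> SF"
  shows "Kop V pr k F = (\<lambda>g. K (F g))"
proof (intro ext)
  fix g xs
  have "count_part pr m F g = count_form m (F g)" for m
    by (simp add: count_part_def count_form_def fun_eq_iff)
  then have 1: "Kun (whole V) k (count_part pr m F) g xs =
      (if homV xs then derv (\<lambda>v. v) (- 1) k (count_form m (F g)) xs else 0)" for m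
    by (simp add: Kun_def restrict_hom_def form_der_eq_derv_K)
  show "Kop V pr k F g xs = K (F g) xs"
  proof (cases "homV xs")
    case True
    then show ?thesis by (simp add: Kop_def 1 K_eq_sum[OF assms True])
  next
    case False
    then show ?thesis using sym_formsD(1)[OF K_SF[OF assms] False] by (simp add: Kop_def 1)
  qed
qed

end

section \<open>Interpolation between two retracts\<close>

locale sdr2 = sdr V \<omega> q k + B: sdr V \<omega> q k'
  for V :: "int \<Rightarrow> 'v::real_vector set" and \<omega> q k k'
begin

definition Z :: "'v form \<Rightarrow> 'v form" where
  "Z = avg_der (\<lambda>v. pr v - pr (k' (q v))) (\<lambda>v. pr (k' (q v))) (\<lambda>v. pr (k' v)) (\<lambda>v. - pr (k' (pr v)))"

lemma Z_args: "homap 0 (\<lambda>v. pr v - pr (k' (q v)))" "homap 0 (\<lambda>v. pr (k' (q v)))"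
   "homap (- 1) (\<lambda>v. pr (k' v))" "homap (- 1) (\<lambda>v. - pr (k' (pr v)))"
proof -
  show *: "homap 0 (\<lambda>v. pr (k' (q v)))"
    using homap_comp[OF homap_pr homap_comp[OF B.homap_k homap_q]] by simp
  show "homap 0 (\<lambda>v. pr v - pr (k' (q v)))" by (rule homap_diff[OF homap_pr *])
  show "homap (- 1) (\<lambda>v. pr (k' v))"
    using homap_comp[OF homap_pr B.homap_k] by simp
  show "homap (- 1) (\<lambda>v. - pr (k' (pr v)))"
    using homap_scale[OF homap_comp[OF homap_pr homap_comp[OF B.homap_k homap_pr]], of "- 1"] by simp
qed

lemma Z_SF: "f \<in> SF \<Longrightarrow> Z f \<in> SF"
  unfolding Z_def by (rule avg_der_SF[OF Z_args])

abbreviation "ZA \<equiv> aff (\<lambda>v. pr v - pr (k' (q v))) (\<lambda>v. pr (k' (q v)))"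
abbreviation "ZB \<equiv> aff (\<lambda>v. pr (k' v)) (\<lambda>v. - pr (k' (pr v)))"

text \<open>\<open>f\<close> is a pullback along \<open>pr\<close> and so Q-closed, which removes
  the term Z Q f from the homotopy relation.\<close>

lemma Z_homotopy:
  assumes f: "f \<in> SF" and inv: "pull pr f = f"
  shows "Qf (Z f) xs = f xs - pull B.pr f xs"
proof (cases "homV xs")
  case True
  have Q0: "Qf f ys = 0" for ys using Qf_pull[OF f] inv by simp
  have "Qf (Z f) xs + Z (Qf f) xs = f (map (hmap 0 (ZA 1)) xs) - f (map (hmap 0 (ZA 0)) xs)"
    unfolding Z_def
    by (rule avg_der_homotopy[OF Z_args f True]) (simp_all add: aff_def pr_simps B.k_simps q_simps)
  moreover have "Z (Qf f) xs = 0"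
    unfolding Z_def using avg_der_cong[OF Z_args, of xs "Qf f" "\<lambda>_. 0"] by (simp add: Q0 avg_der_def)
  moreover have "f (map (hmap 0 (ZA 1)) xs) = f xs"
  proof -
    have "ZA 1 = pr" by (simp add: aff_def fun_eq_iff)
    then show ?thesis using True inv by (metis pull_def)
  qed
  moreover have "f (map (hmap 0 (ZA 0)) xs) = pull B.pr f xs"
  proof -
    \<comment> \<open>\<open>pr\<close> annihilates the image of \<open>q\<close>, so the missing
      term \<open>pr (q (k' v))\<close> can be added for free.\<close>
    have "ZA 0 = (\<lambda>v. pr (B.pr v))" by (simp add: aff_def fun_eq_iff B.pr_def pr_simps)
    then have "map (hmap 0 (ZA 0)) xs = map (hmap 0 pr) (map (hmap 0 B.pr) xs)"
      by (simp add: hmap_def)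
    moreover have "f (map (hmap 0 pr) ys) = f ys" if "homV ys" for ys
      using that inv by (metis pull_def)
    ultimately show ?thesis using True B.hom_pr[OF True] by (simp only: pull_def if_True)
  qed
  ultimately show ?thesis by simp
next
  case False
  then show ?thesis using sym_formsD(1)[OF f False] by (simp add: pull_def Qf_def)
qed

text \<open>Both conditions of \<open>BV_form_avg_der\<close> become operator identities.
  Contraction with \<open>ZA t\<close> on both legs sees only the product with its adjoint, which is
  \<open>pr\<close>, and so reduces to \<Delta>f = 0. The mixed contraction sees \<open>ZA t\<close>
  times the adjoint of \<open>ZB t\<close>, which is 0.\<close>

lemma BV_form_Z:
  assumes f: "f \<in> SF" and inv: "pull pr f = f" and closed: "\<And>ys. BV_form f ys = 0"
  shows "BV_form (Z f) xs = 0"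
proof (cases "homV xs")
  case True
  have 1: "(\<Sum>(a, b)\<in>cas. f (hmap 0 (ZA t) b # hmap 0 (ZA t) a # ys)) = 0" if ys: "homV ys" for t ys
  proof -
    let ?A' = "\<lambda>v. pr v - (1 - t) *\<^sub>R q (k' (pr v))"
    have "homap 0 (\<lambda>v. q (k' (pr v)))"
      using homap_comp[OF homap_q homap_comp[OF B.homap_k homap_pr]] by simp
    then have A': "homap 0 ?A'" by (intro homap_diff homap_pr homap_scale)
    have adj: "\<omega> (ZA t v) w = \<omega> v (?A' w)" for v w
      by (simp add: aff_def \<omega>_simps \<omega>_pr B.\<omega>_kq algebra_simps)
    have AA: "ZA t (?A' v) = pr v" for v
      by (simp add: aff_def pr_simps q_simps B.k_simps)
    have "(\<Sum>(a, b)\<in>cas. f (hmap 0 (ZA t) b # hmap 0 (ZA t) a # ys)) = (\<Sum>(a, b)\<in>cas. f (a # (fst b, pr (snd b)) # ys))"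
      using sum_cas_even[OF f homap_aff[OF Z_args(1,2)] A' adj] by (simp only: AA)
    also have "\<dots> = (\<Sum>(a, b)\<in>cas. f (hmap 0 pr b # hmap 0 pr a # ys))"
      using sum_cas_even[OF f homap_pr homap_pr \<omega>_pr] by simp
    also have "\<dots> = (\<Sum>(a, b)\<in>cas. f (b # a # ys))"
    proof (rule sum.cong[OF refl], clarify)
      fix d a e b assume c: "((d, a), (e, b)) \<in> cas"
      have "homV ((e, b) # (d, a) # ys)" using cas_V[OF c] ys by simp
      moreover have "homV (hmap 0 pr (e, b) # hmap 0 pr (d, a) # ys)" using cas_V[OF c] ys by (simp add: pr_V)
      moreover have "f zs = f (map (hmap 0 pr) zs)" if "homV zs" for zs
        using that inv by (metis pull_def)
      ultimately show "f (hmap 0 pr (e, b) # hmap 0 pr (d, a) # ys) = f ((e, b) # (d, a) # ys)"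
        by (simp add: hmap_def)
    qed
    also have "\<dots> = 0" using closed[of ys] by (simp add: BV_form_def)
    finally show ?thesis .
  qed
  have 2: "(\<Sum>(a, b)\<in>cas. f (hmap 0 (ZA t) a # hmap (- 1) (ZB t) b # ys)) = 0" if ys: "homV ys" for t ys
  proof -
    let ?B' = "\<lambda>v. k' (pr v) - t *\<^sub>R pr (k' (pr v))"
    have "homap (- 1) (\<lambda>v. k' (pr v))" "homap (- 1) (\<lambda>v. pr (k' (pr v)))"
      using homap_comp[OF B.homap_k homap_pr] homap_comp[OF homap_pr homap_comp[OF B.homap_k homap_pr]] by simp_all
    then have "homap (- 1) ?B'" by (intro homap_diff homap_scale)
    note B' = homapD(1)[OF this]
    have adj: "\<omega> (ZB t b) v = ksgn e * \<omega> b (?B' v)" if b: "b \<in> V e" for e b v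
      using b pr_V[OF b] by (simp add: aff_def \<omega>_simps \<omega>_pr B.\<omega>_k algebra_simps)
    have lin: "linear (ZA t)" by (rule homapD(2)[OF homap_aff[OF Z_args(1,2)]])
    have N: "(\<Sum>(a, b)\<in>cas. \<omega> (ZB t (snd b)) v *\<^sub>R ZA t (snd a)) = 0" if v: "v \<in> V d" for d v
    proof -
      have "(\<Sum>(a, b)\<in>cas. \<omega> (ZB t (snd b)) v *\<^sub>R ZA t (snd a)) = ZA t (\<Sum>(a, b)\<in>cas. \<omega> (ZB t (snd b)) v *\<^sub>R snd a)"
        by (simp add: linear_sum[OF lin] linear_scale[OF lin] split_def)
      also have "\<dots> = ZA t (- ?B' v)"
        by (subst cas_adjoint_odd[where B = "ZB t" and B' = ?B', OF B' _ adj v]) auto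
      \<comment> \<open>Up to a common sign all terms are multiples of
        \<open>pr (k' (pr v))\<close>, with coefficients 1, -t and -(1 - t); the last one uses k'qk'
        = k'.\<close>
      also have "\<dots> = 0"
        by (simp add: aff_def pr_simps q_simps B.k_simps algebra_simps)
      finally show ?thesis .
    qed
    have "(\<Sum>(a, b)\<in>cas. f (hmap 0 (ZA t) a # hmap (- 1) (ZB t) b # ys)) =
        (\<Sum>(a, b)\<in>cas. ksgn (fst b) * f ((fst b + 0, 0) # a # ys))"
      by (rule contraction_cas[where \<beta> = "\<lambda>a b. f (a # b # ys)"])
        (use homapD(1)[OF homap_aff[OF Z_args(1,2)]] homapD(1)[OF homap_aff[OF Z_args(3,4)]] N in
          \<open>auto simp: SF_hlin'[OF f] subspace_0[OF sub_V]\<close>)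
    then show ?thesis by (simp add: SF_zero'[OF f])
  qed
  show ?thesis
    unfolding Z_def by (rule BV_form_avg_der[OF Z_args f True 1 2])
next
  case False
  then show ?thesis by (rule sym_formsD(1)[OF BV_form_SF[OF Z_SF[OF f]]])
qed

end

section \<open>Homological perturbation\<close>

context dg_symp
begin

lemma avg_der_lin:
  assumes C: "homap 0 C" and D: "homap 0 D" and P: "homap (- 1) P" and R: "homap (- 1) R"
    and f: "f \<in> SF" and g: "g \<in> SF"
  shows "avg_der C D P R (\<lambda>ys. f ys + c * g ys) xs = avg_der C D P R f xs + c * avg_der C D P R g xs"
proof (cases "homV xs")
  case True
  note int = integrable_integral[OF integrable_derv[OF C D P R f True]]
    integrable_integral[OF integrable_derv[OF C D P R g True]]
  show ?thesis
    using integral_unique[OF has_integral_add[OF int(1) has_integral_mult_right[OF int(2), of c]]] True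
    by (simp add: avg_der_def derv_add derv_scale)
qed (simp add: avg_der_def)

lemma BV_form_lin: "BV_form (\<lambda>ys. f ys + c * g ys) xs = BV_form f xs + c * BV_form g xs"
  by (simp add: BV_form_def split_def sum.distrib sum_distrib_left algebra_simps)

lemma Qf_lin: "Qf (\<lambda>ys. f ys + c * g ys) xs = Qf f xs + c * Qf g xs"
  by (simp add: Qf_def derv_add derv_scale algebra_simps)

lemma SF_lin: "f \<in> SF \<Longrightarrow> g \<in> SF \<Longrightarrow> (\<lambda>ys. f ys + c * g ys) \<in> SF"
  by (intro sym_forms_add sym_forms_scale)

section \<open>Operators on the weight-completed space\<close>

abbreviation WC :: "'v series set" where "WC \<equiv> weight_completed (whole V)"

lemma WC_SF: "F \<in> WC \<Longrightarrow> F g \<in> SF"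
  by (simp add: weight_completed_iff)

lemma WC_lin:
  assumes "F \<in> WC" "G \<in> WC" shows "(\<lambda>g xs. F g xs + c * G g xs) \<in> WC"
  unfolding weight_completed_iff
proof (intro conjI allI)
  show "(\<lambda>xs. F g xs + c * G g xs) \<in> SF" for g
    using assms by (intro SF_lin WC_SF)
  show "hbar_bounded (\<lambda>g xs. F g xs + c * G g xs)"
    unfolding hbar_bounded_def
  proof
    fix w
    obtain m where m: "\<And>g xs. weight g xs = w \<Longrightarrow> F g xs \<noteq> 0 \<Longrightarrow> m \<le> g"
      using assms(1) unfolding weight_completed_iff hbar_bounded_def by blast
    obtain n where n: "\<And>g xs. weight g xs = w \<Longrightarrow> G g xs \<noteq> 0 \<Longrightarrow> n \<le> g"
      using assms(2) unfolding weight_completed_iff hbar_bounded_def by blast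
    show "\<exists>m. \<forall>g xs. weight g xs = w \<longrightarrow> F g xs + c * G g xs \<noteq> 0 \<longrightarrow> m \<le> g"
    proof (intro exI[of _ "min m n"] allI impI)
      fix g xs assume "weight g xs = w" "F g xs + c * G g xs \<noteq> 0"
      then show "min m n \<le> g" using m[of xs g] n[of xs g] by fastforce
    qed
  qed
qed

text \<open>Reading order g - n on lists longer by 2n preserves the weight and can only raise the
  least order. The case n = 1 covers hbar \<Delta>; n = 0 covers Q, \<open>K\<close>,
  \<open>Z\<close> and pullbacks.\<close>

lemma hbar_bounded_transfer:
  assumes "hbar_bounded F"
    and "\<And>g xs. (\<And>ys. length ys = length xs + 2 * n \<Longrightarrow> F (g - int n) ys = 0) \<Longrightarrow> G g xs = 0"
  shows "hbar_bounded G"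
  unfolding hbar_bounded_def
proof
  fix w
  obtain m where m: "\<And>g xs. weight g xs = w \<Longrightarrow> F g xs \<noteq> 0 \<Longrightarrow> m \<le> g"
    using assms(1) unfolding hbar_bounded_def by blast
  show "\<exists>m. \<forall>g xs. weight g xs = w \<longrightarrow> G g xs \<noteq> 0 \<longrightarrow> m \<le> g"
  proof (intro exI[of _ m] allI impI)
    fix g xs assume w: "weight g xs = w" and "G g xs \<noteq> 0"
    then obtain ys where ys: "length ys = length xs + 2 * n" "F (g - int n) ys \<noteq> 0" using assms(2) by blast
    then have "m \<le> g - int n" by (intro m[of ys]) (use w in auto)
    then show "m \<le> g" by simp
  qed
qed

lemma BV_form_zero: "(\<And>ys. length ys = length xs + 2 \<Longrightarrow> f ys = 0) \<Longrightarrow> BV_form f xs = 0"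
  by (simp add: BV_form_def split_def)

lemma Qf_zero: "(\<And>ys. length ys = length xs \<Longrightarrow> f ys = 0) \<Longrightarrow> Qf f xs = 0"
  using Qf_cong[of xs f "\<lambda>_. 0"] by (simp add: Qf_def)

lemma WC_transfer:
  assumes "F \<in> WC" "\<And>g. G g \<in> SF"
    and "\<And>g xs. (\<And>ys. length ys = length xs + 2 * n \<Longrightarrow> F (g - int n) ys = 0) \<Longrightarrow> G g xs = 0"
  shows "G \<in> WC"
  using assms hbar_bounded_transfer[of F n G] unfolding weight_completed_iff by blast

lemma WC_Dl:
  assumes "F \<in> WC" shows "(\<lambda>g. BV_form (F (g - 1))) \<in> WC"
  by (rule WC_transfer[OF assms, where n = 1]) (auto intro: BV_form_SF WC_SF[OF assms] BV_form_zero)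

lemma WC_Qs:
  assumes "F \<in> WC" shows "(\<lambda>g. Qf (F g)) \<in> WC"
  by (rule WC_transfer[OF assms, where n = 0]) (auto intro: Qf_SF WC_SF[OF assms] Qf_zero)

end

context sdr
begin

lemmas K_lin = avg_der_lin[OF K_args, folded K_def]

lemma K_zero:
  assumes "\<And>ys. length ys = length xs \<Longrightarrow> f ys = 0" shows "K f xs = 0"
  using K_cong[of xs f "\<lambda>_. 0"] assms by (simp add: K_def avg_der_def)

lemma pull_zero: "(\<And>ys. length ys = length xs \<Longrightarrow> f ys = 0) \<Longrightarrow> pull A f xs = 0"
  by (simp add: pull_def)

lemma WC_Ks:
  assumes "F \<in> WC" shows "(\<lambda>g. K (F g)) \<in> WC"
  by (rule WC_transfer[OF assms, where n = 0]) (auto intro: K_SF WC_SF[OF assms] K_zero)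

lemma WC_pull:
  assumes "homap 0 A" "F \<in> WC" shows "(\<lambda>g. pull A (F g)) \<in> WC"
  by (rule WC_transfer[OF assms(2), where n = 0])
    (auto intro: pull_SF[OF assms(1)] WC_SF[OF assms(2)] pull_zero)

section \<open>The resolvent as a locally finite geometric series\<close>

definition T :: "'v series \<Rightarrow> 'v series" where
  "T F = (\<lambda>g xs. - BV_form (K (F (g - 1))) xs)"

lemma T_SF: "(\<And>g. F g \<in> SF) \<Longrightarrow> T F g \<in> SF"
  using sym_forms_scale[OF BV_form_SF[OF K_SF], of "F (g - 1)" "- 1"] by (simp add: T_def)

lemma T_local:
  assumes "\<And>h ys. weight h ys = weight g xs \<Longrightarrow> F h ys = G h ys"
  shows "T F g xs = T G g xs"
proof -
  have "K (F (g - 1)) (b # a # xs) = K (G (g - 1)) (b # a # xs)" for a b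
    by (rule K_cong) (use assms in auto)
  then show ?thesis by (simp add: T_def BV_form_def)
qed

lemma T_lin:
  assumes "\<And>g. F g \<in> SF" "\<And>g. G g \<in> SF"
  shows "T (\<lambda>g xs. F g xs + c * G g xs) g xs = T F g xs + c * T G g xs"
proof -
  have "K (\<lambda>xs. F (g - 1) xs + c * G (g - 1) xs) = (\<lambda>xs. K (F (g - 1)) xs + c * K (G (g - 1)) xs)"
    by (rule ext) (rule K_lin[OF assms])
  then show ?thesis by (simp add: T_def BV_form_lin)
qed

lemma T_pow_SF: "(\<And>g. F g \<in> SF) \<Longrightarrow> (T ^^ j) F g \<in> SF"
  by (induction j arbitrary: g) (simp_all add: T_SF)

lemma T_pow_zero:
  "(\<And>ys. length ys = length xs + 2 * j \<Longrightarrow> F (g - int j) ys = 0) \<Longrightarrow> (T ^^ j) F g xs = 0"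
proof (induction j arbitrary: g xs)
  case (Suc j)
  have "(T ^^ j) F (g - 1) ys = 0" if "length ys = length xs + 2" for ys
    by (rule Suc.IH) (use Suc.prems that in \<open>auto simp: algebra_simps\<close>)
  then have "K ((T ^^ j) F (g - 1)) ys = 0" if "length ys = length xs + 2" for ys
    using that by (intro K_zero) auto
  then show ?case using BV_form_zero by (simp add: T_def[of "(T ^^ j) F"])
qed simp

definition R :: "'v series \<Rightarrow> 'v series" where
  "R F = (\<lambda>g xs. Sum_any (\<lambda>j. (T ^^ j) F g xs))"

text \<open>In weight w the order is at most |w| and, where F is nonzero, at least m, while the j-th
  power of \<open>T\<close> reads order g - j. The bound depends on the weight alone, so it holds at
  once for all lists that a further \<open>T\<close> consults.\<close>

lemma T_nilpotent:
  assumes "F \<in> WC"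
  obtains N where "\<And>g xs j. weight g xs = w \<Longrightarrow> j \<ge> N \<Longrightarrow> (T ^^ j) F g xs = 0"
proof -
  obtain m where m: "\<And>g xs. weight g xs = w \<Longrightarrow> F g xs \<noteq> 0 \<Longrightarrow> m \<le> g"
    using assms(1) unfolding weight_completed_iff hbar_bounded_def by blast
  have "(T ^^ j) F g xs = 0" if w: "weight g xs = w" and j: "j \<ge> nat (\<bar>w\<bar> + \<bar>m\<bar> + 1)" for g j xs
  proof (rule T_pow_zero, rule ccontr)
    fix ys assume "length ys = length xs + 2 * j" "F (g - int j) ys \<noteq> 0"
    then have "m \<le> g - int j" by (intro m[of ys]) (use w in auto)
    then show False using w j by linarith
  qed
  then show ?thesis using that by blast
qed

lemma R_eq_sum:
  assumes "\<And>j. j \<ge> N \<Longrightarrow> (T ^^ j) F g xs = 0"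
  shows "R F g xs = (\<Sum>j<N. (T ^^ j) F g xs)"
  unfolding R_def by (rule Sum_any.expand_superset) (use assms in \<open>auto simp: not_le[symmetric]\<close>)

lemma R_WC:
  assumes F: "F \<in> WC" shows "R F \<in> WC"
  unfolding weight_completed_iff
proof (intro conjI allI)
  fix g
  show "R F g \<in> SF"
  proof (rule sym_forms_by_length)
    fix L
    obtain N where N: "\<And>h xs j. weight h xs = int L + 2 * g \<Longrightarrow> j \<ge> N \<Longrightarrow> (T ^^ j) F h xs = 0"
      using T_nilpotent[OF F] by metis
    show "\<exists>f'\<in>SF. \<forall>xs. length xs = L \<longrightarrow> R F g xs = f' xs"
      by (rule bexI[of _ "\<lambda>xs. \<Sum>j<N. (T ^^ j) F g xs"])
        (auto intro!: R_eq_sum N sym_forms_sum T_pow_SF WC_SF[OF F])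
  qed
next
  show "hbar_bounded (R F)"
    unfolding hbar_bounded_def
  proof
    fix w
    obtain m where m: "\<And>g xs. weight g xs = w \<Longrightarrow> F g xs \<noteq> 0 \<Longrightarrow> m \<le> g"
      using assms(1) unfolding weight_completed_iff hbar_bounded_def by blast
    have "m \<le> g" if w: "weight g xs = w" and n: "R F g xs \<noteq> 0" for g xs
    proof -
      obtain j where "(T ^^ j) F g xs \<noteq> 0"
        using n unfolding R_def using Sum_any.not_neutral_obtains_not_neutral by blast
      then obtain ys where ys: "length ys = length xs + 2 * j" "F (g - int j) ys \<noteq> 0"
        using T_pow_zero by blast
      then have "m \<le> g - int j" by (intro m[of ys]) (use w in auto)
      then show ?thesis by simp
    qed
    then show "\<exists>m. \<forall>g xs. weight g xs = w \<longrightarrow> R F g xs \<noteq> 0 \<longrightarrow> m \<le> g" by blast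
  qed
qed

lemma T_sum:
  assumes F: "\<And>j g. F j g \<in> SF"
  shows "T (\<lambda>g xs. \<Sum>j<N. F j g xs) g xs = (\<Sum>j<(N::nat). T (F j) g xs)"
proof (induction N)
  case 0
  show ?case using T_pow_zero[of xs 1 "\<lambda>g xs. 0" g] by simp
next
  case (Suc N)
  have "T (\<lambda>g xs. (\<Sum>j<N. F j g xs) + 1 * F N g xs) g xs = T (\<lambda>g xs. \<Sum>j<N. F j g xs) g xs + 1 * T (F N) g xs"
    by (rule T_lin) (auto intro: sym_forms_sum F)
  then show ?case using Suc by simp
qed

text \<open>The geometric series telescopes. One truncation serves the whole weight, and
  \<open>T\<close> consults only values of that weight.\<close>

lemma R_equation:
  assumes F: "F \<in> WC" shows "R F g xs - T (R F) g xs = F g xs"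
proof -
  let ?w = "weight g xs"
  obtain N where N: "\<And>g xs j. weight g xs = ?w \<Longrightarrow> j \<ge> N \<Longrightarrow> (T ^^ j) F g xs = 0"
    using T_nilpotent[OF F] by metis
  have R: "R F h ys = (\<Sum>j<N. (T ^^ j) F h ys)" if "weight h ys = ?w" for h ys
    by (rule R_eq_sum) (use N that in auto)
  have "T (R F) g xs = T (\<lambda>g xs. \<Sum>j<N. (T ^^ j) F g xs) g xs"
    by (rule T_local) (rule R)
  also have "\<dots> = (\<Sum>j<N. (T ^^ Suc j) F g xs)"
    by (subst T_sum) (simp_all add: T_pow_SF WC_SF[OF F])
  finally have "R F g xs - T (R F) g xs = (\<Sum>j<N. (T ^^ j) F g xs) - (\<Sum>j<N. (T ^^ Suc j) F g xs)"
    using R[of xs g] by simp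
  also have "\<dots> = (T ^^ 0) F g xs - (T ^^ N) F g xs"
    unfolding sum_subtractf[symmetric] by (rule sum_lessThan_telescope')
  finally show ?thesis using N[of xs g N] by simp
qed

text \<open>The difference of two solutions is fixed by \<open>T\<close> and all its powers, and
  these eventually vanish in each weight.\<close>

lemma R_unique:
  assumes F: "F \<in> WC" and Y: "Y \<in> WC" and eq: "\<And>g xs. Y g xs - T Y g xs = F g xs"
  shows "Y = R F"
proof -
  define U where "U = (\<lambda>g xs. Y g xs + - 1 * R F g xs)"
  have U: "U \<in> WC" unfolding U_def by (rule WC_lin[OF Y R_WC[OF F]])
  have TU: "T U = U"
  proof (intro ext)
    fix g and xs :: "'v hvec list"
    have "T U g xs = T Y g xs + - 1 * T (R F) g xs"
      unfolding U_def by (rule T_lin[OF WC_SF[OF Y] WC_SF[OF R_WC[OF F]]])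
    then show "T U g xs = U g xs" using eq[of g xs] R_equation[OF F, of g xs] by (simp add: U_def)
  qed
  have pow: "(T ^^ j) U = U" for j by (induction j) (simp_all add: TU)
  show ?thesis
  proof (intro ext)
    fix g and xs :: "'v hvec list"
    obtain N where "\<And>h ys j. weight h ys = weight g xs \<Longrightarrow> j \<ge> N \<Longrightarrow> (T ^^ j) U h ys = 0"
      using T_nilpotent[OF U] by metis
    then have "U g xs = 0" using pow by (metis order_refl)
    then show "Y g xs = R F g xs" by (simp add: U_def)
  qed
qed

text \<open>With \<open>R_unique\<close> this yields that \<open>R\<close> intertwines Q + hbar
  \<Delta> with Q + hbar \<Delta> after pullback along \<open>pr\<close>. Checking the equation that
  characterizes \<open>R\<close> avoids commuting operators past the infinite series.\<close>

lemma R_chain_eq: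
  assumes Z: "Z \<in> WC"
  defines "Y \<equiv> R Z"
  defines "U \<equiv> (\<lambda>g xs. Qf (Y g) xs + 1 * BV_form (pull pr (Y (g - 1))) xs)"
  shows "U \<in> WC" "U g xs - T U g xs = Qf (Z g) xs + BV_form (Z (g - 1)) xs"
proof -
  have Y: "Y \<in> WC" unfolding Y_def by (rule R_WC[OF Z])
  note YS = WC_SF[OF Y]
  show "U \<in> WC"
    unfolding U_def by (intro WC_lin WC_Qs WC_Dl[of "\<lambda>g. pull pr (Y g)"] WC_pull homap_pr Y)
  have Zeq: "Z h = (\<lambda>ys. Y h ys + 1 * BV_form (K (Y (h - 1))) ys)" for h
    using R_equation[OF Z, of h] by (simp add: fun_eq_iff Y_def T_def)
  define h where "h = g - 1"
  \<comment> \<open>\<open>K\<close> annihilates the second part of \<open>U\<close>, which is a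
    pullback along \<open>pr\<close>; on the first part the homotopy relation expresses K Q through
    Q K.\<close>
  have KU: "K (U h) = (\<lambda>ys. (Y h ys + - 1 * pull pr (Y h) ys) + - 1 * Qf (K (Y h)) ys)"
  proof
    fix ys
    have "K (U h) ys = K (Qf (Y h)) ys + 1 * K (BV_form (pull pr (Y (h - 1)))) ys"
      unfolding U_def by (rule K_lin) (intro Qf_SF BV_form_SF pull_SF homap_pr YS)+
    also have "K (BV_form (pull pr (Y (h - 1)))) ys = 0"
      using K_pull[where f = "BV_form (pull pr (Y (h - 1)))" and xs = ys, OF BV_form_SF[OF pull_SF[OF homap_pr YS]]]
      by (simp only: pull_BV_form_pull[OF YS])
    finally show "K (U h) ys = (Y h ys + - 1 * pull pr (Y h) ys) + - 1 * Qf (K (Y h)) ys"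
      using K_homotopy[OF YS, of h ys] by simp
  qed
  have "U g xs - T U g xs = Qf (Y g) xs + BV_form (pull pr (Y h)) xs + BV_form (K (U h)) xs"
    by (simp add: U_def T_def h_def)
  also have "BV_form (K (U h)) xs = BV_form (Y h) xs - BV_form (pull pr (Y h)) xs - BV_form (Qf (K (Y h))) xs"
    unfolding KU BV_form_lin by simp
  also have "BV_form (Qf (K (Y h))) xs = - Qf (BV_form (K (Y h))) xs"
    using BV_form_Qf[OF K_SF[OF YS], of h xs] by simp
  finally have 1: "U g xs - T U g xs = Qf (Y g) xs + BV_form (Y h) xs + Qf (BV_form (K (Y h))) xs"
    by simp
  have "Qf (Z g) xs = Qf (Y g) xs + 1 * Qf (BV_form (K (Y h))) xs"
    unfolding Zeq h_def by (rule Qf_lin)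
  moreover have "BV_form (Z h) xs = BV_form (Y h) xs + 1 * BV_form (BV_form (K (Y (h - 1)))) xs"
    unfolding Zeq by (rule BV_form_lin)
  ultimately show "U g xs - T U g xs = Qf (Z g) xs + BV_form (Z (g - 1)) xs"
    using 1 BV_form_BV_form[OF K_SF[OF YS]] by (simp add: h_def)
qed

text \<open>For X = R E the sum of Q X and hbar \<Delta> of the pullback of X solves the equation
  with right side 0 and vanishes. Pullback along \<open>pr\<close> kills its first term and fixes
  the second, so both are 0. Then the homotopy relation for X turns E = X + hbar \<Delta>K X into
  the last claim.\<close>

lemma R_closed:
  assumes E: "E \<in> WC" and closed: "\<And>g xs. Qf (E g) xs + BV_form (E (g - 1)) xs = 0"
  shows "BV_form (pull pr (R E g)) xs = 0" and "Qf (R E g) xs = 0"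
    and "E g xs = pull pr (R E g) xs + (Qf (K (R E g)) xs + BV_form (K (R E (g - 1))) xs)"
proof -
  define X where "X = R E"
  have X: "X \<in> WC" unfolding X_def by (rule R_WC[OF E])
  note XS = WC_SF[OF X]
  define U where "U = (\<lambda>g xs. Qf (X g) xs + 1 * BV_form (pull pr (X (g - 1))) xs)"
  have z: "(\<lambda>g xs. 0) \<in> WC" using WC_lin[OF E E, of "- 1"] by simp
  have "U \<in> WC" unfolding U_def X_def by (rule R_chain_eq(1)[OF E])
  moreover have "U g xs - T U g xs = 0" for g xs
    using R_chain_eq(2)[OF E, of g xs] closed[of g xs] unfolding U_def X_def by (simp only:)
  ultimately have "U = R (\<lambda>g xs. 0)" by (rule R_unique[OF z])
  also have "\<dots> = (\<lambda>g xs. 0)"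
    by (rule R_unique[OF z z, symmetric]) (use T_pow_zero[of _ 1 "\<lambda>g xs. 0"] in simp)
  finally have sum: "Qf (X g) xs + BV_form (pull pr (X (g - 1))) xs = 0" for g xs
    by (metis U_def mult_1)
  have "BV_form (pull pr (X g)) xs = 0" for g xs
  proof -
    \<comment> \<open>The vanishing sum is used one order higher, since hbar \<Delta> raises the
      order by 1.\<close>
    have "pull pr (BV_form (pull pr (X g))) xs = 0"
      using sum[of "g + 1" "map (hmap 0 pr) xs"] pull_Qf[OF XS, of "g + 1" xs] by (simp add: pull_def split: if_splits)
    then show ?thesis by (simp add: pull_BV_form_pull[OF XS])
  qed
  then show 1: "BV_form (pull pr (R E g)) xs = 0" for g xs by (simp add: X_def)
  have Q: "Qf (X g) = (\<lambda>xs. 0)" for g using sum 1 by (simp add: X_def fun_eq_iff)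
  then show "Qf (R E g) xs = 0" by (simp add: X_def)
  have "K (Qf (X g)) xs = 0" using Q by (simp add: K_zero)
  then show "E g xs = pull pr (R E g) xs + (Qf (K (R E g)) xs + BV_form (K (R E (g - 1))) xs)"
    using K_homotopy[OF XS, of g xs] R_equation[OF E, of g xs] by (simp add: X_def T_def)
qed

end

context sdr2
begin

text \<open>\<open>E\<close> is the pullback of f along \<open>B.pr\<close> plus an image of Q +
  hbar \<Delta>. The second resolvent fixes the former and, by its intertwining property, rewrites
  the latter with Y = B.R W.\<close>

lemma R_compare:
  assumes E: "E \<in> WC" and closed: "\<And>g xs. Qf (E g) xs + BV_form (E (g - 1)) xs = 0"
  obtains Y where "Y \<in> WC" "\<And>g xs. B.R E g xs =
    pull B.pr (pull pr (R E g)) xs + Qf (Y g) xs + BV_form (pull B.pr (Y (g - 1))) xs"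
proof -
  define X where "X = R E"
  have X: "X \<in> WC" unfolding X_def by (rule R_WC[OF E])
  define f where "f g = pull pr (X g)" for g
  have f: "f \<in> WC" unfolding f_def[abs_def] by (rule WC_pull[OF homap_pr X])
  note fS = WC_SF[OF f]
  have inv: "pull pr (f g) = f g" for g by (simp add: f_def pull_pull)
  have fc: "BV_form (f g) ys = 0" for g ys using R_closed(1)[OF E closed] by (simp add: f_def X_def)
  have ZW: "(\<lambda>g. Z (f g)) \<in> WC"
  proof -
    have "Z f xs = 0" if "\<And>ys. length ys = length xs \<Longrightarrow> f ys = 0" for f xs
      using avg_der_cong[OF Z_args, of xs f "\<lambda>_. 0"] that by (simp add: Z_def avg_der_def)
    then show ?thesis
      by (intro WC_transfer[OF f, where n = 0]) (auto intro: Z_SF fS)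
  qed
  define W where "W = (\<lambda>g xs. K (X g) xs + 1 * Z (f g) xs)"
  have W: "W \<in> WC" unfolding W_def by (rule WC_lin[OF WC_Ks[OF X] ZW])
  have E_eq: "E g xs = pull B.pr (f g) xs + (Qf (W g) xs + BV_form (W (g - 1)) xs)" for g xs
  proof -
    have "Qf (W g) xs = Qf (K (X g)) xs + 1 * Qf (Z (f g)) xs"
      unfolding W_def by (rule Qf_lin)
    moreover have "BV_form (W (g - 1)) xs = BV_form (K (X (g - 1))) xs + 1 * BV_form (Z (f (g - 1))) xs"
      unfolding W_def by (rule BV_form_lin)
    ultimately show ?thesis
      using R_closed(3)[OF E closed, of g xs] Z_homotopy[OF fS inv, of g xs] BV_form_Z[OF fS inv fc, of "g - 1" xs]
      by (simp add: f_def X_def)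
  qed
  define Y where "Y = B.R W"
  have Y: "Y \<in> WC" unfolding Y_def by (rule B.R_WC[OF W])
  define U where "U = (\<lambda>g xs. Qf (Y g) xs + 1 * BV_form (pull B.pr (Y (g - 1))) xs)"
  have U: "U \<in> WC" "U g xs - B.T U g xs = Qf (W g) xs + BV_form (W (g - 1)) xs" for g xs
    using B.R_chain_eq[OF W] by (simp_all add: U_def Y_def)
  define f' where "f' g = pull B.pr (f g)" for g
  have f': "f' \<in> WC" unfolding f'_def[abs_def] by (rule WC_pull[OF B.homap_pr f])
  \<comment> \<open>\<open>B.K\<close> vanishes on pullbacks along \<open>B.pr\<close>, so the
    second resolvent leaves \<open>f'\<close> unchanged.\<close>
  have Tf': "B.T f' g xs = 0" for g xs
    using BV_form_zero[of xs "B.K (f' (g - 1))"] B.K_pull[OF fS] by (simp add: B.T_def f'_def)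
  have eq: "(\<lambda>g xs. f' g xs + 1 * U g xs) = B.R E"
  proof (rule B.R_unique[OF E WC_lin[OF f' U(1)]])
    show "f' g xs + 1 * U g xs - B.T (\<lambda>g xs. f' g xs + 1 * U g xs) g xs = E g xs" for g xs
      unfolding B.T_lin[OF WC_SF[OF f'] WC_SF[OF U(1)]] Tf'
      using U(2)[of g xs] E_eq[of g xs] by (simp add: f'_def)
  qed
  have "B.R E g xs = pull B.pr (pull pr (R E g)) xs + Qf (Y g) xs + BV_form (pull B.pr (Y (g - 1))) xs" for g xs
    unfolding eq[symmetric] by (simp add: f'_def f_def X_def U_def)
  then show ?thesis using that Y by blast
qed

end

section \<open>Non-degenerate isotropes\<close>

lemma coset_eq_iff:
  assumes B: "subspace B" shows "coset B u = coset B v \<longleftrightarrow> u - v \<in> B"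
proof
  assume "coset B u = coset B v"
  moreover have "u \<in> coset B u" unfolding coset_def using subspace_0[OF B] by force
  ultimately obtain b where "b \<in> B" "u = v + b" unfolding coset_def by blast
  then show "u - v \<in> B" by simp
next
  assume uv: "u - v \<in> B"
  show "coset B u = coset B v"
  proof (intro subset_antisym subsetI)
    fix x assume "x \<in> coset B u"
    then obtain b where b: "b \<in> B" "x = u + b" unfolding coset_def by blast
    have "(u - v) + b \<in> B" using subspace_add[OF B uv b(1)] .
    moreover have "x = v + ((u - v) + b)" using b(2) by simp
    ultimately show "x \<in> coset B v" unfolding coset_def by blast
  next
    fix x assume "x \<in> coset B v"
    then obtain b where b: "b \<in> B" "x = v + b" unfolding coset_def by blast
    have "b - (u - v) \<in> B" using subspace_diff[OF B b(1) uv] .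
    moreover have "x = u + (b - (u - v))" using b(2) by simp
    ultimately show "x \<in> coset B u" unfolding coset_def by blast
  qed
qed

lemma coset_add:
  assumes B: "subspace B"
  shows "{x + y | x y. x \<in> coset B u \<and> y \<in> coset B v} = coset B (u + v)"
proof (intro subset_antisym subsetI)
  fix z assume "z \<in> {x + y | x y. x \<in> coset B u \<and> y \<in> coset B v}"
  then obtain a b where ab: "a \<in> B" "b \<in> B" "z = (u + a) + (v + b)" unfolding coset_def by blast
  then have "z = (u + v) + (a + b)" by simp
  then show "z \<in> coset B (u + v)" unfolding coset_def using subspace_add[OF B ab(1,2)] by blast
next
  fix z assume "z \<in> coset B (u + v)"
  then obtain b where b: "b \<in> B" "z = (u + v) + b" unfolding coset_def by blast
  then have "z = (u + 0) + (v + b)" by simp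
  then show "z \<in> {x + y | x y. x \<in> coset B u \<and> y \<in> coset B v}"
    unfolding coset_def using b(1) subspace_0[OF B] by blast
qed

lemma coset_scale:
  assumes B: "subspace B"
  shows "{c *\<^sub>R x + b | x b. x \<in> coset B v \<and> b \<in> B} = coset B (c *\<^sub>R v)"
proof (intro subset_antisym subsetI)
  fix z assume "z \<in> {c *\<^sub>R x + b | x b. x \<in> coset B v \<and> b \<in> B}"
  then obtain a b where ab: "a \<in> B" "b \<in> B" "z = c *\<^sub>R (v + a) + b" unfolding coset_def by blast
  then have "z = c *\<^sub>R v + (c *\<^sub>R a + b)" by (simp add: scaleR_right_distrib)
  then show "z \<in> coset B (c *\<^sub>R v)" unfolding coset_def
    using subspace_add[OF B subspace_scale[OF B ab(1)] ab(2)] by blast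
next
  fix z assume "z \<in> coset B (c *\<^sub>R v)"
  then obtain b where b: "b \<in> B" "z = c *\<^sub>R (v + 0) + b" unfolding coset_def by auto
  then show "z \<in> {c *\<^sub>R x + b | x b. x \<in> coset B v \<and> b \<in> B}"
    unfolding coset_def using subspace_0[OF B] by blast
qed

lemma subquotient_simps:
  "hcomp (subquotient V A B) d = coset B ` (A \<inter> V d)"
  "subspace B \<Longrightarrow> vadd (subquotient V A B) (coset B u) (coset B v) = coset B (u + v)"
  "subspace B \<Longrightarrow> vscale (subquotient V A B) c (coset B v) = coset B (c *\<^sub>R v)"
  "vzero (subquotient V A B) = B"
  by (simp_all only: subquotient_def gspace.simps coset_add coset_scale)

context dg_symp
begin

lemma part_q: "part (q v) (d + 1) = q (part v d)"
proof -
  have "part (q v) = (\<lambda>e. q (part v (e - 1)))"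
  proof (rule part_unique[of _ "(\<lambda>d. d + 1) ` {d. part v d \<noteq> 0}"])
    show "q (part v (d - 1)) \<in> V d" for d using q_V[OF part(1)[of v "d - 1"]] by simp
    show "{d. q (part v (d - 1)) \<noteq> 0} \<subseteq> (\<lambda>d. d + 1) ` {d. part v d \<noteq> 0}"
    proof
      fix d assume "d \<in> {d. q (part v (d - 1)) \<noteq> 0}"
      then have "part v (d - 1) \<noteq> 0" using q_simps(4) by auto
      then show "d \<in> (\<lambda>d. d + 1) ` {d. part v d \<noteq> 0}" by (intro image_eqI[of _ _ "d - 1"]) auto
    qed
    have "q v = q (\<Sum>d | part v d \<noteq> 0. part v d)" by (simp add: part(3))
    also have "\<dots> = (\<Sum>d | part v d \<noteq> 0. q (part v d))" by (rule linear_sum[OF lin_q])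
    finally show "q v = (\<Sum>d\<in>(\<lambda>d. d + 1) ` {d. part v d \<noteq> 0}. q (part v (d - 1)))"
      by (simp add: sum.reindex inj_on_def)
  qed (simp add: part(2))
  then show ?thesis by simp
qed

lemma \<omega>_comp: "\<omega> (part v d) w = \<omega> v (part w (1 - d))"
proof -
  have fin: "finite (insert (1 - d) {e. part w e \<noteq> 0})" "finite (insert d {e. part v e \<noteq> 0})"
    by (simp_all add: part(2))
  have "\<omega> (part v d) w = \<omega> (part v d) (\<Sum>e\<in>insert (1 - d) {e. part w e \<noteq> 0}. part w e)"
    by (subst part_sum) (auto simp: part(2))
  also have "\<dots> = (\<Sum>e\<in>insert (1 - d) {e. part w e \<noteq> 0}. \<omega> (part v d) (part w e))"
    by (rule linear_sum[OF lin_\<omega>_right])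
  also have "\<dots> = (\<Sum>e\<in>{1 - d}. \<omega> (part v d) (part w e))"
    by (rule sum.mono_neutral_right[OF fin(1)]) (auto intro!: \<omega>_deg[OF part(1) part(1)])
  also have "\<dots> = (\<Sum>e\<in>{d}. \<omega> (part v e) (part w (1 - d)))" by simp
  also have "\<dots> = (\<Sum>e\<in>insert d {e. part v e \<noteq> 0}. \<omega> (part v e) (part w (1 - d)))"
    by (rule sum.mono_neutral_left[OF fin(2)]) (auto intro!: \<omega>_deg[OF part(1) part(1)])
  also have "\<dots> = \<omega> (\<Sum>e\<in>insert d {e. part v e \<noteq> 0}. part v e) (part w (1 - d))"
    by (rule linear_sum[OF lin_\<omega>_left, symmetric])
  also have "\<dots> = \<omega> v (part w (1 - d))"
    by (subst part_sum) (auto simp: part(2))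
  finally show ?thesis .
qed

lemma part_eq_0: "(\<And>d. part v d = 0) \<Longrightarrow> v = 0"
  using part(3)[of v] by simp

lemma range_q: "subspace (range q)"
  using linear_subspace_image[OF lin_q subspace_UNIV] by simp

context
  fixes J assumes J: "nondegenerate_isotrope V \<omega> q J"
begin

lemma sub_J: "subspace J"
  using J unfolding nondegenerate_isotrope_def graded_subspace_def by (elim conjE)

lemma J_graded: "J \<subseteq> span (\<Union>d. J \<inter> V d)"
  using J unfolding nondegenerate_isotrope_def graded_subspace_def by (elim conjE)

lemma J_iso:
  assumes "v \<in> J" "w \<in> J" shows "\<omega> v w = 0"
proof -
  have "\<forall>v\<in>J. \<forall>w\<in>J. \<omega> v w = 0"
    using J unfolding nondegenerate_isotrope_def by (elim conjE)
  then show ?thesis using assms by blast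
qed

lemma J_nd:
  assumes "v \<in> J" "v \<in> V d" "\<And>w. w \<in> J \<Longrightarrow> \<omega> (q v) w = 0"
  shows "v = 0"
proof -
  have "\<forall>w\<in>J. ksgn d * \<omega> (q v) w = 0" using assms(3) by simp
  then show ?thesis using J assms(1,2) unfolding nondegenerate_isotrope_def by blast
qed

lemma part_J: "v \<in> J \<Longrightarrow> part v d \<in> J"
proof -
  assume "v \<in> J"
  then have "v \<in> span (\<Union>d. J \<inter> V d)" using J_graded by blast
  then show "part v d \<in> J"
  proof (induction rule: span_induct)
    case base
    show ?case
      by (rule subspaceI)
        (auto simp: part_add part_scale linear_0[OF lin_comp] subspace_0[OF sub_J] subspace_add[OF sub_J] subspace_scale[OF sub_J])
  next
    case (step x)
    then show ?case using part_hom subspace_0[OF sub_J] by auto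
  qed
qed

text \<open>Non-degeneracy is assumed on homogeneous vectors. Each component of v inherits the
  orthogonality because \<open>J\<close> contains the components of w.\<close>

lemma J_nondeg:
  assumes v: "v \<in> J" and 0: "\<And>w. w \<in> J \<Longrightarrow> \<omega> (q v) w = 0"
  shows "v = 0"
proof (rule part_eq_0)
  fix d
  show "part v d = 0"
  proof (rule J_nd[OF part_J[OF v] part(1)])
    fix w assume w: "w \<in> J"
    show "\<omega> (q (part v d)) w = 0"
      unfolding part_q[symmetric] \<omega>_comp by (rule 0[OF part_J[OF w]])
  qed
qed

lemma J_nondeg':
  assumes v: "v \<in> J" and 0: "\<And>w. w \<in> J \<Longrightarrow> \<omega> (q w) v = 0"
  shows "v = 0"
proof (rule J_nondeg[OF v])
  fix w assume w: "w \<in> J"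
  have "\<omega> (q v) (part w d) = 0" for d
    using 0[OF part_J[OF w], of d] \<omega>_q[OF part(1)[of w d], of v] \<omega>_swap[of "q v" "part w d"]
    by (auto simp: ksgn_def split: if_splits)
  moreover have "\<omega> (q v) w = (\<Sum>d | part w d \<noteq> 0. \<omega> (q v) (part w d))"
    using linear_sum[OF lin_\<omega>_right, of "q v" "part w" "{d. part w d \<noteq> 0}"] by (simp add: part(3))
  ultimately show "\<omega> (q v) w = 0" by simp
qed

section \<open>The splitting of V into J + qJ and its orthogonal complement\<close>

definition U where "U = {a + q b | a b. a \<in> J \<and> b \<in> J}"

lemma U_I: "a \<in> J \<Longrightarrow> b \<in> J \<Longrightarrow> a + q b \<in> U"
  unfolding U_def by blast

lemma J_U: "a \<in> J \<Longrightarrow> a \<in> U" and qJ_U: "a \<in> J \<Longrightarrow> q a \<in> U"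
  using U_I[of a 0] U_I[of 0 a] subspace_0[OF sub_J] by (simp_all add: q_simps)

lemma sub_U: "subspace U"
proof (rule subspaceI)
  show "0 \<in> U" using J_U subspace_0[OF sub_J] by blast
  show "x + y \<in> U" if xy: "x \<in> U" "y \<in> U" for x y
  proof -
    obtain a b c d where "a \<in> J" "b \<in> J" "c \<in> J" "d \<in> J" "x = a + q b" "y = c + q d"
      using xy unfolding U_def by blast
    then show ?thesis using U_I[of "a + c" "b + d"] by (simp add: q_simps subspace_add[OF sub_J] algebra_simps)
  qed
  show "c *\<^sub>R x \<in> U" if x: "x \<in> U" for c x
  proof -
    obtain a b where "a \<in> J" "b \<in> J" "x = a + q b" using x unfolding U_def by blast
    then show ?thesis using U_I[of "c *\<^sub>R a" "c *\<^sub>R b"] by (simp add: q_simps subspace_scale[OF sub_J] algebra_simps)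
  qed
qed

lemma part_U: assumes "u \<in> U" shows "part u d \<in> U"
proof -
  obtain a b where ab: "a \<in> J" "b \<in> J" "u = a + q b" using assms unfolding U_def by blast
  have "part u d = part a d + q (part b (d - 1))"
    using part_q[of b "d - 1"] by (simp add: ab(3) part_add)
  then show ?thesis using U_I part_J ab by simp
qed

text \<open>Pairing with \<open>J\<close> sees only b, since \<open>J\<close> is isotropic; once b =
  0, pairing with qJ detects a.\<close>

lemma U_nondeg:
  assumes u: "u \<in> U" and 0: "\<And>w. w \<in> U \<Longrightarrow> \<omega> u w = 0"
  shows "u = 0"
proof -
  obtain a b where ab: "a \<in> J" "b \<in> J" "u = a + q b" using u unfolding U_def by blast
  have "b = 0"
  proof (rule J_nondeg[OF ab(2)])
    fix w assume w: "w \<in> J"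
    show "\<omega> (q b) w = 0" using 0[OF J_U[OF w]] J_iso[OF ab(1) w] by (simp add: ab(3) \<omega>_simps)
  qed
  moreover have "a = 0"
  proof (rule J_nondeg'[OF ab(1)])
    fix w assume w: "w \<in> J"
    show "\<omega> (q w) a = 0" using 0[OF qJ_U[OF w]] \<omega>_swap[of a "q w"] by (simp add: ab(3) \<open>b = 0\<close> q_simps)
  qed
  ultimately show ?thesis using ab(3) by (simp add: q_simps)
qed

lemma orth_I: "(\<And>u. u \<in> U \<Longrightarrow> \<omega> w u = 0) \<Longrightarrow> w \<in> orth \<omega> U"
  and orth_D: "w \<in> orth \<omega> U \<Longrightarrow> u \<in> U \<Longrightarrow> \<omega> w u = 0"
  unfolding orth_def by blast+

lemma sub_orth: "subspace (orth \<omega> U)"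
  by (rule subspaceI) (auto simp: orth_def \<omega>_simps)

lemma U_orth: "u \<in> U \<Longrightarrow> u \<in> orth \<omega> U \<Longrightarrow> u = 0"
  using U_nondeg orth_D by blast

lemma part_orth:
  assumes "w \<in> orth \<omega> U" shows "part w d \<in> orth \<omega> U"
  by (rule orth_I) (simp add: \<omega>_comp orth_D[OF assms] part_U)

text \<open>\<open>T w\<close> records the restriction of \<omega>(w, .) to \<open>U\<close> in a
  basis of \<open>U\<close>. It is injective on \<open>U\<close>, hence maps \<open>U\<close> onto
  itself, and some u in \<open>U\<close> has the same restriction as v.\<close>

lemma decompose_U: obtains u where "u \<in> U" "v - u \<in> orth \<omega> U"
proof -
  obtain F :: "'v set" where F: "finite F" "span F = UNIV"
    using fd unfolding finite_dimensional_def by blast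
  obtain B where B: "B \<subseteq> U" "independent B" "U \<subseteq> span B"
    by (rule real_vector.maximal_independent_subset)
  have finB: "finite B" using independent_span_bound[OF F(1) B(2)] F(2) by simp
  define T where "T w = (\<Sum>b\<in>B. \<omega> w b *\<^sub>R b)" for w
  have linT: "linear T"
    by (rule linearI) (simp_all add: T_def \<omega>_simps scaleR_left_distrib sum.distrib scaleR_sum_right)
  have TU: "T w \<in> U" for w
    unfolding T_def using B(1) by (intro subspace_sum[OF sub_U] subspace_scale[OF sub_U]) auto
  have T0: "w \<in> orth \<omega> U" if "T w = 0" for w
  proof -
    have nz: "\<forall>u. (\<forall>v\<in>B. u v = 0) \<or> (\<Sum>v\<in>B. u v *\<^sub>R v) \<noteq> 0"
      using B(2) by (simp add: dependent_finite[OF finB])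
    have "\<omega> w b = 0" if "b \<in> B" for b
      using nz[THEN spec, of "\<omega> w"] that \<open>T w = 0\<close> by (auto simp: T_def)
    then have "\<omega> w u = 0" if "u \<in> span B" for u
      using that linear_eq_0_on_span[OF lin_\<omega>_right, of B w u] by blast
    then show ?thesis using B(3) by (intro orth_I) auto
  qed
  have "inj_on T U"
    unfolding linear_inj_on_iff_eq_0[OF linT sub_U] using T0 U_orth by blast
  then have "T ` U = U"
    using finite_dimensional_inj_image_eq[OF fd linT sub_U] TU by blast
  then obtain u where u: "u \<in> U" "T u = T v" using TU by (metis imageE)
  then have "T (v - u) = 0" by (simp add: linear_diff[OF linT])
  then show ?thesis using that u(1) T0 by blast
qed

lemma decompose: obtains a b w where "a \<in> J" "b \<in> J" "w \<in> orth \<omega> U" "v = a + q b + w"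
proof -
  obtain u where u: "u \<in> U" "v - u \<in> orth \<omega> U" by (rule decompose_U)
  then obtain a b where "a \<in> J" "b \<in> J" "u = a + q b" unfolding U_def by blast
  then show ?thesis using that[of a b "v - u"] u(2) by simp
qed

lemma decompose_unique:
  assumes "a \<in> J" "b \<in> J" "w \<in> orth \<omega> U" "a' \<in> J" "b' \<in> J" "w' \<in> orth \<omega> U"
    and eq: "a + q b + w = a' + q b' + w'"
  shows "b = b'"
proof -
  have J': "a - a' \<in> J" "b - b' \<in> J" using assms by (simp_all add: subspace_diff[OF sub_J])
  have "w' - w = (a - a') + q (b - b')" using eq by (simp add: q_simps algebra_simps)
  moreover have "w' - w \<in> orth \<omega> U" using assms by (simp add: subspace_diff[OF sub_orth])
  ultimately have z: "(a - a') + q (b - b') = 0" using U_I[OF J'] U_orth by metis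
  have "b - b' = 0"
  proof (rule J_nondeg[OF J'(2)])
    fix w assume w: "w \<in> J"
    have "q (b - b') = - (a - a')" by (rule minus_unique[OF z, symmetric])
    then show "\<omega> (q (b - b')) w = 0" using J_iso[OF J'(1) w] by (simp only: \<omega>_simps)
  qed
  then show ?thesis by simp
qed

section \<open>The homotopy of a non-degenerate isotrope\<close>

lemma kmap_exists:
  obtains k where "linear k" "\<And>v. v \<in> J \<Longrightarrow> k (q v) = v" "\<And>v. v \<in> J \<Longrightarrow> k v = 0"
    "\<And>v. v \<in> orth \<omega> U \<Longrightarrow> k v = 0"
proof -
  define k where "k v = (SOME b. \<exists>a\<in>J. \<exists>w\<in>orth \<omega> U. b \<in> J \<and> v = a + q b + w)" for v
  have k: "k v = b" if "a \<in> J" "b \<in> J" "w \<in> orth \<omega> U" "v = a + q b + w" for v a b w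
  proof -
    have "\<exists>b. \<exists>a\<in>J. \<exists>w\<in>orth \<omega> U. b \<in> J \<and> v = a + q b + w" using that by blast
    then have "\<exists>a\<in>J. \<exists>w\<in>orth \<omega> U. k v \<in> J \<and> v = a + q (k v) + w" unfolding k_def by (rule someI_ex)
    then show ?thesis using decompose_unique that by metis
  qed
  note J0 = subspace_0[OF sub_J] and O0 = subspace_0[OF sub_orth]
  show ?thesis
  proof (rule that)
    show "linear k"
    proof (rule linearI)
      fix u v
      obtain a b w where 1: "a \<in> J" "b \<in> J" "w \<in> orth \<omega> U" "u = a + q b + w" by (rule decompose)
      obtain a' b' w' where 2: "a' \<in> J" "b' \<in> J" "w' \<in> orth \<omega> U" "v = a' + q b' + w'" by (rule decompose)
      have "k (u + v) = b + b'"
        by (rule k[where a = "a + a'" and w = "w + w'"])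
          (use 1 2 in \<open>simp_all add: subspace_add[OF sub_J] subspace_add[OF sub_orth] q_simps\<close>)
      then show "k (u + v) = k u + k v" using k[OF 1] k[OF 2] by simp
    next
      fix c v
      obtain a b w where 1: "a \<in> J" "b \<in> J" "w \<in> orth \<omega> U" "v = a + q b + w" by (rule decompose)
      have "k (c *\<^sub>R v) = c *\<^sub>R b"
        by (rule k[where a = "c *\<^sub>R a" and w = "c *\<^sub>R w"])
          (use 1 in \<open>simp_all add: subspace_scale[OF sub_J] subspace_scale[OF sub_orth] q_simps scaleR_right_distrib\<close>)
      then show "k (c *\<^sub>R v) = c *\<^sub>R k v" using k[OF 1] by simp
    qed
    show "k (q v) = v" if "v \<in> J" for v
      by (rule k[where a = 0 and w = 0]) (use that J0 O0 in simp_all)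
    show "k v = 0" if "v \<in> J" for v
      by (rule k[where a = v and w = 0]) (use that J0 O0 in \<open>simp_all add: q_simps\<close>)
    show "k v = 0" if "v \<in> orth \<omega> U" for v
      by (rule k[where a = 0 and w = v]) (use that J0 O0 in \<open>simp_all add: q_simps\<close>)
  qed
qed

lemma kmap:
  shows lin_kmap: "linear (kmap \<omega> q J)" and kmap_qJ: "v \<in> J \<Longrightarrow> kmap \<omega> q J (q v) = v"
    and kmap_J: "v \<in> J \<Longrightarrow> kmap \<omega> q J v = 0" and kmap_orth: "v \<in> orth \<omega> U \<Longrightarrow> kmap \<omega> q J v = 0"
proof -
  let ?P = "\<lambda>k. linear k \<and> (\<forall>v\<in>J. k (q v) = v) \<and> (\<forall>v\<in>J. k v = 0) \<and> (\<forall>v\<in>orth \<omega> U. k v = 0)"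
  obtain k where k: "?P k" using kmap_exists by metis
  have "k' = k" if k': "?P k'" for k'
  proof
    fix v
    obtain a b w where "a \<in> J" "b \<in> J" "w \<in> orth \<omega> U" "v = a + q b + w" by (rule decompose)
    then show "k' v = k v" using k k' by (simp add: linear_add)
  qed
  then have "kmap \<omega> q J = k" unfolding kmap_def U_def[symmetric] using k by (intro the_equality) blast+
  then have "?P (kmap \<omega> q J)" using k by simp
  then show "linear (kmap \<omega> q J)" "v \<in> J \<Longrightarrow> kmap \<omega> q J (q v) = v"
    "v \<in> J \<Longrightarrow> kmap \<omega> q J v = 0" "v \<in> orth \<omega> U \<Longrightarrow> kmap \<omega> q J v = 0" by blast+
qed

lemma kmap_decompose:
  "a \<in> J \<Longrightarrow> b \<in> J \<Longrightarrow> w \<in> orth \<omega> U \<Longrightarrow> kmap \<omega> q J (a + q b + w) = b"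
  by (simp add: linear_add[OF lin_kmap] kmap_qJ kmap_J kmap_orth)

lemma kmap_in_J: "kmap \<omega> q J v \<in> J"
proof -
  obtain a b w where "a \<in> J" "b \<in> J" "w \<in> orth \<omega> U" "v = a + q b + w" by (rule decompose)
  then show ?thesis using kmap_decompose by simp
qed

lemma decompose_hom:
  assumes v: "v \<in> V d"
  obtains a b w where "a \<in> J" "b \<in> J" "w \<in> orth \<omega> U" "v = a + q b + w" "a \<in> V d" "b \<in> V (d - 1)" "w \<in> V d"
proof -
  obtain a b w where 1: "a \<in> J" "b \<in> J" "w \<in> orth \<omega> U" "v = a + q b + w" by (rule decompose)
  have "v = part v d" using part_hom[OF v] by simp
  also have "\<dots> = part a d + q (part b (d - 1)) + part w d"
    using part_q[of b "d - 1"] by (simp add: 1(4) part_add)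
  finally show ?thesis
    using that[OF part_J[OF 1(1)] part_J[OF 1(2)] part_orth[OF 1(3)]] part(1) by blast
qed

lemma homap_kmap: "homap (- 1) (kmap \<omega> q J)"
  unfolding homap_def
proof (intro conjI allI ballI lin_kmap)
  fix d v assume "v \<in> V d"
  then obtain a b w where "a \<in> J" "b \<in> J" "w \<in> orth \<omega> U" "v = a + q b + w" "a \<in> V d" "b \<in> V (d - 1)" "w \<in> V d"
    by (rule decompose_hom)
  then show "kmap \<omega> q J v \<in> V (d + - 1)" using kmap_decompose by simp
qed

text \<open>Isotropy and orthogonality reduce both sides to the qJ components b and b': to
  \<omega>(b, q b') and \<omega>(q b, b'). These differ by the sign of \<open>q\<close> in degree d
  - 1.\<close>

lemma \<omega>_kmap:
  assumes v: "v \<in> V d"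
  shows "\<omega> (kmap \<omega> q J v) w = ksgn d * \<omega> v (kmap \<omega> q J w)"
proof -
  obtain a b x where 1: "a \<in> J" "b \<in> J" "x \<in> orth \<omega> U" "v = a + q b + x" "a \<in> V d" "b \<in> V (d - 1)" "x \<in> V d"
    by (rule decompose_hom[OF v])
  obtain a' b' y where 2: "a' \<in> J" "b' \<in> J" "y \<in> orth \<omega> U" "w = a' + q b' + y" by (rule decompose)
  have "\<omega> (kmap \<omega> q J v) w = \<omega> b (q b')"
    using kmap_decompose[OF 1(1-3)] J_iso[OF 1(2) 2(1)] orth_D[OF 2(3) J_U[OF 1(2)]] \<omega>_swap[of b y]
    by (simp add: 1(4) 2(4) \<omega>_simps)
  moreover have "\<omega> v (kmap \<omega> q J w) = \<omega> (q b) b'"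
    using kmap_decompose[OF 2(1-3)] J_iso[OF 1(1) 2(2)] orth_D[OF 1(3) J_U[OF 2(2)]]
    by (simp add: 1(4) 2(4) \<omega>_simps)
  moreover have "\<omega> (q b) b' = ksgn d * \<omega> b (q b')"
    using \<omega>_q[OF 1(6)] by (simp add: ksgn_def)
  ultimately show ?thesis by simp
qed

text \<open>\<open>q\<close> preserves J + qJ and is its own adjoint up to a sign depending on the
  degree; therefore w is split into components.\<close>

lemma q_orth:
  assumes w: "w \<in> orth \<omega> U" shows "q w \<in> orth \<omega> U"
proof (rule orth_I)
  fix u assume u: "u \<in> U"
  have qu: "q u \<in> U"
  proof -
    obtain a b where "a \<in> J" "b \<in> J" "u = a + q b" using u unfolding U_def by blast
    then show ?thesis using qJ_U by (simp add: q_simps)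
  qed
  have "\<omega> (q (part w d)) u = 0" for d
    using \<omega>_q[OF part(1)] orth_D[OF part_orth[OF w] qu] by simp
  moreover have "q w = (\<Sum>d | part w d \<noteq> 0. q (part w d))"
    using linear_sum[OF lin_q, of "part w" "{d. part w d \<noteq> 0}"] by (simp add: part(3))
  ultimately show "\<omega> (q w) u = 0" by (simp add: linear_sum[OF lin_\<omega>_left])
qed

text \<open>The complement \<open>(J \<oplus> qJ)\<^sup>\<omega>\<close> is a complex with the cohomology of \<open>V\<close>; if its components
  have the dimensions of this cohomology, its differential vanishes.\<close>

lemma q_orth_hom_eq_0:
  assumes iso: "gspace_iso (subquotient V (orth \<omega> J) J) (cohomology V q)"
    and w: "w \<in> orth \<omega> U" "w \<in> V d"
  shows "q w = 0"
proof -
  let ?G = "subquotient V (orth \<omega> J) J" and ?H = "cohomology V q"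
  obtain f where bij: "bij_betw f (hcomp ?G d) (hcomp ?H d)"
    and add: "\<And>x y. x \<in> hcomp ?G d \<Longrightarrow> y \<in> hcomp ?G d \<Longrightarrow> f (vadd ?G x y) = vadd ?H (f x) (f y)"
    and sc: "\<And>c x. x \<in> hcomp ?G d \<Longrightarrow> f (vscale ?G c x) = vscale ?H c (f x)"
    using iso unfolding gspace_iso_def by blast
  define W where "W = orth \<omega> U \<inter> V d"
  have sub_W: "subspace W" unfolding W_def by (rule subspace_inter[OF sub_orth sub_V])
  have WG: "coset J w \<in> hcomp ?G d" if "w \<in> W" for w
    using that J_U unfolding W_def subquotient_def orth_def by auto
  \<comment> \<open>Every class has a closed representative in \<open>W\<close>: in z0 = a + qb + x
    the vector qa lies in \<open>U\<close> and in its complement, so it vanishes, and a with it; qb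
    is exact.\<close>
  have rep: "\<exists>z\<in>W. q z = 0 \<and> h = coset (range q) z" if h: "h \<in> hcomp ?H d" for h
  proof -
    obtain z0 where z0: "q z0 = 0" "z0 \<in> V d" "h = coset (range q) z0"
      using h unfolding cohomology_def subquotient_def by auto
    obtain a b x where 1: "a \<in> J" "b \<in> J" "x \<in> orth \<omega> U" "z0 = a + q b + x" "a \<in> V d" "b \<in> V (d - 1)" "x \<in> V d"
      by (rule decompose_hom[OF z0(2)])
    have "q a = - q x" using z0(1) by (simp add: 1(4) q_simps eq_neg_iff_add_eq_0)
    then have "q a \<in> orth \<omega> U" using q_orth[OF 1(3)] subspace_neg[OF sub_orth] by simp
    then have "q a = 0" using U_orth[OF qJ_U[OF 1(1)]] by blast
    then have "a = 0" using kmap_qJ[OF 1(1)] linear_0[OF lin_kmap] by simp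
    then have "z0 - x = q b" using 1(4) by simp
    then have "h = coset (range q) x" unfolding z0(3) coset_eq_iff[OF range_q] by simp
    moreover have "q x = 0" using \<open>q a = - q x\<close> \<open>q a = 0\<close> by simp
    ultimately show ?thesis using 1 by (auto simp: W_def)
  qed
  obtain B where B: "B \<subseteq> W" "independent B" "W \<subseteq> span B"
    by (rule real_vector.maximal_independent_subset)
  have "\<forall>b\<in>B. \<exists>z\<in>W. q z = 0 \<and> f (coset J b) = coset (range q) z"
    using rep B(1) WG bij_betwE[OF bij] by blast
  then obtain z where z: "\<And>b. b \<in> B \<Longrightarrow> z b \<in> W \<and> q (z b) = 0 \<and> f (coset J b) = coset (range q) (z b)"
    by metis
  obtain g where g: "linear g" "\<And>b. b \<in> B \<Longrightarrow> g b = z b"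
    using linear_independent_extend[OF B(2), of z] by blast
  \<comment> \<open>\<open>gspace_iso\<close> does not mention zero; the zero coset is reached
    through the scalar 0.\<close>
  have f0: "f (coset J 0) = coset (range q) 0"
  proof -
    have 0: "coset J 0 \<in> hcomp ?G d" using WG subspace_0[OF sub_W] by blast
    obtain y where y: "f (coset J 0) = coset (range q) y" using rep bij_betwE[OF bij] 0 by blast
    have "f (vscale ?G 0 (coset J 0)) = vscale ?H 0 (coset (range q) y)"
      unfolding y[symmetric] by (rule sc[OF 0])
    then show ?thesis
      unfolding cohomology_def subquotient_simps(3)[OF sub_J] subquotient_simps(3)[OF range_q] by simp
  qed
  \<comment> \<open>These conditions are linear in w and hold on the basis \<open>B\<close>, so they
    extend to its span.\<close>
  define S where "S = {w \<in> W. g w \<in> W \<and> q (g w) = 0 \<and> f (coset J w) = coset (range q) (g w)}"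
  have "subspace S"
  proof (rule subspaceI)
    show "0 \<in> S"
      by (simp add: S_def linear_0[OF g(1)] q_simps subspace_0[OF sub_W] f0)
    show "x + y \<in> S" if "x \<in> S" "y \<in> S" for x y
      using that add[OF WG WG, of x y]
      by (simp add: S_def linear_add[OF g(1)] q_simps subspace_add[OF sub_W]
          cohomology_def subquotient_simps sub_J range_q)
    show "c *\<^sub>R x \<in> S" if "x \<in> S" for c x
      using that sc[OF WG, of x c]
      by (simp add: S_def linear_scale[OF g(1)] q_simps subspace_scale[OF sub_W]
          cohomology_def subquotient_simps sub_J range_q)
  qed
  moreover have "B \<subseteq> S" using z g(2) B(1) by (auto simp: S_def)
  ultimately have "span B \<subseteq> S" by (rule span_minimal[rotated])
  then have P: "w \<in> W \<and> g w \<in> W \<and> q (g w) = 0 \<and> f (coset J w) = coset (range q) (g w)"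
    if "w \<in> span B" for w
    using that unfolding S_def by blast
  have "inj_on g W"
    unfolding linear_inj_on_iff_eq_0[OF g(1) sub_W]
  proof (intro ballI impI)
    fix x assume x: "x \<in> W" "g x = 0"
    have "f (coset J x) = f (coset J 0)" using P[of x] x B(3) f0 by auto
    then have "coset J x = coset J 0"
      using bij_betw_imp_inj_on[OF bij] WG[OF x(1)] WG[OF subspace_0[OF sub_W]] by (auto dest: inj_onD)
    then have "x \<in> J" unfolding coset_eq_iff[OF sub_J] by simp
    then show "x = 0" using U_orth J_U x(1) unfolding W_def by blast
  qed
  moreover have "g ` W \<subseteq> W" using P B(3) by auto
  \<comment> \<open>\<open>g\<close> lifts the isomorphism to an injection of \<open>W\<close> into
    its closed vectors. By dimension it is onto, so all of \<open>W\<close> is closed.\<close>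
  ultimately have "g ` W = W" by (intro finite_dimensional_inj_image_eq[OF fd g(1) sub_W])
  then obtain x where "x \<in> W" "w = g x" using w unfolding W_def by blast
  then show ?thesis using P B(3) by auto
qed

end

lemma maximal_isotrope_sdr:
  assumes "maximal_isotrope V \<omega> q J"
  shows "sdr V \<omega> q (kmap \<omega> q J)"
proof -
  have J: "nondegenerate_isotrope V \<omega> q J" and iso: "gspace_iso (subquotient V (orth \<omega> J) J) (cohomology V q)"
    using assms unfolding maximal_isotrope_def by auto
  let ?k = "kmap \<omega> q J"
  show ?thesis
  proof
    show "homap (- 1) ?k" by (rule homap_kmap[OF J])
    show "?k (?k v) = 0" for v by (rule kmap_J[OF J kmap_in_J[OF J]])
    show "?k (q (?k v)) = ?k v" for v by (rule kmap_qJ[OF J kmap_in_J[OF J]])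
    show "\<omega> (?k v) w = ksgn d * \<omega> v (?k w)" if "v \<in> V d" for d v w by (rule \<omega>_kmap[OF J that])
    show "q (?k (q v)) = q v" for v
    proof -
      obtain a b w where 1: "a \<in> J" "b \<in> J" "w \<in> orth \<omega> (U J)" "v = a + q b + w" by (rule decompose[OF J])
      have "q (part w d) = 0" for d
        by (rule q_orth_hom_eq_0[OF J iso part_orth[OF J 1(3)] part(1)])
      moreover have "q w = (\<Sum>d | part w d \<noteq> 0. q (part w d))"
        using linear_sum[OF lin_q, of "part w" "{d. part w d \<noteq> 0}"] by (simp add: part(3))
      ultimately have "q v = q a" by (simp add: 1(4) q_simps)
      then show ?thesis using kmap_qJ[OF J 1(1)] by simp
    qed
  qed
qed

end

section \<open>Effective actions\<close>

context dg_symp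
begin

section \<open>Cohomology with its induced form\<close>

lemma \<omega>_closed_q:
  assumes z: "q z = 0" shows "\<omega> z (q u) = 0"
proof -
  have "\<omega> (part z d) (q u) = 0" for d
  proof -
    have "q (part z d) = 0" using part_q[of z d] z linear_0[OF lin_comp] by simp
    then show ?thesis using \<omega>_q[OF part(1)[of z d], of u] by (auto simp: \<omega>_simps ksgn_def split: if_splits)
  qed
  moreover have "\<omega> z (q u) = (\<Sum>d | part z d \<noteq> 0. \<omega> (part z d) (q u))"
    using linear_sum[OF lin_\<omega>_left[of "q u"], of "part z" "{d. part z d \<noteq> 0}"] by (simp add: part(3))
  ultimately show ?thesis by simp
qed

abbreviation cls :: "'v \<Rightarrow> 'v set" where "cls \<equiv> coset (range q)"
abbreviation H :: "'v set gspace" where "H \<equiv> cohomology V q"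
abbreviation \<omega>H :: "'v set \<Rightarrow> 'v set \<Rightarrow> real" where "\<omega>H \<equiv> induced_form \<omega>"

lemma H_simps:
  "h \<in> hcomp H d \<longleftrightarrow> (\<exists>z\<in>V d. q z = 0 \<and> h = cls z)"
  "vadd H (cls u) (cls v) = cls (u + v)" "vscale H c (cls v) = cls (c *\<^sub>R v)" "vzero H = cls 0"
  unfolding cohomology_def subquotient_simps subquotient_simps(2,3)[OF range_q]
  by (auto simp: coset_def)

lemma \<omega>H_cls:
  assumes u: "q u = 0" and v: "q v = 0"
  shows "\<omega>H (cls u) (cls v) = \<omega> u v"
  unfolding induced_form_def
proof (rule the_equality)
  have "\<omega> (q a) v = 0" for a using \<omega>_closed_q[OF v, of a] \<omega>_swap[of "q a" v] by simp
  moreover have "\<omega> (q a) (q b) = 0" for a b by (rule \<omega>_closed_q) simp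
  ultimately show "\<forall>x\<in>cls u. \<forall>y\<in>cls v. \<omega> x y = \<omega> u v"
    by (auto simp: coset_def \<omega>_simps \<omega>_closed_q[OF u])
next
  fix r assume "\<forall>x\<in>cls u. \<forall>y\<in>cls v. \<omega> x y = r"
  moreover have "u \<in> cls u" "v \<in> cls v"
    unfolding coset_def using subspace_0[OF range_q] by force+
  ultimately show "r = \<omega> u v" by metis
qed

end

context sdr
begin

abbreviation p :: "'v \<Rightarrow> 'v set" where "p \<equiv> pmap q k"
abbreviation i :: "'v set \<Rightarrow> 'v" where "i \<equiv> imap \<omega> q k"

lemma p_eq: "p v = cls (v - k (q v))" and p_closed: "q (v - k (q v)) = 0"
  by (simp_all add: pmap_def q_simps)

text \<open>For closed z, adjointness moves 1 - kq to 1 - qk, and z - q(kz) is \<open>pr z\<close>.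
  Non-degeneracy makes it the only solution.\<close>

lemma i_cls:
  assumes z: "q z = 0" shows "i (cls z) = pr z"
  unfolding imap_def
proof (rule the_equality)
  show eq: "\<forall>v. \<omega>H (p v) (cls z) = \<omega> v (pr z)"
    using z by (simp add: p_eq \<omega>H_cls[OF p_closed z] \<omega>_simps \<omega>_kq pr_def k_simps)
  fix w assume "\<forall>v. \<omega>H (p v) (cls z) = \<omega> v w"
  then have "\<omega> (w - pr z) v = 0" for v
    using eq \<omega>_swap[of "w - pr z" v] by (simp add: \<omega>_simps)
  then show "w = pr z" using \<omega>_nondeg[of "w - pr z"] by simp
qed

lemma i_p: "i (p v) = pr v"
  by (simp add: p_eq i_cls[OF p_closed] pr_simps)

lemma i_hom: "h \<in> hcomp H d \<Longrightarrow> i h \<in> V d"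
  unfolding H_simps by (auto simp: i_cls pr_V)

lemma hom_i: "hom_list H hs \<Longrightarrow> homV (map (hmap 0 i) hs)"
  by (rule hom_list_map_hmap) (auto simp: i_hom)

lemma p_hom: "v \<in> V d \<Longrightarrow> p v \<in> hcomp H d"
  unfolding H_simps p_eq using p_closed subspace_diff[OF sub_V _ k_V[OF q_V]] by fastforce

lemma cls_pr: "q z = 0 \<Longrightarrow> cls (pr z) = cls z"
  unfolding coset_eq_iff[OF range_q] by (simp add: pr_def k_simps flip: q_simps(5))

lemma pr_i: "h \<in> hcomp H d \<Longrightarrow> pr (i h) = i h"
  unfolding H_simps by (auto simp: i_cls)

lemma pullback_SF:
  assumes f: "f \<in> SF"
  shows "(\<lambda>hs. if hom_list H hs then f (map (hmap 0 i) hs) else 0) \<in> sym_forms H"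
proof (rule sym_forms_pullback[OF f])
  fix d u v assume "u \<in> hcomp H d" "v \<in> hcomp H d"
  then obtain x y where "x \<in> V d" "y \<in> V d" "q x = 0" "q y = 0" "u = cls x" "v = cls y"
    unfolding H_simps by blast
  moreover from this have "x + y \<in> V d" "q (x + y) = 0" by (simp_all add: subspace_add[OF sub_V] q_simps)
  ultimately show "vadd H u v \<in> hcomp H d \<and> i (vadd H u v) = vadd (whole V) (i u) (i v)"
    by (auto simp: H_simps i_cls pr_simps)
next
  fix d c v assume "v \<in> hcomp H d"
  then obtain x where "x \<in> V d" "q x = 0" "v = cls x"
    unfolding H_simps by blast
  moreover from this have "c *\<^sub>R x \<in> V d" "q (c *\<^sub>R x) = 0" by (simp_all add: subspace_scale[OF sub_V] q_simps)
  ultimately show "vscale H c v \<in> hcomp H d \<and> i (vscale H c v) = vscale (whole V) c (i v)"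
    by (auto simp: H_simps i_cls pr_simps)
qed (simp add: i_hom)

lemma pullback_WC:
  assumes F: "F \<in> WC" shows "pullback H i F \<in> weight_completed H"
  unfolding weight_completed_iff
proof (intro conjI allI)
  show "pullback H i F g \<in> sym_forms H" for g
    unfolding pullback_def restrict_hom_def by (rule pullback_SF[OF WC_SF[OF F]])
  show "hbar_bounded (pullback H i F)"
    unfolding hbar_bounded_def
  proof
    fix w
    obtain m where m: "\<And>g xs. weight g xs = w \<Longrightarrow> F g xs \<noteq> 0 \<Longrightarrow> m \<le> g"
      using assms(1) unfolding weight_completed_iff hbar_bounded_def by blast
    show "\<exists>m. \<forall>g xs. weight g xs = w \<longrightarrow> pullback H i F g xs \<noteq> 0 \<longrightarrow> m \<le> g"
    proof (intro exI[of _ m] allI impI)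
      fix g and xs :: "'v set hvec list"
      assume "weight g xs = w" "pullback H i F g xs \<noteq> 0"
      then show "m \<le> g" using m[of "map (hmap 0 i) xs" g]
        by (simp add: pullback_def restrict_hom_def split: if_splits)
    qed
  qed
qed

text \<open>A fold over cosets fixes a vector only up to exact terms. It is followed by a closed
  representative, whose image under \<open>pr\<close> is an honest sum in V.\<close>

lemma foldr_cls:
  assumes "\<forall>x\<in>set ks. snd (fst x) \<in> cls ` {z. q z = 0}"
  shows "\<exists>z. q z = 0 \<and> foldr (\<lambda>(a, b) s. vadd H (vscale H (c b) (snd a)) s) ks (vzero H) = cls z \<and>
    pr z = (\<Sum>(a, b)\<leftarrow>ks. c b *\<^sub>R i (snd a))"
  using assms
proof (induction ks)
  case Nil
  show ?case by (rule exI[of _ 0]) (simp add: H_simps q_simps pr_simps)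
next
  case (Cons ab ks)
  obtain a b where ab: "ab = (a, b)" by (cases ab)
  obtain z where z: "q z = 0" "foldr (\<lambda>(a, b) s. vadd H (vscale H (c b) (snd a)) s) ks (vzero H) = cls z"
    "pr z = (\<Sum>(a, b)\<leftarrow>ks. c b *\<^sub>R i (snd a))"
    using Cons.IH Cons.prems by (metis list.set_intros(2))
  obtain y where y: "q y = 0" "snd a = cls y" using Cons.prems by (auto simp: ab)
  show ?case
    by (rule exI[of _ "c b *\<^sub>R y + z"]) (use z y in \<open>simp add: ab H_simps q_simps pr_simps i_cls\<close>)
qed

text \<open>The Casimir element of V is pushed forward by \<open>p\<close> on both legs. Existence
  guarantees that the choice in \<open>BV\<close> picks a genuine Casimir list.\<close>

lemma casimir_H_exists: "\<exists>ks. casimir H \<omega>H ks"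
proof -
  obtain cs where cs: "set cs = cas" "distinct cs" using finite_distinct_list[OF finite_cas] by blast
  let ?ks = "map (\<lambda>(a, b). (hmap 0 p a, hmap 0 p b)) cs"
  have "casimir H \<omega>H ?ks"
    unfolding casimir_def
  proof (intro conjI allI ballI)
    show "case x of (a, b) \<Rightarrow> hom_list H [a, b]" if "x \<in> set ?ks" for x
      using that cas_V cs(1) by (auto simp: p_hom)
  next
    fix d h assume "h \<in> hcomp H d"
    then obtain y where y: "y \<in> V d" "q y = 0" "h = cls y" unfolding H_simps by blast
    have "\<forall>x\<in>set ?ks. snd (fst x) \<in> cls ` {z. q z = 0}"
      using p_closed by (auto simp: p_eq)
    from foldr_cls[of ?ks "\<lambda>b. \<omega>H (snd b) h", OF this] obtain z where z: "q z = 0"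
      "foldr (\<lambda>(a, b) s. vadd H (vscale H (\<omega>H (snd b) h) (snd a)) s) ?ks (vzero H) = cls z"
      "pr z = (\<Sum>(a, b)\<leftarrow>?ks. \<omega>H (snd b) h *\<^sub>R i (snd a))" by blast
    have b: "\<omega>H (p b) h = \<omega> b (pr y)" for b
      using \<omega>H_cls[OF p_closed y(2), of b] y(2)
      by (simp add: y(3) p_eq \<omega>_simps \<omega>_kq pr_def k_simps)
    have "pr z = (\<Sum>(a, b)\<in>cas. \<omega> (snd b) (pr y) *\<^sub>R pr (snd a))"
      unfolding z(3) by (simp add: cs sum_list_distinct_conv_sum_set split_def o_def b i_p)
    also have "\<dots> = pr (\<Sum>(a, b)\<in>cas. \<omega> (snd b) (pr y) *\<^sub>R snd a)"
      by (simp add: linear_sum[OF lin_pr] pr_simps split_def)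
    also have "\<dots> = ksgn d *\<^sub>R pr y"
      by (simp add: cas_rep[OF pr_V[OF y(1)]] pr_simps)
    finally have pz: "pr z = ksgn d *\<^sub>R pr y" .
    have "cls z = cls (ksgn d *\<^sub>R pr y)" using cls_pr[OF z(1)] pz by simp
    then have "vscale H (ksgn d) (cls z) = cls (pr y)" by (simp add: H_simps)
    then show "vscale H (ksgn d) (foldr (\<lambda>(a, b) s. vadd H (vscale H (\<omega>H (snd b) h) (snd a)) s) ?ks (vzero H)) = h"
      using z(2) cls_pr[OF y(2)] y(3) by simp
  qed
  then show ?thesis by blast
qed

text \<open>Carried to V by \<open>i\<close>, a Casimir list of the cohomology induces the operator
  v to (-1)^|v| \<open>pr v\<close>. As \<open>pr\<close> is self-adjoint and idempotent, this is
  the tensor \<open>cas\<close> with \<open>pr\<close> on both legs, so contracting with it is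
  \<Delta> after pullback along \<open>pr\<close>.\<close>

lemma BV_H:
  assumes F: "F \<in> WC" and hs: "hom_list H hs"
  shows "BV H \<omega>H (pullback H i F) g hs = BV_form (pull pr (F g)) (map (hmap 0 i) hs)"
proof -
  define ks where "ks = (SOME ks. casimir H \<omega>H ks)"
  have ks: "casimir H \<omega>H ks" unfolding ks_def using casimir_H_exists by (rule someI_ex)
  have ksH: "snd a \<in> hcomp H (fst a)" "snd b \<in> hcomp H (fst b)" if "(a, b) \<in> set ks" for a b
    using ks that unfolding casimir_def by auto
  let ?ys = "map (hmap 0 i) hs"
  let ?ks = "map (\<lambda>(a, b). (hmap 0 i a, hmap 0 i b)) ks"
  note FS = WC_SF[OF F]
  have N: "(\<Sum>(a, b)\<leftarrow>?ks. \<omega> (snd b) v *\<^sub>R snd a) = ksgn d *\<^sub>R pr v" if v: "v \<in> V d" for d v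
  proof -
    have "\<forall>x\<in>set ks. snd (fst x) \<in> cls ` {z. q z = 0}"
      using ksH(1) unfolding H_simps by fastforce
    from foldr_cls[of ks "\<lambda>b. \<omega>H (snd b) (p v)", OF this] obtain z where z: "q z = 0"
      "foldr (\<lambda>(a, b) s. vadd H (vscale H (\<omega>H (snd b) (p v)) (snd a)) s) ks (vzero H) = cls z"
      "pr z = (\<Sum>(a, b)\<leftarrow>ks. \<omega>H (snd b) (p v) *\<^sub>R i (snd a))" by blast
    have "vscale H (ksgn d) (foldr (\<lambda>(a, b) s. vadd H (vscale H (\<omega>H (snd b) (p v)) (snd a)) s) ks (vzero H)) = p v"
      using ks p_hom[OF v] unfolding casimir_def by blast
    then have "cls (ksgn d *\<^sub>R z) = p v" by (simp only: z(2) H_simps(3))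
    then have "pr (ksgn d *\<^sub>R z) = pr v" using i_cls[of "ksgn d *\<^sub>R z"] z(1) i_p[of v] by (simp add: q_simps)
    then have "ksgn d *\<^sub>R ksgn d *\<^sub>R pr z = ksgn d *\<^sub>R pr v" by (simp add: pr_simps)
    then have "pr z = ksgn d *\<^sub>R pr v" by (simp only: scaleR_scaleR ksgn_square scaleR_one)
    moreover have "(\<Sum>(a, b)\<leftarrow>?ks. \<omega> (snd b) v *\<^sub>R snd a) = (\<Sum>(a, b)\<leftarrow>ks. \<omega>H (snd b) (p v) *\<^sub>R i (snd a))"
      unfolding map_map
    proof (rule arg_cong[of _ _ sum_list], rule map_cong[OF refl], clarify)
      fix d' a e b assume "((d', a), (e, b)) \<in> set ks"
      then obtain y where y: "q y = 0" "b = cls y" using ksH(2) unfolding H_simps by fastforce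
      have "\<omega>H b (p v) = \<omega> (i b) v"
        by (simp add: y p_eq \<omega>H_cls[OF y(1) p_closed] i_cls[OF y(1)] \<omega>_simps \<omega>_qk pr_def k_simps)
      then show "((\<lambda>(a, b). \<omega> (snd b) v *\<^sub>R snd a) \<circ> (\<lambda>(a, b). (hmap 0 i a, hmap 0 i b))) ((d', a), (e, b)) =
          \<omega>H (snd (e, b)) (p v) *\<^sub>R i (snd (d', a))" by simp
    qed
    ultimately show ?thesis using z(3) by simp
  qed
  have "(\<Sum>(a, b)\<leftarrow>ks. pullback H i F g (b # a # hs)) = (\<Sum>(a, b)\<leftarrow>?ks. F g (b # a # ?ys))"
    unfolding map_map
    by (rule arg_cong[of _ _ sum_list], rule map_cong[OF refl])
      (use ksH hs in \<open>auto simp: pullback_def restrict_hom_def\<close>)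
  also have "\<dots> = (\<Sum>(a, b)\<in>cas. ksgn (fst b) * F g (a # (fst b + 0, ksgn (fst b) *\<^sub>R pr (snd b)) # ?ys))"
  proof (rule contraction[where \<beta> = "\<lambda>a b. F g (b # a # ?ys)"])
    show "snd a \<in> V (fst a) \<and> snd b \<in> V (fst b)" if "(a, b) \<in> set ?ks" for a b
      using that ksH i_hom by auto
  qed (use N in \<open>auto simp: SF_hlin'[OF FS] pr_V subspace_scale[OF sub_V]\<close>)
  \<comment> \<open>\<open>pr\<close> is doubled so that it has the shape of a map times its adjoint
    in \<open>sum_cas_even\<close>.\<close>
  also have "\<dots> = (\<Sum>(a, b)\<in>cas. F g (a # (fst b, pr (pr (snd b))) # ?ys))"
  proof (rule sum.cong[OF refl], clarify)
    fix d a e b assume c: "((d, a), (e, b)) \<in> cas"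
    show "ksgn (fst (e, b)) * F g ((d, a) # (fst (e, b) + 0, ksgn (fst (e, b)) *\<^sub>R pr (snd (e, b))) # ?ys) =
        F g ((d, a) # (fst (e, b), pr (pr (snd (e, b)))) # ?ys)"
      using SF_scale[OF FS pr_V, of b e g "[(d, a)]"] cas_V(2)[OF c] by simp
  qed
  also have "\<dots> = (\<Sum>(a, b)\<in>cas. F g (hmap 0 pr b # hmap 0 pr a # ?ys))"
    by (rule sum_cas_even[OF FS homap_pr homap_pr \<omega>_pr, symmetric])
  also have "\<dots> = (\<Sum>(a, b)\<in>cas. pull pr (F g) (b # a # ?ys))"
  proof (rule sum.cong[OF refl], clarify)
    fix d a e b assume c: "((d, a), (e, b)) \<in> cas"
    have "map (hmap 0 pr) ?ys = ?ys"
      using hs pr_i by (auto simp: hmap_def hom_list_def)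
    then show "F g (hmap 0 pr (e, b) # hmap 0 pr (d, a) # ?ys) = pull pr (F g) ((e, b) # (d, a) # ?ys)"
      using cas_V[OF c] hom_i[OF hs] by (simp add: pull_def del: map_map)
  qed
  finally show ?thesis by (simp add: BV_def BV_form_def ks_def)
qed

lemma BV_H_not_hom: "\<not> hom_list H hs \<Longrightarrow> BV H \<omega>H (pullback H i F) g hs = 0"
  by (simp add: BV_def pullback_def restrict_hom_def case_prod_unfold)

lemma perturbed_P_eq:
  assumes k: "kmap \<omega> q J = k" and F: "F \<in> WC"
  shows "perturbed_P V \<omega> q J F = pullback H i (R F)"
proof -
  define T' where "T' = (\<lambda>F. - hbar_pow 1 (BV (whole V) \<omega> (Kop V (\<lambda>v. i (p v)) k F)))"
  have T: "T' F = T F" if "\<And>g. F g \<in> SF" for F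
  proof (intro ext)
    fix g xs
    have "BV (whole V) \<omega> (\<lambda>g. K (F g)) = (\<lambda>g. BV_form (K (F g)))"
      by (rule BV_eq_BV_form[OF K_SF[OF that]])
    then show "T' F g xs = T F g xs"
      by (simp add: T'_def i_p Kop_eq[OF that] hbar_pow_def T_def)
  qed
  have "(T' ^^ j) F = (T ^^ j) F" for j
    by (induction j) (simp_all add: T[OF T_pow_SF[OF WC_SF[OF F]]])
  then show ?thesis
    by (simp add: perturbed_P_def k Let_def R_def flip: T'_def)
qed

text \<open>In weights at most 0 the series is the constant 1, and \<open>T\<close> annihilates it
  because only lists of length at least 2 are consulted. As \<open>T\<close> preserves weight, the
  logarithm is later taken of a series that starts with 1.\<close>

lemma R_low_weight:
  assumes F: "\<And>g xs. weight g xs \<le> 0 \<Longrightarrow> F g xs = series_one g xs"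
    and "weight g xs \<le> 0"
  shows "R F g xs = series_one g xs"
proof -
  have z: "(T ^^ Suc j) F g xs = 0" if "weight g xs \<le> 0" for j g xs
    using that
  proof (induction j arbitrary: g xs)
    case 0
    have "T F g xs = T series_one g xs" by (rule T_local) (use F 0 in auto)
    moreover have "K (series_one (g - 1)) ys = 0" if "length ys = length xs + 2" for ys
      by (rule K_zero) (use that in \<open>auto simp: series_one_def\<close>)
    ultimately show ?case using BV_form_zero[of xs "K (series_one (g - 1))"] by (simp add: T_def)
  next
    case (Suc j)
    have "T ((T ^^ Suc j) F) g xs = T (\<lambda>g xs. 0) g xs" by (rule T_local) (use Suc in auto)
    moreover have "T (\<lambda>g xs. 0) g xs = 0" using T_pow_zero[of xs 1 "\<lambda>g xs. 0" g] by simp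
    ultimately show ?case by simp
  qed
  have "(T ^^ j) F g xs = 0" if "j \<ge> 1" for j
    using z[OF assms(2), of "j - 1"] that by (cases j) simp_all
  then have "R F g xs = (\<Sum>j<1. (T ^^ j) F g xs)" by (rule R_eq_sum)
  then show ?thesis using F assms(2) by simp
qed

lemma weight_ge_pullback_R:
  assumes F: "\<And>g xs. weight g xs \<le> 0 \<Longrightarrow> F g xs = series_one g xs"
  shows "weight_ge 1 (pullback H i (R F) - series_one)"
  unfolding weight_ge_def
proof (intro allI impI, rule ccontr)
  fix g and hs :: "'v set hvec list"
  assume n: "(pullback H i (R F) - series_one) g hs \<noteq> 0" and "\<not> 1 \<le> weight g hs"
  then have w: "int (length (map (hmap 0 i) hs)) + 2 * g \<le> 0" by simp
  have "pullback H i (R F) g hs = series_one g hs"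
    using R_low_weight[OF F w] by (auto simp: pullback_def restrict_hom_def series_one_def)
  then show False using n by simp
qed

end

text \<open>\<open>R_compare\<close> is evaluated on vectors \<open>B.i h\<close>: the Q term
  vanishes because they are closed and projected, the doubly pulled back term becomes the first
  half-density, and the last is \<Delta>_H of a pullback.\<close>

lemma (in sdr2) pullback_R_difference:
  assumes E: "E \<in> WC" and closed: "\<And>g xs. Qf (E g) xs + BV_form (E (g - 1)) xs = 0"
  shows "\<exists>F\<in>weight_completed H. pullback H i (R E) - pullback H B.i (B.R E) = BV H \<omega>H F"
proof -
  obtain Y where Y: "Y \<in> WC" and eq: "\<And>g xs. B.R E g xs =
      pull B.pr (pull pr (R E g)) xs + Qf (Y g) xs + BV_form (pull B.pr (Y (g - 1))) xs"
    using R_compare[OF E closed] by blast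
  \<comment> \<open>The sign orients the difference as first minus second; the shift absorbs the
    hbar in front of \<Delta>_H.\<close>
  define Y2 where "Y2 = (\<lambda>g xs. - Y (g - 1) xs)"
  have Y2: "Y2 \<in> WC"
    unfolding weight_completed_iff
  proof (intro conjI allI)
    show "Y2 g \<in> SF" for g
      using sym_forms_scale[OF WC_SF[OF Y, of "g - 1"], of "- 1"] by (simp add: Y2_def)
    show "hbar_bounded Y2"
      unfolding hbar_bounded_def
    proof
      fix w
      obtain m where m: "\<And>g xs. weight g xs = w - 2 \<Longrightarrow> Y g xs \<noteq> 0 \<Longrightarrow> m \<le> g"
        using Y unfolding weight_completed_iff hbar_bounded_def by blast
      have "m \<le> g" if "weight g xs = w" "Y2 g xs \<noteq> 0" for g xs
        using m[of xs "g - 1"] that by (simp add: Y2_def)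
      then show "\<exists>m. \<forall>g xs. weight g xs = w \<longrightarrow> Y2 g xs \<noteq> 0 \<longrightarrow> m \<le> g" by blast
    qed
  qed
  have "(pullback H i (R E) - pullback H B.i (B.R E)) g hs = BV H \<omega>H (pullback H B.i Y2) g hs" for g hs
  proof (cases "hom_list H hs")
    case True
    let ?ys = "map (hmap 0 B.i) hs"
    have ys: "homV ?ys" by (rule B.hom_i[OF True])
    have inv: "map (hmap 0 B.pr) ?ys = ?ys"
      using True B.pr_i by (auto simp: hmap_def hom_list_def)
    \<comment> \<open>For closed z, \<open>B.pr z\<close> differs from z by an exact vector, which
      \<open>pr\<close> annihilates.\<close>
    have pri: "pr (B.i h) = i h" if "h \<in> hcomp H d" for h d
      using that unfolding H_simps by (auto simp: i_cls B.i_cls B.pr_def pr_simps B.k_simps)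
    have pr: "map (hmap 0 pr) ?ys = map (hmap 0 i) hs"
      using True pri by (auto simp: hmap_def hom_list_def)
    have 1: "pull B.pr (pull pr (R E g)) ?ys = R E g (map (hmap 0 i) hs)"
      using ys inv pr by (simp only: pull_def if_True)
    have "pull B.pr (Qf (Y g)) ?ys = 0" by (rule B.pull_Qf[OF WC_SF[OF Y]])
    then have 2: "Qf (Y g) ?ys = 0" using ys inv by (simp only: pull_def if_True)
    have "pull B.pr (Y2 g) = (\<lambda>xs. - pull B.pr (Y (g - 1)) xs)"
      by (auto simp: pull_def Y2_def)
    then have 3: "BV_form (pull B.pr (Y2 g)) ?ys = - BV_form (pull B.pr (Y (g - 1))) ?ys"
      by (simp add: BV_form_def split_def sum_negf)
    show ?thesis
      unfolding B.BV_H[OF Y2 True] using eq[of g ?ys] 1 2 3 True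
      by (simp add: pullback_def restrict_hom_def)
  next
    case False
    then show ?thesis by (simp add: B.BV_H_not_hom[OF False]) (simp add: pullback_def restrict_hom_def)
  qed
  then have "pullback H i (R E) - pullback H B.i (B.R E) = BV H \<omega>H (pullback H B.i Y2)"
    by (intro ext)
  then show ?thesis using B.pullback_WC[OF Y2] by blast
qed

lemma (in dg_symp) quantum_master_action_exp:
  assumes "quantum_master_action V \<omega> q S"
  defines "E \<equiv> series_exp (hbar_pow (- 1) (S - S_free V \<omega> q))"
  shows "E \<in> WC" and "Qf (E g) xs + BV_form (E (g - 1)) xs = 0"
    and "weight g xs \<le> 0 \<Longrightarrow> E g xs = series_one g xs"
proof -
  define I where "I = S - S_free V \<omega> q"
  have IF: "I \<in> formal_functions (whole V)"
    and Iw: "\<And>g xs. I g xs \<noteq> 0 \<Longrightarrow> weight g xs \<ge> 3"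
    and QME: "\<And>g xs. Qop (whole V) q E g xs + hbar_pow 1 (BV (whole V) \<omega> E) g xs = 0"
    using assms(1) unfolding quantum_master_action_def Let_def E_def I_def by blast+
  have sym: "hbar_pow (- 1) I g \<in> SF" for g
    using IF unfolding formal_functions_def hbar_pow_def by simp
  have neg: "I g xs = 0" if "g < 0" for g xs using IF that unfolding formal_functions_def by blast
  \<comment> \<open>Division by hbar lowers the weight by 2, from at least 3 to at least 1.\<close>
  have weight_ge: "weight_ge 1 (hbar_pow (- 1) I)"
    unfolding weight_ge_def hbar_pow_def using Iw by fastforce
  \<comment> \<open>Only g = -1 needs an argument: such terms come from order 0 of the interaction
    and have length at least 3.\<close>
  have bd: "0 \<le> int (length xs) + 3 * g" if "hbar_pow (- 1) I g xs \<noteq> 0" for g xs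
    using that Iw[of "g + 1" xs] neg[of "g + 1" xs] unfolding hbar_pow_def by force
  show E: "E \<in> WC"
    unfolding E_def I_def[symmetric] by (rule weight_completed_series_exp[OF sym weight_ge bd])
  show "Qf (E g) xs + BV_form (E (g - 1)) xs = 0"
    using QME[of g xs] by (simp add: Qop_eq BV_eq_BV_form[OF WC_SF[OF E]] hbar_pow_def)
  show "weight g xs \<le> 0 \<Longrightarrow> E g xs = series_one g xs"
    unfolding E_def I_def[symmetric] by (rule series_exp_low_weight[OF weight_ge])
qed

lemma (in dg_symp) effective_action_exp:
  assumes S: "quantum_master_action V \<omega> q S" and J: "maximal_isotrope V \<omega> q J"
  defines "E \<equiv> series_exp (hbar_pow (- 1) (S - S_free V \<omega> q))" and "k \<equiv> kmap \<omega> q J"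
  shows "series_exp (hbar_pow (- 1) (effective_action V \<omega> q S J)) =
    pullback H (imap \<omega> q k) (sdr.R V \<omega> q k E)"
proof -
  interpret sdr V \<omega> q k unfolding k_def by (rule maximal_isotrope_sdr[OF J])
  have "effective_action V \<omega> q S J = hbar_pow 1 (series_log (pullback H i (R E)))"
    unfolding effective_action_def E_def[symmetric]
    using perturbed_P_eq[of J E] quantum_master_action_exp(1)[OF S] by (simp add: E_def k_def)
  then have "hbar_pow (- 1) (effective_action V \<omega> q S J) = series_log (pullback H i (R E))"
    by (simp add: hbar_pow_def)
  moreover have "weight_ge 1 (pullback H i (R E) - series_one)"
    by (rule weight_ge_pullback_R) (simp add: E_def quantum_master_action_exp(3)[OF S])
  ultimately show ?thesis by (simp add: series_exp_log)
qed

theorem corollary5p6: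
  fixes V :: "int \<Rightarrow> 'v::real_vector set"
    and \<omega> :: "'v \<Rightarrow> 'v \<Rightarrow> real"
    and q :: "'v \<Rightarrow> 'v"
    and S :: "'v series"
    and J J' :: "'v set"
  assumes "finite_dimensional TYPE('v)"
    and "dg_shifted_symplectic V \<omega> q"
    and "quantum_master_action V \<omega> q S"
    and "maximal_isotrope V \<omega> q J"
    and "maximal_isotrope V \<omega> q J'"
  shows "homotopic_half_densities (cohomology V q) (induced_form \<omega>)
    (series_exp (hbar_pow (- 1) (effective_action V \<omega> q S J)))
    (series_exp (hbar_pow (- 1) (effective_action V \<omega> q S J')))"
proof -
  interpret dg_symp V \<omega> q by unfold_locales (rule assms)+
  define k where "k = kmap \<omega> q J"
  define k' where "k' = kmap \<omega> q J'"
  interpret A: sdr V \<omega> q k unfolding k_def by (rule maximal_isotrope_sdr[OF assms(4)])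
  interpret B: sdr V \<omega> q k' unfolding k'_def by (rule maximal_isotrope_sdr[OF assms(5)])
  interpret sdr2 V \<omega> q k k' ..
  define E where "E = series_exp (hbar_pow (- 1) (S - S_free V \<omega> q))"
  note E = quantum_master_action_exp[OF assms(3), folded E_def]
  note exp = effective_action_exp[OF assms(3), folded E_def]
  have closed_A: "BV H \<omega>H (pullback H A.i (A.R E)) g hs = 0" for g hs
    by (cases "hom_list H hs")
      (simp_all add: A.BV_H[OF A.R_WC[OF E(1)]] A.R_closed(1)[OF E(1,2)] A.BV_H_not_hom)
  have closed_B: "BV H \<omega>H (pullback H B.i (B.R E)) g hs = 0" for g hs
    by (cases "hom_list H hs")
      (simp_all add: B.BV_H[OF B.R_WC[OF E(1)]] B.R_closed(1)[OF E(1,2)] B.BV_H_not_hom)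
  show ?thesis
    unfolding homotopic_half_densities_def exp[OF assms(4), folded k_def] exp[OF assms(5), folded k'_def]
    using A.pullback_WC[OF A.R_WC[OF E(1)]] B.pullback_WC[OF B.R_WC[OF E(1)]] closed_A closed_B
      pullback_R_difference[OF E(1,2)] by blast
qed

end
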